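(* Let $M$ be a Riemannian manifold, let $\varphi\in\Omega^p(M)$ be a parallel calibration, and let $N\subset M$ be a $\varphi$-critical submanifold, with critical value $\varphi_o$ (the constant such that $\varphi|_N=\varphi_o\,\mathrm{vol}_N$). If $\varphi_o\neq 0$, then $N$ is a minimal submanifold of $M$ (i.e. its mean curvature vector vanishes identically).
   Context: For a Euclidean vector space $V$, $\mathrm{Gr}_o(p,V)=\{e_1\wedge\cdots\wedge e_p : e_1,\dots,e_p \text{ orthonormal in } V\}\subset\bigwedge^pV$ is the set of unit decomposable $p$-vectors (oriented $p$-planes); $\mathrm{Gr}_o(p,TM)$ is the bundle over $M$ with fibres $\mathrm{Gr}_o(p,T_xM)$. For a $p$-form $\varphi$ and $\xi=e_1\wedge\cdots\wedge e_p$, put $\varphi(\xi)=\varphi(e_1,\dots,e_p)$. A calibration is a closed $p$-form $\varphi\in\Omega^p(M)$ with $\varphi\le 1$ on $\mathrm{Gr}_o(p,TM)$. It is parallel if $\nabla\varphi=0$ for the Levi-Civita connection. $C(\varphi)_x\subset\mathrm{Gr}_o(p,T_xM)$ is the set of critical points of the function $\varphi_x:\mathrm{Gr}_o(p,T_xM)\to\mathbb{R}$. An oriented $p$-dimensional submanifold $N\subset M$ is $\varphi$-critical if $T_xN\in C(\varphi)_x$ for all $x\in N$ (where $T_xN$ denotes the unit $p$-vector of the oriented tangent space). For a $\varphi$-critical $N$ one has $\varphi|_N=\varphi_o\,\mathrm{vol}_N$ with $\varphi_o$ a constant, called the critical value of $\varphi$ on $N$; here $\mathrm{vol}_N$ is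 the Riemannian volume form of $N$. *)

theory Defs
  imports "HOL-Analysis.Analysis" "HOL-Library.Function_Algebras"
begin

text \<open>
  Pointwise real vector space structure on functions; it is used for tangent vectors
  (functions on charts, see below) and for multivectors (functionals on forms).
\<close>

instantiation "fun" :: (type, real_vector) real_vector
begin

definition scaleR_fun_def: "scaleR a f = (\<lambda>x. a *\<^sub>R f x)"

instance
  by standard (auto simp: scaleR_fun_def fun_eq_iff algebra_simps)

end


section \<open>Smooth manifolds\<close>

primrec Ck_on :: "nat \<Rightarrow> 'e::euclidean_space set \<Rightarrow> ('e \<Rightarrow> 'b::real_normed_vector) \<Rightarrow> bool" where
  "Ck_on 0 S f \<longleftrightarrow> continuous_on S f"
| "Ck_on (Suc k) S f \<longleftrightarrow>
     (\<exists>f'. (\<forall>y\<in>S. (f has_derivative f' y) (at y)) \<and> (\<forall>u. Ck_on k S (\<lambda>y. f' y u)))"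

text \<open>\<open>C\<^sup>\<infinity>\<close> on a set \<open>S\<close>, which is open in all uses.\<close>

definition smooth_on :: "'e::euclidean_space set \<Rightarrow> ('e \<Rightarrow> 'b::real_normed_vector) \<Rightarrow> bool" where
  "smooth_on S f \<longleftrightarrow> (\<forall>k. Ck_on k S f)"

text \<open>A chart is a domain together with a coordinate map, of which only the values on the
  domain matter.\<close>

type_synonym ('a, 'e) chart = "'a set \<times> ('a \<Rightarrow> 'e)"

abbreviation chart_inv :: "('a, 'e) chart \<Rightarrow> 'e \<Rightarrow> 'a" where
  "chart_inv c \<equiv> inv_into (fst c) (snd c)"

text \<open>The topology is part of the data; the atlas need not be maximal, and the dimension is
  that of the model space \<open>'e\<close>.\<close>

record ('a, 'e) manifold =
  mtop :: "'a topology"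
  atlas :: "('a, 'e) chart set"

abbreviation points :: "('a, 'e) manifold \<Rightarrow> 'a set" where
  "points M \<equiv> topspace (mtop M)"

definition second_countable_top :: "'a topology \<Rightarrow> bool" where
  "second_countable_top X \<longleftrightarrow>
     (\<exists>\<B>. countable \<B> \<and> (\<forall>B\<in>\<B>. openin X B) \<and>
        (\<forall>U x. openin X U \<and> x \<in> U \<longrightarrow> (\<exists>B\<in>\<B>. x \<in> B \<and> B \<subseteq> U)))"

definition smooth_manifold :: "('a, 'e::euclidean_space) manifold \<Rightarrow> bool" where
  "smooth_manifold M \<longleftrightarrow>
     Hausdorff_space (mtop M) \<and> second_countable_top (mtop M) \<and>
     points M = \<Union> (fst ` atlas M) \<and>
     (\<forall>c\<in>atlas M. openin (mtop M) (fst c) \<and> open (snd c ` fst c) \<and>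
        homeomorphic_map (subtopology (mtop M) (fst c)) (top_of_set (snd c ` fst c)) (snd c)) \<and>
     (\<forall>c\<in>atlas M. \<forall>d\<in>atlas M.
        smooth_on (snd c ` (fst c \<inter> fst d)) (snd d \<circ> chart_inv c))"

definition charts_at :: "('a, 'e) manifold \<Rightarrow> 'a \<Rightarrow> ('a, 'e) chart set" where
  "charts_at M x = {c \<in> atlas M. x \<in> fst c}"


section \<open>Tangent vectors, derivatives, vector fields\<close>

text \<open>
  A tangent vector at \<open>x\<close> is the family of its coordinate representations in all charts
  around \<open>x\<close>, related by the derivatives of the coordinate changes (and \<open>0\<close> at all other
  charts). In this way \<open>T\<^sub>xM\<close> is a linear subspace of a function space.
\<close>

type_synonym ('a, 'e) tvec = "('a, 'e) chart \<Rightarrow> 'e"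

definition tangent_space ::
    "('a, 'e::euclidean_space) manifold \<Rightarrow> 'a \<Rightarrow> ('a, 'e) tvec set" where
  "tangent_space M x = {v.
     (\<forall>c\<in>charts_at M x. \<forall>d\<in>charts_at M x.
        v d = frechet_derivative (snd d \<circ> chart_inv c) (at (snd c x)) (v c)) \<and>
     (\<forall>c. c \<notin> charts_at M x \<longrightarrow> v c = 0)}"

text \<open>The tangent vector at \<open>x\<close> with coordinate representation \<open>u\<close> in the chart \<open>c\<close>.\<close>

definition coord_vec ::
    "('a, 'e::euclidean_space) manifold \<Rightarrow> ('a, 'e) chart \<Rightarrow> 'a \<Rightarrow> 'e \<Rightarrow> ('a, 'e) tvec" where
  "coord_vec M c x u = (\<lambda>d. if d \<in> charts_at M x
     then frechet_derivative (snd d \<circ> chart_inv c) (at (snd c x)) u else 0)"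

text \<open>Directional derivative \<open>v(f)\<close> of a vector-valued function. It does not depend on the
  chosen chart when \<open>v\<close> is tangent and \<open>f\<close> is differentiable at \<open>x\<close>.\<close>

definition dir_deriv ::
    "('a, 'e::euclidean_space) manifold \<Rightarrow> 'a \<Rightarrow> ('a, 'e) tvec \<Rightarrow> ('a \<Rightarrow> 'b::real_normed_vector) \<Rightarrow> 'b" where
  "dir_deriv M x v f = (let c = (SOME c. c \<in> charts_at M x)
     in frechet_derivative (f \<circ> chart_inv c) (at (snd c x)) (v c))"

definition smooth_field ::
    "('a, 'e::euclidean_space) manifold \<Rightarrow> 'a set \<Rightarrow> ('a \<Rightarrow> ('a, 'e) tvec) \<Rightarrow> bool" where
  "smooth_field M W Y \<longleftrightarrow> (\<forall>x\<in>W. Y x \<in> tangent_space M x) \<and>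
     (\<forall>c\<in>atlas M. smooth_on (snd c ` (W \<inter> fst c)) (\<lambda>y. Y (chart_inv c y) c))"


section \<open>Riemannian metrics and the Levi-Civita connection\<close>

type_synonym ('a, 'e) metric = "'a \<Rightarrow> ('a, 'e) tvec \<Rightarrow> ('a, 'e) tvec \<Rightarrow> real"

definition coord_metric ::
    "('a, 'e::euclidean_space) manifold \<Rightarrow> ('a, 'e) metric \<Rightarrow> ('a, 'e) chart \<Rightarrow> 'e \<Rightarrow> 'e \<Rightarrow> 'e \<Rightarrow> real" where
  "coord_metric M g c u v y =
     g (chart_inv c y) (coord_vec M c (chart_inv c y) u) (coord_vec M c (chart_inv c y) v)"

definition riemannian_manifold ::
    "('a, 'e::euclidean_space) manifold \<Rightarrow> ('a, 'e) metric \<Rightarrow> bool" where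
  "riemannian_manifold M g \<longleftrightarrow> smooth_manifold M \<and>
     (\<forall>x\<in>points M. \<forall>u\<in>tangent_space M x. \<forall>v\<in>tangent_space M x. \<forall>w\<in>tangent_space M x. \<forall>a b.
        g x (a *\<^sub>R u + b *\<^sub>R v) w = a * g x u w + b * g x v w) \<and>
     (\<forall>x\<in>points M. \<forall>u\<in>tangent_space M x. \<forall>v\<in>tangent_space M x. g x u v = g x v u) \<and>
     (\<forall>x\<in>points M. \<forall>u\<in>tangent_space M x. u \<noteq> 0 \<longrightarrow> g x u u > 0) \<and>
     (\<forall>c\<in>atlas M. \<forall>u v. smooth_on (snd c ` fst c) (coord_metric M g c u v))"

text \<open>
  The connection coefficients in the chart \<open>c\<close> at \<open>x\<close>: \<open>christoffel M g c x u v\<close> is the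
  coordinate representation of \<open>\<nabla>\<^sub>U V\<close> for the fields \<open>U\<close>, \<open>V\<close> with constant coordinates \<open>u\<close>, \<open>v\<close>.
  The Levi-Civita connection is determined by being torsion-free (symmetry of the
  coefficients, as coordinate fields commute) and metric.
\<close>

definition levi_civita_coeffs ::
    "('a, 'e::euclidean_space) manifold \<Rightarrow> ('a, 'e) metric \<Rightarrow> ('a, 'e) chart \<Rightarrow> 'a \<Rightarrow> ('e \<Rightarrow> 'e \<Rightarrow> 'e) \<Rightarrow> bool" where
  "levi_civita_coeffs M g c x \<Gamma> \<longleftrightarrow> bilinear \<Gamma> \<and> (\<forall>u v. \<Gamma> u v = \<Gamma> v u) \<and>
     (\<forall>w u v. frechet_derivative (coord_metric M g c u v) (at (snd c x)) w =
        coord_metric M g c (\<Gamma> w u) v (snd c x) + coord_metric M g c u (\<Gamma> w v) (snd c x))"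

definition christoffel ::
    "('a, 'e::euclidean_space) manifold \<Rightarrow> ('a, 'e) metric \<Rightarrow> ('a, 'e) chart \<Rightarrow> 'a \<Rightarrow> 'e \<Rightarrow> 'e \<Rightarrow> 'e" where
  "christoffel M g c x = (THE \<Gamma>. levi_civita_coeffs M g c x \<Gamma>)"

text \<open>
  The inclusion \<open>N \<subseteq> M\<close> of manifolds with the same type of points, and its derivative
  \<open>T\<^sub>xN \<rightarrow> T\<^sub>xM\<close>.
\<close>

definition incl_deriv ::
    "('a, 'e::euclidean_space) manifold \<Rightarrow> ('a, 'f::euclidean_space) manifold \<Rightarrow> 'a \<Rightarrow> ('a, 'f) tvec \<Rightarrow> ('a, 'e) tvec" where
  "incl_deriv M N x v = (\<lambda>c. if c \<in> charts_at M x then dir_deriv N x v (snd c) else 0)"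

text \<open>
  The Levi-Civita covariant derivative \<open>\<nabla>\<^sub>v Y\<close> for \<open>v \<in> T\<^sub>xN\<close> and a field \<open>Y\<close> of tangent vectors
  of \<open>M\<close> along \<open>N\<close>, where \<open>N \<subseteq> M\<close>. The case \<open>N = M\<close> is the Levi-Civita connection of \<open>M\<close>.
\<close>

definition nabla ::
    "('a, 'e::euclidean_space) manifold \<Rightarrow> ('a, 'e) metric \<Rightarrow> ('a, 'f::euclidean_space) manifold \<Rightarrow>
     'a \<Rightarrow> ('a, 'f) tvec \<Rightarrow> ('a \<Rightarrow> ('a, 'e) tvec) \<Rightarrow> ('a, 'e) tvec" where
  "nabla M g N x v Y = (\<lambda>c. if c \<in> charts_at M x
     then dir_deriv N x v (\<lambda>y. Y y c) + christoffel M g c x (incl_deriv M N x v c) (Y x c)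
     else 0)"


section \<open>Multivectors and oriented planes\<close>

text \<open>
  \<open>p\<close>-tuples of vectors are functions on \<open>nat\<close> of which only the values at \<open>i < p\<close> matter.
\<close>

definition alternating_form :: "nat \<Rightarrow> 'v::real_vector set \<Rightarrow> ((nat \<Rightarrow> 'v) \<Rightarrow> real) \<Rightarrow> bool" where
  "alternating_form p V \<omega> \<longleftrightarrow>
     (\<forall>v w. (\<forall>i<p. v i \<in> V \<and> w i = v i) \<longrightarrow> \<omega> w = \<omega> v) \<and>
     (\<forall>v. (\<forall>i<p. v i \<in> V) \<longrightarrow>
        (\<forall>i<p. \<forall>z\<in>V. \<forall>w\<in>V. \<forall>a b.
           \<omega> (v(i := a *\<^sub>R z + b *\<^sub>R w)) = a * \<omega> (v(i := z)) + b * \<omega> (v(i := w))) \<and>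
        (\<forall>i<p. \<forall>j<p. i \<noteq> j \<and> v i = v j \<longrightarrow> \<omega> v = 0))"

text \<open>
  For a finite-dimensional space \<open>V\<close>, the exterior power \<open>\<Lambda>\<^sup>p V\<close> is realised as the dual of the
  space of alternating \<open>p\<close>-forms on \<open>V\<close>. Thus \<open>wedge p V e\<close> is \<open>e\<^sub>1 \<and> \<dots> \<and> e\<^sub>p\<close>, and the value
  \<open>\<phi>(\<xi>)\<close> of a \<open>p\<close>-form on a \<open>p\<close>-vector is the application \<open>\<xi> \<phi>\<close>.
\<close>

type_synonym 'v multivector = "((nat \<Rightarrow> 'v) \<Rightarrow> real) \<Rightarrow> real"

definition wedge :: "nat \<Rightarrow> 'v::real_vector set \<Rightarrow> (nat \<Rightarrow> 'v) \<Rightarrow> 'v multivector" where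
  "wedge p V e = (\<lambda>\<omega>. if alternating_form p V \<omega> then \<omega> e else 0)"

definition orthonormal :: "nat \<Rightarrow> 'v set \<Rightarrow> ('v \<Rightarrow> 'v \<Rightarrow> real) \<Rightarrow> (nat \<Rightarrow> 'v) \<Rightarrow> bool" where
  "orthonormal p V h e \<longleftrightarrow>
     (\<forall>i<p. e i \<in> V) \<and> (\<forall>i<p. \<forall>j<p. h (e i) (e j) = (if i = j then 1 else 0))"

definition Gr_o :: "nat \<Rightarrow> 'v::real_vector set \<Rightarrow> ('v \<Rightarrow> 'v \<Rightarrow> real) \<Rightarrow> 'v multivector set" where
  "Gr_o p V h = {wedge p V e | e. orthonormal p V h e}"

text \<open>
  Critical points of \<open>\<xi> \<mapsto> \<omega>(\<xi>)\<close> on the submanifold \<open>Gr\<^sub>o(p,V)\<close> of \<open>\<Lambda>\<^sup>p V\<close>: the derivative of the function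
  vanishes along every smooth curve in \<open>Gr\<^sub>o(p,V)\<close> through the point. Linear coordinates on
  \<open>\<Lambda>\<^sup>p V\<close> are the evaluations at alternating forms.
\<close>

definition critical_planes ::
    "nat \<Rightarrow> 'v::real_vector set \<Rightarrow> ('v \<Rightarrow> 'v \<Rightarrow> real) \<Rightarrow> ((nat \<Rightarrow> 'v) \<Rightarrow> real) \<Rightarrow> 'v multivector set" where
  "critical_planes p V h \<omega> = {\<xi> \<in> Gr_o p V h.
     \<forall>\<gamma> :: real \<Rightarrow> 'v multivector.
       (\<forall>t. \<gamma> t \<in> Gr_o p V h) \<and>
       (\<forall>\<eta>. alternating_form p V \<eta> \<longrightarrow> smooth_on UNIV (\<lambda>t. \<gamma> t \<eta>)) \<and> \<gamma> 0 = \<xi> \<longrightarrow>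
       ((\<lambda>t. \<gamma> t \<omega>) has_real_derivative 0) (at 0)}"


section \<open>Differential forms and calibrations\<close>

type_synonym ('a, 'e) dform = "'a \<Rightarrow> (nat \<Rightarrow> ('a, 'e) tvec) \<Rightarrow> real"

definition coord_form ::
    "('a, 'e::euclidean_space) manifold \<Rightarrow> ('a, 'e) dform \<Rightarrow> ('a, 'e) chart \<Rightarrow> (nat \<Rightarrow> 'e) \<Rightarrow> 'e \<Rightarrow> real" where
  "coord_form M \<phi> c u y = \<phi> (chart_inv c y) (\<lambda>i. coord_vec M c (chart_inv c y) (u i))"

definition smooth_form ::
    "nat \<Rightarrow> ('a, 'e::euclidean_space) manifold \<Rightarrow> ('a, 'e) dform \<Rightarrow> bool" where
  "smooth_form p M \<phi> \<longleftrightarrow>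
     (\<forall>x\<in>points M. alternating_form p (tangent_space M x) (\<phi> x)) \<and>
     (\<forall>c\<in>atlas M. \<forall>u. smooth_on (snd c ` fst c) (coord_form M \<phi> c u))"

text \<open>\<open>d\<phi> = 0\<close>, where in coordinates
  \<open>d\<phi>(u\<^sub>0, \<dots>, u\<^sub>p) = \<Sum>\<^sub>i (-1)\<^sup>i D\<^bsub>u\<^sub>i\<^esub> (\<phi>(u\<^sub>0, \<dots>, u\<^sub>i omitted, \<dots>, u\<^sub>p))\<close> for constant \<open>u\<^sub>0, \<dots>, u\<^sub>p\<close>.\<close>

definition closed_form ::
    "nat \<Rightarrow> ('a, 'e::euclidean_space) manifold \<Rightarrow> ('a, 'e) dform \<Rightarrow> bool" where
  "closed_form p M \<phi> \<longleftrightarrow> (\<forall>c\<in>atlas M. \<forall>y\<in>snd c ` fst c. \<forall>u.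
     (\<Sum>i\<le>p. (-1) ^ i *
        frechet_derivative (coord_form M \<phi> c (\<lambda>j. if j < i then u j else u (Suc j))) (at y) (u i)) = 0)"

definition calibration ::
    "nat \<Rightarrow> ('a, 'e::euclidean_space) manifold \<Rightarrow> ('a, 'e) metric \<Rightarrow> ('a, 'e) dform \<Rightarrow> bool" where
  "calibration p M g \<phi> \<longleftrightarrow> smooth_form p M \<phi> \<and> closed_form p M \<phi> \<and>
     (\<forall>x\<in>points M. \<forall>\<xi>\<in>Gr_o p (tangent_space M x) (g x). \<xi> (\<phi> x) \<le> 1)"

text \<open>The value at \<open>x\<close> of \<open>(\<nabla>\<^sub>v \<phi>)(Y\<^sub>1, \<dots>, Y\<^sub>p) = v(\<phi>(Y\<^sub>1, \<dots>, Y\<^sub>p)) - \<Sum>\<^sub>i \<phi>(Y\<^sub>1, \<dots>, \<nabla>\<^sub>v Y\<^sub>i, \<dots>, Y\<^sub>p)\<close>.\<close>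

definition nabla_form ::
    "nat \<Rightarrow> ('a, 'e::euclidean_space) manifold \<Rightarrow> ('a, 'e) metric \<Rightarrow> ('a, 'e) dform \<Rightarrow>
     'a \<Rightarrow> ('a, 'e) tvec \<Rightarrow> (nat \<Rightarrow> 'a \<Rightarrow> ('a, 'e) tvec) \<Rightarrow> real" where
  "nabla_form p M g \<phi> x v Y =
     dir_deriv M x v (\<lambda>y. \<phi> y (\<lambda>i. Y i y)) -
     (\<Sum>i<p. \<phi> x ((\<lambda>j. Y j x)(i := nabla M g M x v (Y i))))"

definition parallel_form ::
    "nat \<Rightarrow> ('a, 'e::euclidean_space) manifold \<Rightarrow> ('a, 'e) metric \<Rightarrow> ('a, 'e) dform \<Rightarrow> bool" where
  "parallel_form p M g \<phi> \<longleftrightarrow>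
     (\<forall>W Y. openin (mtop M) W \<and> (\<forall>i<p. smooth_field M W (Y i)) \<longrightarrow>
        (\<forall>x\<in>W. \<forall>v\<in>tangent_space M x. nabla_form p M g \<phi> x v Y = 0))"


section \<open>Submanifolds, mean curvature\<close>

text \<open>Submanifolds are subsets with a manifold structure for which the inclusion is a smooth
  immersion. The topology of \<open>N\<close> may be finer than the subspace topology.\<close>

definition submanifold ::
    "('a, 'e::euclidean_space) manifold \<Rightarrow> ('a, 'f::euclidean_space) manifold \<Rightarrow> bool" where
  "submanifold M N \<longleftrightarrow> smooth_manifold N \<and> points N \<subseteq> points M \<and>
     continuous_map (mtop N) (mtop M) (\<lambda>x. x) \<and>
     (\<forall>d\<in>atlas N. \<forall>c\<in>atlas M. smooth_on (snd d ` (fst d \<inter> fst c)) (snd c \<circ> chart_inv d)) \<and>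
     (\<forall>x\<in>points N. inj_on (incl_deriv M N x) (tangent_space N x))"

definition induced_metric ::
    "('a, 'e::euclidean_space) manifold \<Rightarrow> ('a, 'e) metric \<Rightarrow> ('a, 'f::euclidean_space) manifold \<Rightarrow> ('a, 'f) metric" where
  "induced_metric M g N x v w = g x (incl_deriv M N x v) (incl_deriv M N x w)"

text \<open>Component of \<open>z \<in> T\<^sub>xM\<close> orthogonal to \<open>T\<^sub>xN\<close>.\<close>

definition normal_part ::
    "('a, 'e::euclidean_space) manifold \<Rightarrow> ('a, 'e) metric \<Rightarrow> ('a, 'f::euclidean_space) manifold \<Rightarrow>
     'a \<Rightarrow> ('a, 'e) tvec \<Rightarrow> ('a, 'e) tvec" where
  "normal_part M g N x z = (THE w. w \<in> tangent_space M x \<and>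
     (\<forall>s\<in>incl_deriv M N x ` tangent_space N x. g x w s = 0) \<and>
     z - w \<in> incl_deriv M N x ` tangent_space N x)"

text \<open>The second fundamental form \<open>II(v,w)\<close> is the normal part of \<open>\<nabla>\<^sub>v W\<close>, where \<open>W\<close> is any tangent
  field of \<open>N\<close> extending \<open>w \<in> T\<^sub>xN\<close>; here the one with constant coordinates in some chart of \<open>N\<close>.
  The mean curvature vector is the trace of \<open>II\<close> with respect to an orthonormal basis; neither
  depends on the choices.\<close>

definition second_fund ::
    "('a, 'e::euclidean_space) manifold \<Rightarrow> ('a, 'e) metric \<Rightarrow> ('a, 'f::euclidean_space) manifold \<Rightarrow>
     'a \<Rightarrow> ('a, 'f) tvec \<Rightarrow> ('a, 'f) tvec \<Rightarrow> ('a, 'e) tvec" where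
  "second_fund M g N x v w = (let d = (SOME d. d \<in> charts_at N x) in
     normal_part M g N x
       (nabla M g N x v (\<lambda>y. incl_deriv M N y (coord_vec N d y (w d)))))"

definition mean_curvature ::
    "('a, 'e::euclidean_space) manifold \<Rightarrow> ('a, 'e) metric \<Rightarrow> ('a, 'f::euclidean_space) manifold \<Rightarrow>
     'a \<Rightarrow> ('a, 'e) tvec" where
  "mean_curvature M g N x =
     (let e = (SOME e. orthonormal DIM('f) (tangent_space N x) (induced_metric M g N x) e)
      in (\<Sum>i<DIM('f). second_fund M g N x (e i) (e i)))"

definition minimal_submanifold ::
    "('a, 'e::euclidean_space) manifold \<Rightarrow> ('a, 'e) metric \<Rightarrow> ('a, 'f::euclidean_space) manifold \<Rightarrow> bool" where
  "minimal_submanifold M g N \<longleftrightarrow>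
     submanifold M N \<and> (\<forall>x\<in>points N. mean_curvature M g N x = 0)"

text \<open>The \<open>p\<close>-vector \<open>v\<^sub>1 \<and> \<dots> \<and> v\<^sub>p\<close> in \<open>\<Lambda>\<^sup>p T\<^sub>xM\<close>, for \<open>v\<^sub>1, \<dots>, v\<^sub>p \<in> T\<^sub>xN\<close> and \<open>p = dim N\<close>.\<close>

definition plane_vec ::
    "('a, 'e::euclidean_space) manifold \<Rightarrow> ('a, 'f::euclidean_space) manifold \<Rightarrow> 'a \<Rightarrow>
     (nat \<Rightarrow> ('a, 'f) tvec) \<Rightarrow> ('a, 'e) tvec multivector" where
  "plane_vec M N x v = wedge DIM('f) (tangent_space M x) (\<lambda>i. incl_deriv M N x (v i))"

text \<open>An orientation of \<open>N\<close> is given as the map \<open>\<tau>\<close> taking \<open>x\<close> to the unit \<open>p\<close>-vector of the oriented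
  tangent space \<open>T\<^sub>xN\<close>; locally it comes from a smooth orthonormal frame of \<open>N\<close>.\<close>

definition orientation ::
    "('a, 'e::euclidean_space) manifold \<Rightarrow> ('a, 'e) metric \<Rightarrow> ('a, 'f::euclidean_space) manifold \<Rightarrow>
     ('a \<Rightarrow> ('a, 'e) tvec multivector) \<Rightarrow> bool" where
  "orientation M g N \<tau> \<longleftrightarrow> (\<forall>x\<in>points N. \<exists>W E.
     openin (mtop N) W \<and> x \<in> W \<and> (\<forall>i<DIM('f). smooth_field N W (E i)) \<and>
     (\<forall>y\<in>W. orthonormal DIM('f) (tangent_space N y) (induced_metric M g N y) (\<lambda>i. E i y) \<and>
        \<tau> y = plane_vec M N y (\<lambda>i. E i y)))"

text \<open>The Riemannian volume form of the oriented submanifold \<open>N\<close>: the top-degree form on \<open>T\<^sub>xN\<close>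
  with value \<open>1\<close> on the unit \<open>p\<close>-vector \<open>\<tau> x\<close>.\<close>

definition volume_form ::
    "('a, 'e::euclidean_space) manifold \<Rightarrow> ('a, 'f::euclidean_space) manifold \<Rightarrow>
     ('a \<Rightarrow> ('a, 'e) tvec multivector) \<Rightarrow> ('a, 'f) dform" where
  "volume_form M N \<tau> x v = (THE a. plane_vec M N x v = a *\<^sub>R \<tau> x)"

definition critical_submanifold ::
    "('a, 'e::euclidean_space) manifold \<Rightarrow> ('a, 'e) metric \<Rightarrow> ('a, 'e) dform \<Rightarrow>
     ('a, 'f::euclidean_space) manifold \<Rightarrow> ('a \<Rightarrow> ('a, 'e) tvec multivector) \<Rightarrow> bool" where
  "critical_submanifold M g \<phi> N \<tau> \<longleftrightarrow> submanifold M N \<and> orientation M g N \<tau> \<and>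
     (\<forall>x\<in>points N. \<tau> x \<in> critical_planes DIM('f) (tangent_space M x) (g x) (\<phi> x))"

definition critical_value ::
    "('a, 'e::euclidean_space) manifold \<Rightarrow> ('a, 'e) dform \<Rightarrow> ('a, 'f::euclidean_space) manifold \<Rightarrow>
     ('a \<Rightarrow> ('a, 'e) tvec multivector) \<Rightarrow> real \<Rightarrow> bool" where
  "critical_value M \<phi> N \<tau> \<phi>\<^sub>o \<longleftrightarrow>
     (\<forall>x\<in>points N. \<forall>v. (\<forall>i<DIM('f). v i \<in> tangent_space N x) \<longrightarrow>
        \<phi> x (\<lambda>i. incl_deriv M N x (v i)) = \<phi>\<^sub>o * volume_form M N \<tau> x v)"

end

theory Submission
  imports Defs
begin

text \<open>
  Let \<open>E\<^sub>1, \<dots>, E\<^sub>p\<close> be a local orthonormal frame of \<open>N\<close> and \<open>\<nu>\<close> a normal field along \<open>N\<close>. Criticality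
  gives the first cousin principle \<open>\<phi>(E\<^sub>1, \<dots>, \<nu>, \<dots>, E\<^sub>p) = 0\<close> with \<open>\<nu>\<close> in any slot \<open>i\<close>. Differentiate
  this along \<open>E\<^sub>i\<close>, using \<open>\<nabla>\<phi> = 0\<close>, and sum over \<open>i\<close>. The terms with \<open>\<nu>\<close> in slot \<open>i\<close> and \<open>\<nabla>\<^bsub>E\<^sub>i\<^esub> E\<^sub>k\<close> in
  slot \<open>k\<close> cancel: up to vectors tangent to \<open>N\<close>, which contribute nothing, \<open>\<nabla>\<^bsub>E\<^sub>i\<^esub> E\<^sub>k\<close> is symmetric
  in \<open>i\<close>, \<open>k\<close>, while \<open>\<phi>\<close> is alternating. What remains is
  \<open>0 = \<Sum>\<^sub>i \<phi>(E\<^sub>1, \<dots>, \<nabla>\<^bsub>E\<^sub>i\<^esub> \<nu>, \<dots>, E\<^sub>p) = \<phi>\<^sub>o \<Sum>\<^sub>i \<langle>\<nabla>\<^bsub>E\<^sub>i\<^esub> \<nu>, E\<^sub>i\<rangle> = - \<phi>\<^sub>o \<langle>H, \<nu>\<rangle>\<close>, so the mean curvature vector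
  \<open>H\<close> is orthogonal to every normal vector, in particular to itself.
\<close>

section \<open>Calculus of smooth functions\<close>

text \<open>The cousin identity can be differentiated only along a normal field defined near the
  point, and mean curvature is defined through choices: a chart of N, extensions with constant
  coordinates, an orthonormal basis. Hence the argument runs in one chart of N and one of M. A
  normal vector is extended by keeping its coordinates constant and subtracting its projection to
  the frame. The covariant derivative of the frame splits into two parts: the Hessian of the
  inclusion plus a Christoffel term, and the differential of the inclusion applied to the derivative
  of the frame coefficients. The first is symmetric, since second derivatives commute and the
  connection is torsion-free; the second is tangent. This takes the place of Lie brackets.
  Extensions with constant coordinates produce the first part alone, so the same expression computes
  mean curvature. Its trace against a normal vector is independent of the orthonormal basis, which
  connects the frame given by the orientation with the basis picked in the definition.\<close>

lemma second_difference_bound: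
  fixes f :: "'a::euclidean_space \<Rightarrow> real"
  assumes "open S" "q \<in> S"
    and f: "\<And>y. y \<in> S \<Longrightarrow> (f has_derivative f' y) (at y)"
    and D: "((\<lambda>y. f' y u) has_derivative D) (at q)"
    and "e > 0"
  shows "\<exists>d>0. \<forall>t. 0 < t \<and> t < d \<longrightarrow>
    \<bar>f (q + t *\<^sub>R u + t *\<^sub>R w) - f (q + t *\<^sub>R u) - f (q + t *\<^sub>R w) + f q - t\<^sup>2 * D w\<bar> \<le> e * t\<^sup>2"
proof -
  \<comment> \<open>\<open>t * K\<close> bounds the norm of
    \<open>s *\<^sub>R u + b *\<^sub>R w\<close> for \<open>s\<close> and \<open>b\<close> between 0
    and \<open>t\<close>; the summand 1 keeps \<open>K\<close> positive when both vectors
    vanish.\<close>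
  define K where "K = norm u + norm w + 1"
  have K: "K > 0" unfolding K_def by (simp add: add_nonneg_pos)
  obtain r where r: "r > 0" "ball q r \<subseteq> S"
    using assms(1,2) open_contains_ball by blast
  \<comment> \<open>Two evaluation points within \<open>t * K\<close> of \<open>q\<close> cost
    \<open>e / 2 * t\<close> each; the mean value theorem contributes the second factor
    \<open>t\<close> of the bound.\<close>
  have "e / (2 * K) > 0" using K \<open>e > 0\<close> by simp
  then obtain d where d: "d > 0"
    "\<And>y. norm (y - q) < d \<Longrightarrow> norm (f' y u - f' q u - D (y - q)) \<le> e / (2 * K) * norm (y - q)"
    using D unfolding has_derivative_at_alt by blast
  interpret D: bounded_linear D using D has_derivative_bounded_linear by blast
  show ?thesis
  proof (intro exI conjI allI impI)
    show "min d r / K > 0" using d r K by simp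
    fix t :: real assume t: "0 < t \<and> t < min d r / K"
    then have tK: "t * K < d" "t * K < r" using K by (auto simp: field_simps)
    \<comment> \<open>The difference in direction \<open>w\<close> is taken first and the mean value
      theorem is applied along \<open>u\<close>, so that only differences of \<open>f' _ u\<close>
      near \<open>q\<close> remain, which \<open>D\<close> controls.\<close>
    define h where "h s = f (q + s *\<^sub>R u + t *\<^sub>R w) - f (q + s *\<^sub>R u)" for s
    define h' where "h' s = f' (q + s *\<^sub>R u + t *\<^sub>R w) u - f' (q + s *\<^sub>R u) u" for s
    have small: "norm (s *\<^sub>R u + b *\<^sub>R w) \<le> t * K" if "0 \<le> s" "s \<le> t" "0 \<le> b" "b \<le> t" for s b
    proof -
      have "norm (s *\<^sub>R u + b *\<^sub>R w) \<le> s * norm u + b * norm w"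
        using norm_triangle_ineq[of "s *\<^sub>R u" "b *\<^sub>R w"] that by simp
      also have "\<dots> \<le> t * norm u + t * norm w"
        using that by (intro add_mono mult_right_mono) auto
      also have "\<dots> \<le> t * K" unfolding K_def using t by (simp add: algebra_simps)
      finally show ?thesis .
    qed
    have inS: "q + s *\<^sub>R u + b *\<^sub>R w \<in> S" if "0 \<le> s" "s \<le> t" "0 \<le> b" "b \<le> t" for s b
    proof -
      have "dist q (q + (s *\<^sub>R u + b *\<^sub>R w)) = norm (s *\<^sub>R u + b *\<^sub>R w)"
        unfolding dist_norm by (metis add_diff_cancel_left' norm_minus_commute)
      then have "q + s *\<^sub>R u + b *\<^sub>R w \<in> ball q r"
        using small[OF that] tK unfolding mem_ball add.assoc by linarith
      then show ?thesis using r by blast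
    qed
    have h_der: "(h has_derivative (\<lambda>x. x * h' s)) (at s)" if s: "0 \<le> s" "s \<le> t" for s
    proof -
      have 1: "q + s *\<^sub>R u + t *\<^sub>R w \<in> S" "q + s *\<^sub>R u \<in> S"
        using inS[OF s, of t] inS[OF s, of 0] t by auto
      have 2: "((\<lambda>s. q + s *\<^sub>R u + t *\<^sub>R w) has_derivative (\<lambda>x. x *\<^sub>R u)) (at s)"
        "((\<lambda>s. q + s *\<^sub>R u) has_derivative (\<lambda>x. x *\<^sub>R u)) (at s)"
        by (auto intro!: derivative_eq_intros)
      have lin: "linear (f' (q + s *\<^sub>R u + t *\<^sub>R w))" "linear (f' (q + s *\<^sub>R u))"
        using f[OF 1(1)] f[OF 1(2)] has_derivative_linear by blast+
      show ?thesis
        unfolding h_def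
        by (rule has_derivative_eq_rhs[OF has_derivative_diff[OF
              has_derivative_compose[OF 2(1) f[OF 1(1)]] has_derivative_compose[OF 2(2) f[OF 1(2)]]]])
          (simp add: h'_def linear_cmul[OF lin(1)] linear_cmul[OF lin(2)] right_diff_distrib)
    qed
    obtain s where s: "s \<in> {0<..<t}" "h t - h 0 = (t - 0) * h' s"
    proof (rule bexE[OF mvt_simple[of 0 t h "\<lambda>s x. x * h' s"]])
      show "0 < t" using t by simp
      show "(h has_derivative (\<lambda>x. x * h' s)) (at s within {0..t})" if "0 \<le> s" "s \<le> t" for s
        using h_der[OF that] by (rule has_derivative_at_withinI)
    qed
    have s': "0 \<le> s" "s \<le> t" using s by auto
    have "\<bar>h' s - t * D w\<bar> \<le> e * t"
    proof -
      let ?y1 = "q + s *\<^sub>R u + t *\<^sub>R w" and ?y2 = "q + s *\<^sub>R u"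
      have n1: "norm (?y1 - q) \<le> t * K" using small[OF s', of t] t by (simp add: algebra_simps)
      have n2: "norm (?y2 - q) \<le> t * K" using small[OF s', of 0] t by (simp add: algebra_simps)
      have b: "norm (f' y u - f' q u - D (y - q)) \<le> e / 2 * t" if "norm (y - q) \<le> t * K" for y
      proof -
        have "norm (f' y u - f' q u - D (y - q)) \<le> e / (2 * K) * norm (y - q)"
          using d(2) that tK by force
        also have "\<dots> \<le> e / (2 * K) * (t * K)"
          using that K \<open>e > 0\<close> by (intro mult_left_mono) auto
        finally show ?thesis using K by (simp add: field_simps)
      qed
      have "D (?y1 - q) - D (?y2 - q) = t * D w"
        by (simp add: D.diff D.add D.scaleR)
      then show ?thesis using b[OF n1] b[OF n2] unfolding h'_def real_norm_def by linarith
    qed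
    then have "t * \<bar>h' s - t * D w\<bar> \<le> t * (e * t)" using t by (intro mult_left_mono) auto
    moreover have "t * \<bar>h' s - t * D w\<bar> = \<bar>t * (h' s - t * D w)\<bar>" using t by (simp add: abs_mult)
    moreover have "t * (h' s - t * D w) = h t - h 0 - t\<^sup>2 * D w"
      using s by (simp add: algebra_simps power2_eq_square)
    ultimately have "\<bar>h t - h 0 - t\<^sup>2 * D w\<bar> \<le> e * t\<^sup>2"
      by (simp add: algebra_simps power2_eq_square)
    then show "\<bar>f (q + t *\<^sub>R u + t *\<^sub>R w) - f (q + t *\<^sub>R u) - f (q + t *\<^sub>R w) + f q - t\<^sup>2 * D w\<bar> \<le> e * t\<^sup>2"
      unfolding h_def by simp
  qed
qed

text \<open>The mixed second difference is symmetric in \<open>u\<close> and \<open>w\<close>, and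
  both \<open>t\<^sup>2 * D u w\<close> and \<open>t\<^sup>2 * D w u\<close> approximate it up to
  o(t^2).\<close>

lemma second_derivative_symmetric_real:
  fixes f :: "'a::euclidean_space \<Rightarrow> real"
  assumes "open S" "q \<in> S"
    and f: "\<And>y. y \<in> S \<Longrightarrow> (f has_derivative f' y) (at y)"
    and D: "\<And>u. ((\<lambda>y. f' y u) has_derivative D u) (at q)"
  shows "D u w = D w u"
proof -
  have "\<bar>D u w - D w u\<bar> \<le> 2 * e" if "e > 0" for e
  proof -
    obtain d1 where d1: "d1 > 0" "\<And>t. 0 < t \<and> t < d1 \<Longrightarrow>
      \<bar>f (q + t *\<^sub>R u + t *\<^sub>R w) - f (q + t *\<^sub>R u) - f (q + t *\<^sub>R w) + f q - t\<^sup>2 * D u w\<bar> \<le> e * t\<^sup>2"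
      using second_difference_bound[OF assms(1-3) D \<open>e > 0\<close>] by blast
    obtain d2 where d2: "d2 > 0" "\<And>t. 0 < t \<and> t < d2 \<Longrightarrow>
      \<bar>f (q + t *\<^sub>R w + t *\<^sub>R u) - f (q + t *\<^sub>R w) - f (q + t *\<^sub>R u) + f q - t\<^sup>2 * D w u\<bar> \<le> e * t\<^sup>2"
      using second_difference_bound[OF assms(1-3) D \<open>e > 0\<close>] by blast
    define t where "t = min d1 d2 / 2"
    have t: "0 < t \<and> t < d1" "0 < t \<and> t < d2" using d1(1) d2(1) unfolding t_def by auto
    have "f (q + t *\<^sub>R w + t *\<^sub>R u) = f (q + t *\<^sub>R u + t *\<^sub>R w)" by (simp add: add_ac)
    then have "\<bar>t\<^sup>2 * D u w - t\<^sup>2 * D w u\<bar> \<le> 2 * (e * t\<^sup>2)"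
      using d1(2)[OF t(1)] d2(2)[OF t(2)] by linarith
    moreover have "\<bar>t\<^sup>2 * D u w - t\<^sup>2 * D w u\<bar> = t\<^sup>2 * \<bar>D u w - D w u\<bar>"
      by (simp add: abs_mult flip: right_diff_distrib)
    ultimately have "t\<^sup>2 * \<bar>D u w - D w u\<bar> \<le> t\<^sup>2 * (2 * e)" by (simp add: mult_ac)
    then show ?thesis using t by (simp add: mult_le_cancel_left_pos)
  qed
  \<comment> \<open>With a quarter of the gap as error, the gap is at most half of itself.\<close>
  from this[of "\<bar>D u w - D w u\<bar> / 4"] show ?thesis by fastforce
qed

lemma second_derivative_symmetric:
  fixes f :: "'a::euclidean_space \<Rightarrow> 'b::euclidean_space"
  assumes "open S" "q \<in> S"
    and f: "\<And>y. y \<in> S \<Longrightarrow> (f has_derivative f' y) (at y)"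
    and D: "\<And>u. ((\<lambda>y. f' y u) has_derivative D u) (at q)"
  shows "D u w = D w u"
proof (rule euclidean_eqI)
  fix b :: 'b
  show "D u w \<bullet> b = D w u \<bullet> b"
    by (rule second_derivative_symmetric_real[OF assms(1,2), of "\<lambda>y. f y \<bullet> b" "\<lambda>y u. f' y u \<bullet> b" "\<lambda>u w. D u w \<bullet> b"])
      (auto intro!: has_derivative_inner_left f D)
qed

text \<open>Trades a moving argument for fixed directions with scalar coefficients. This is the
  device used whenever a linear map is known to depend differentiably on a parameter only at
  constant vectors.\<close>

lemma linear_basis_expansion:
  fixes L :: "'a::euclidean_space \<Rightarrow> 'b::real_vector"
  assumes "linear L"
  shows "(\<Sum>b\<in>Basis. (x \<bullet> b) *\<^sub>R L b) = L x"
proof -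
  have "L x = L (\<Sum>b\<in>Basis. (x \<bullet> b) *\<^sub>R b)" by (simp add: euclidean_representation)
  also have "\<dots> = (\<Sum>b\<in>Basis. (x \<bullet> b) *\<^sub>R L b)"
    by (simp add: linear_sum[OF assms] linear_cmul[OF assms])
  finally show ?thesis by simp
qed

section \<open>Closure properties of functions of class C^k\<close>

lemma Ck_on_cong:
  assumes "open S" "\<And>y. y \<in> S \<Longrightarrow> f y = g y" "Ck_on k S f"
  shows "Ck_on k S g"
proof (cases k)
  case 0
  then show ?thesis using assms continuous_on_cong[of S S f g] by auto
next
  case (Suc j)
  then show ?thesis using assms has_derivative_transform_within_open[OF _ assms(1), of f] by fastforce
qed

lemma Ck_on_SucE:
  assumes "Ck_on (Suc k) S f"
  obtains f' where "\<And>y. y \<in> S \<Longrightarrow> (f has_derivative f' y) (at y)"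
    "\<And>u. Ck_on k S (\<lambda>y. f' y u)"
  using assms by auto

lemma Ck_on_Suc_imp: "Ck_on (Suc k) S f \<Longrightarrow> Ck_on k S f"
proof (induction k arbitrary: f)
  case 0
  then obtain f' where "\<And>y. y \<in> S \<Longrightarrow> (f has_derivative f' y) (at y)"
    by (rule Ck_on_SucE) blast
  then have "continuous_on S f"
    using has_derivative_continuous_on has_derivative_at_withinI by metis
  then show ?case by simp
next
  case (Suc k)
  obtain f' where "\<And>y. y \<in> S \<Longrightarrow> (f has_derivative f' y) (at y)"
    "\<And>u. Ck_on (Suc k) S (\<lambda>y. f' y u)" using Suc.prems by (rule Ck_on_SucE) blast
  then show ?case using Suc.IH unfolding Ck_on.simps(2)[of k] by blast
qed

lemma Ck_on_const: "Ck_on k S (\<lambda>y. c)"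
proof (induction k arbitrary: c)
  case (Suc k)
  show ?case using Suc[of 0] by (auto intro!: exI[of _ "\<lambda>_ _. 0"])
qed simp

lemma Ck_on_bounded_linear:
  assumes "bounded_linear L"
  shows "Ck_on k S f \<Longrightarrow> Ck_on k S (\<lambda>y. L (f y))"
proof (induction k arbitrary: f)
  case 0
  then show ?case using assms bounded_linear.continuous_on by auto
next
  case (Suc k)
  then obtain f' where f': "\<And>y. y \<in> S \<Longrightarrow> (f has_derivative f' y) (at y)"
    "\<And>u. Ck_on k S (\<lambda>y. f' y u)" by auto
  show ?case
    using f' Suc.IH
    by (auto intro!: exI[of _ "\<lambda>y u. L (f' y u)"] bounded_linear.has_derivative[OF assms])
qed

lemma Ck_on_add: "Ck_on k S f \<Longrightarrow> Ck_on k S g \<Longrightarrow> Ck_on k S (\<lambda>y. f y + g y)"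
proof (induction k arbitrary: f g)
  case 0
  then show ?case by (auto intro: continuous_on_add)
next
  case (Suc k)
  obtain f' where d1: "\<And>y. y \<in> S \<Longrightarrow> (f has_derivative f' y) (at y)"
    "\<And>u. Ck_on k S (\<lambda>y. f' y u)" using Suc.prems(1) by (rule Ck_on_SucE) blast
  obtain g' where d2: "\<And>y. y \<in> S \<Longrightarrow> (g has_derivative g' y) (at y)"
    "\<And>u. Ck_on k S (\<lambda>y. g' y u)" using Suc.prems(2) by (rule Ck_on_SucE) blast
  note d = d1 d2
  show ?case
    using Suc.IH d by (auto intro!: exI[of _ "\<lambda>y u. f' y u + g' y u"] has_derivative_add)
qed

lemma Ck_on_sum: "(\<And>i. i \<in> I \<Longrightarrow> Ck_on k S (f i)) \<Longrightarrow> Ck_on k S (\<lambda>y. \<Sum>i\<in>I. f i y)"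
  by (induction I rule: infinite_finite_induct) (auto intro: Ck_on_const Ck_on_add)

lemma Ck_on_scaleR: "Ck_on k S a \<Longrightarrow> Ck_on k S f \<Longrightarrow> Ck_on k S (\<lambda>y. a y *\<^sub>R f y)"
proof (induction k arbitrary: a f)
  case 0
  then show ?case by (auto intro: continuous_on_scaleR)
next
  case (Suc k)
  obtain a' where d1: "\<And>y. y \<in> S \<Longrightarrow> (a has_derivative a' y) (at y)"
    "\<And>u. Ck_on k S (\<lambda>y. a' y u)" using Suc.prems(1) by (rule Ck_on_SucE) blast
  obtain f' where d2: "\<And>y. y \<in> S \<Longrightarrow> (f has_derivative f' y) (at y)"
    "\<And>u. Ck_on k S (\<lambda>y. f' y u)" using Suc.prems(2) by (rule Ck_on_SucE) blast
  note d = d1 d2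
  have "Ck_on k S a" "Ck_on k S f" using Suc.prems Ck_on_Suc_imp by blast+
  then show ?case using Suc.IH d
    by (auto intro!: exI[of _ "\<lambda>y u. a y *\<^sub>R f' y u + a' y u *\<^sub>R f y"] has_derivative_scaleR Ck_on_add)
qed

text \<open>The chain rule yields \<open>f' (g y) (g' y u)\<close>, whose direction moves with
  \<open>y\<close>, whereas \<open>Ck_on\<close> controls \<open>f'\<close> only in fixed
  directions. Expanding \<open>g' y u\<close> in \<open>Basis\<close> leaves products to which the
  induction hypothesis applies.\<close>

lemma Ck_on_compose:
  fixes g :: "'a::euclidean_space \<Rightarrow> 'b::euclidean_space"
  shows "Ck_on k T f \<Longrightarrow> Ck_on k S g \<Longrightarrow> g ` S \<subseteq> T \<Longrightarrow> Ck_on k S (\<lambda>y. f (g y))"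
proof (induction k arbitrary: f)
  case 0
  then show ?case using continuous_on_compose2 by auto
next
  case (Suc k)
  obtain f' where d1: "\<And>y. y \<in> T \<Longrightarrow> (f has_derivative f' y) (at y)"
    "\<And>u. Ck_on k T (\<lambda>y. f' y u)" using Suc.prems(1) by (rule Ck_on_SucE) blast
  obtain g' where d2: "\<And>y. y \<in> S \<Longrightarrow> (g has_derivative g' y) (at y)"
    "\<And>u. Ck_on k S (\<lambda>y. g' y u)" using Suc.prems(2) by (rule Ck_on_SucE) blast
  note d = d1 d2
  have gk: "Ck_on k S g" using Suc.prems Ck_on_Suc_imp by blast
  show ?case unfolding Ck_on.simps
  proof (intro exI[of _ "\<lambda>y u. \<Sum>b\<in>Basis. (g' y u \<bullet> b) *\<^sub>R f' (g y) b"] conjI ballI allI)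
    fix y assume y: "y \<in> S"
    then have gy: "g y \<in> T" using Suc.prems by auto
    have lin: "linear (f' (g y))" using d(1)[OF gy] has_derivative_linear by blast
    show "((\<lambda>y. f (g y)) has_derivative (\<lambda>u. \<Sum>b\<in>Basis. (g' y u \<bullet> b) *\<^sub>R f' (g y) b)) (at y)"
      using has_derivative_compose[OF d(3)[OF y] d(1)[OF gy]]
      unfolding linear_basis_expansion[OF lin] .
  next
    fix u
    show "Ck_on k S (\<lambda>y. \<Sum>b\<in>Basis. (g' y u \<bullet> b) *\<^sub>R f' (g y) b)"
      using Suc.prems(3) Suc.IH[OF d(2) gk]
      by (intro Ck_on_sum Ck_on_scaleR Ck_on_bounded_linear[OF bounded_linear_inner_left] d(4)) auto
  qed
qed

lemma smooth_on_cong: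
  "open S \<Longrightarrow> (\<And>y. y \<in> S \<Longrightarrow> f y = g y) \<Longrightarrow> smooth_on S f \<Longrightarrow> smooth_on S g"
  unfolding smooth_on_def using Ck_on_cong by blast

lemma smooth_on_compose:
  fixes g :: "'a::euclidean_space \<Rightarrow> 'b::euclidean_space"
  shows "smooth_on T f \<Longrightarrow> smooth_on S g \<Longrightarrow> g ` S \<subseteq> T \<Longrightarrow> smooth_on S (\<lambda>y. f (g y))"
  unfolding smooth_on_def using Ck_on_compose by blast

lemma smooth_on_has_derivative:
  assumes "smooth_on S f" "y \<in> S"
  shows "(f has_derivative frechet_derivative f (at y)) (at y)"
proof -
  have "Ck_on (Suc 0) S f" using assms unfolding smooth_on_def by blast
  then have "f differentiable at y" using assms(2) by (auto intro: differentiableI)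
  then show ?thesis by (simp add: frechet_derivative_works)
qed

text \<open>Each order \<open>k\<close> comes with its own derivative \<open>f'\<close>; uniqueness
  of derivatives identifies all of them.\<close>

lemma smooth_on_frechet_derivative:
  assumes "open S" "smooth_on S f"
  shows "smooth_on S (\<lambda>y. frechet_derivative f (at y) u)"
  unfolding smooth_on_def
proof
  fix k
  have "Ck_on (Suc k) S f" using assms unfolding smooth_on_def by blast
  then obtain f' where f': "\<And>y. y \<in> S \<Longrightarrow> (f has_derivative f' y) (at y)"
    "\<And>u. Ck_on k S (\<lambda>y. f' y u)" by auto
  show "Ck_on k S (\<lambda>y. frechet_derivative f (at y) u)"
    using f'(1) by (intro Ck_on_cong[OF assms(1) _ f'(2)[of u]]) (metis frechet_derivative_at)
qed

lemma smooth_on_second_derivative_symmetric: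
  fixes f :: "'a::euclidean_space \<Rightarrow> 'b::euclidean_space"
  assumes "open S" "smooth_on S f" "q \<in> S"
  shows "frechet_derivative (\<lambda>y. frechet_derivative f (at y) u) (at q) w
       = frechet_derivative (\<lambda>y. frechet_derivative f (at y) w) (at q) u"
  using second_derivative_symmetric[OF assms(1,3) smooth_on_has_derivative[OF assms(2)]
      smooth_on_has_derivative[OF smooth_on_frechet_derivative[OF assms(1,2)] assms(3)]] .

section \<open>Multilinear and alternating forms along a map\<close>

definition multilinear :: "nat \<Rightarrow> ((nat \<Rightarrow> 'v::real_vector) \<Rightarrow> real) \<Rightarrow> bool" where
  "multilinear p T \<longleftrightarrow> (\<forall>u v. (\<forall>i<p. v i = u i) \<longrightarrow> T v = T u) \<and>
     (\<forall>i<p. \<forall>u. linear (\<lambda>x. T (u(i := x))))"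

text \<open>Product rule for a family of multilinear forms that is parallel for the connection with
  coefficients \<open>\<Gamma>\<close>; it serves the metric (\<open>p = 2\<close>) as well as the calibration, so no
  product rule for sums over multi-indices is needed.\<close>

lemma multilinear_family_has_derivative:
  fixes T :: "'y::euclidean_space \<Rightarrow> (nat \<Rightarrow> 'e::euclidean_space) \<Rightarrow> real"
  assumes S: "open S" "q \<in> S"
    and T: "\<And>y. y \<in> S \<Longrightarrow> multilinear p (T y)"
    and dT: "\<And>u. ((\<lambda>y. T y u) has_derivative (\<lambda>w. \<Sum>i<p. T q (u(i := \<Gamma> w (u i))))) (at q)"
    and \<Gamma>: "\<And>w. linear (\<Gamma> w)"
    and U: "\<And>i. i < p \<Longrightarrow> (U i has_derivative U' i) (at q)"
  shows "((\<lambda>y. T y (\<lambda>i. U i y)) has_derivative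
      (\<lambda>w. \<Sum>i<p. T q ((\<lambda>j. U j q)(i := U' i w + \<Gamma> w (U i q))))) (at q)"
proof -
  have loc: "T y u = T y v" if "y \<in> S" "\<And>i. i < p \<Longrightarrow> u i = v i" for y u v
    using T[OF that(1)] that(2) unfolding multilinear_def by blast
  have lin: "linear (\<lambda>x. T y (u(i := x)))" if "y \<in> S" "i < p" for y u i
    using T[OF that(1)] that(2) unfolding multilinear_def by blast
  \<comment> \<open>Induction on the number \<open>k\<close> of slots that may vary: from slot
    \<open>k\<close> on the vectors are constant. With no varying slot the claim is
    \<open>dT\<close>.\<close>
  have main: "((\<lambda>y. T y (\<lambda>i. V i y)) has_derivative
      (\<lambda>w. \<Sum>i<p. T q ((\<lambda>j. V j q)(i := V' i w + \<Gamma> w (V i q))))) (at q)"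
    if "k \<le> p" "\<And>i. (V i has_derivative V' i) (at q)"
      "\<And>i y. i \<ge> k \<Longrightarrow> V i y = V i q" "\<And>i w. i \<ge> k \<Longrightarrow> V' i w = 0"
    for k and V :: "nat \<Rightarrow> 'y \<Rightarrow> 'e" and V' :: "nat \<Rightarrow> 'y \<Rightarrow> 'e"
    using that
  proof (induction k arbitrary: V V')
    case 0
    have "T y (\<lambda>i. V i y) = T y (\<lambda>i. V i q)" for y
      by (rule arg_cong[where f = "T y"], rule ext, rule "0.prems"(3)) simp
    then have eq: "(\<lambda>y. T y (\<lambda>i. V i y)) = (\<lambda>y. T y (\<lambda>i. V i q))" by (rule ext)
    show ?case unfolding eq using dT[of "\<lambda>i. V i q"] "0.prems"(4) by (simp add: fun_upd_def)
  next
    case (Suc k)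
    then have k: "k < p" by simp
    \<comment> \<open>Slot \<open>k\<close> is frozen at a basis vector, so one slot fewer varies;
      \<open>V k\<close> itself re-enters through its coefficients
      \<open>V k y \<bullet> b\<close>.\<close>
    define B where "B b = V(k := \<lambda>_. b)" for b
    define B' where "B' = V'(k := \<lambda>_. 0)"
    define X where "X w i = V' i w + \<Gamma> w (V i q)" for w i
    define v where "v = (\<lambda>j. V j q)"
    have Bq: "(\<lambda>i. B b i y) = (\<lambda>i. V i y)(k := b)" for b y
      unfolding B_def by auto
    have dB: "((\<lambda>y. T y (\<lambda>i. B b i y)) has_derivative
      (\<lambda>w. \<Sum>i<p. T q ((\<lambda>j. B b j q)(i := B' i w + \<Gamma> w (B b i q))))) (at q)" for b
    proof (rule Suc.IH)
      show "k \<le> p" using k by simp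
      show "(B b i has_derivative B' i) (at q)" for i
        using Suc.prems(2) by (simp add: B_def B'_def)
      show "B b i y = B b i q" if "k \<le> i" for i y
        using Suc.prems(3)[of i y] that unfolding B_def by (cases "i = k") auto
      show "B' i w = 0" if "k \<le> i" for i w
        using Suc.prems(4)[of i w] that unfolding B'_def by (cases "i = k") auto
    qed
    have "((\<lambda>y. \<Sum>b\<in>Basis. (V k y \<bullet> b) * T y (\<lambda>i. B b i y)) has_derivative
      (\<lambda>w. \<Sum>b\<in>Basis. (V k q \<bullet> b) * (\<Sum>i<p. T q ((\<lambda>j. B b j q)(i := B' i w + \<Gamma> w (B b i q))))
          + (V' k w \<bullet> b) * T q (\<lambda>i. B b i q))) (at q)"
      by (intro has_derivative_sum has_derivative_mult has_derivative_inner_left Suc.prems(2) dB)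
    moreover have "(\<Sum>b\<in>Basis. (V k y \<bullet> b) * T y (\<lambda>i. B b i y)) = T y (\<lambda>i. V i y)" if "y \<in> S" for y
      using linear_basis_expansion[OF lin[OF that k, of "\<lambda>i. V i y"], of "V k y"]
      unfolding Bq by (simp add: fun_upd_idem)
    ultimately have "((\<lambda>y. T y (\<lambda>i. V i y)) has_derivative
      (\<lambda>w. \<Sum>b\<in>Basis. (V k q \<bullet> b) * (\<Sum>i<p. T q ((\<lambda>j. B b j q)(i := B' i w + \<Gamma> w (B b i q))))
          + (V' k w \<bullet> b) * T q (\<lambda>i. B b i q))) (at q)"
      by (rule has_derivative_transform_within_open[OF _ S])
    moreover have "(\<Sum>b\<in>Basis. (V k q \<bullet> b) * (\<Sum>i<p. T q ((\<lambda>j. B b j q)(i := B' i w + \<Gamma> w (B b i q))))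
          + (V' k w \<bullet> b) * T q (\<lambda>i. B b i q)) = (\<Sum>i<p. T q ((\<lambda>j. V j q)(i := V' i w + \<Gamma> w (V i q))))" for w
    proof -
      \<comment> \<open>Summing over \<open>b\<close> restores \<open>V k q\<close> in slot
        \<open>k\<close>. For \<open>i = k\<close> only the connection term arises here; the term
        with \<open>V' k w\<close> comes from differentiating the coefficients.\<close>
      have slot: "(\<Sum>b\<in>Basis. (V k q \<bullet> b) * T q ((v(k := b))(i := B' i w + \<Gamma> w ((v(k := b)) i))))
          = (if i = k then T q (v(k := \<Gamma> w (v k))) else T q (v(i := X w i)))" if i: "i < p" for i
      proof (cases "i = k")
        case True
        have "linear (\<lambda>x. T q (v(k := \<Gamma> w x)))"
          using linear_compose[OF \<Gamma> lin[OF S(2) k]] by (simp add: o_def)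
        from linear_basis_expansion[OF this, of "V k q"] show ?thesis
          using True by (simp add: B'_def v_def)
      next
        case False
        have "T q ((v(k := b))(i := B' i w + \<Gamma> w ((v(k := b)) i))) = T q ((v(i := X w i))(k := b))" for b
          using False by (simp add: B'_def X_def v_def fun_upd_twist)
        then show ?thesis
          using linear_basis_expansion[OF lin[OF S(2) k, of "v(i := X w i)"], of "V k q"] False
          by (simp add: v_def fun_upd_idem)
      qed
      have "(\<Sum>b\<in>Basis. (V k q \<bullet> b) * (\<Sum>i<p. T q ((\<lambda>j. B b j q)(i := B' i w + \<Gamma> w (B b i q)))))
        = (\<Sum>i<p. \<Sum>b\<in>Basis. (V k q \<bullet> b) * T q ((v(k := b))(i := B' i w + \<Gamma> w ((v(k := b)) i))))"
        using fun_cong[OF Bq] unfolding sum_distrib_left Bq v_def by (subst sum.swap) simp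
      also have "\<dots> = (\<Sum>i<p. if i = k then T q (v(k := \<Gamma> w (v k))) else T q (v(i := X w i)))"
        by (rule sum.cong) (use slot in auto)
      also have "\<dots> = T q (v(k := \<Gamma> w (v k))) + (\<Sum>i\<in>{..<p} - {k}. T q (v(i := X w i)))"
        using k by (subst sum.remove[of _ k]) auto
      finally have 1: "(\<Sum>b\<in>Basis. (V k q \<bullet> b) * (\<Sum>i<p. T q ((\<lambda>j. B b j q)(i := B' i w + \<Gamma> w (B b i q)))))
        = T q (v(k := \<Gamma> w (v k))) + (\<Sum>i\<in>{..<p} - {k}. T q (v(i := X w i)))" .
      have 2: "(\<Sum>b\<in>Basis. (V' k w \<bullet> b) * T q (\<lambda>i. B b i q)) = T q (v(k := V' k w))"
        using linear_basis_expansion[OF lin[OF S(2) k, of v], of "V' k w"]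
        unfolding Bq v_def by simp
      have "T q (v(k := X w k)) = T q (v(k := V' k w)) + T q (v(k := \<Gamma> w (v k)))"
        using linear_add[OF lin[OF S(2) k, of v]] by (simp add: X_def v_def)
      moreover have "(\<Sum>i<p. T q (v(i := X w i))) = T q (v(k := X w k)) + (\<Sum>i\<in>{..<p} - {k}. T q (v(i := X w i)))"
        using k by (subst sum.remove[of _ k]) auto
      ultimately show ?thesis
        using 1 2 by (simp add: sum.distrib X_def v_def)
    qed
    ultimately show ?case by (simp only:)
  qed
  \<comment> \<open>\<open>main\<close> asks for differentiability in every slot, while
    \<open>U\<close> is controlled only below \<open>p\<close>; the remaining slots are filled with
    zero.\<close>
  define V where "V i = (if i < p then U i else (\<lambda>_. 0))" for i
  define V' where "V' i = (if i < p then U' i else (\<lambda>_. 0))" for i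
  have "((\<lambda>y. T y (\<lambda>i. V i y)) has_derivative
      (\<lambda>w. \<Sum>i<p. T q ((\<lambda>j. V j q)(i := V' i w + \<Gamma> w (V i q))))) (at q)"
    by (rule main[of p]) (use U in \<open>auto simp: V_def V'_def\<close>)
  moreover have "(\<Sum>i<p. T q ((\<lambda>j. V j q)(i := V' i w + \<Gamma> w (V i q)))) =
      (\<Sum>i<p. T q ((\<lambda>j. U j q)(i := U' i w + \<Gamma> w (U i q))))" for w
    by (intro sum.cong loc S) (auto simp: V_def V'_def)
  ultimately have "((\<lambda>y. T y (\<lambda>i. V i y)) has_derivative
      (\<lambda>w. \<Sum>i<p. T q ((\<lambda>j. U j q)(i := U' i w + \<Gamma> w (U i q))))) (at q)" by simp
  then show ?thesis
    by (rule has_derivative_transform_within_open[OF _ S]) (auto intro: loc simp: V_def)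
qed

lemma bilinear_multilinear: "bilinear G \<Longrightarrow> multilinear 2 (\<lambda>u. G (u 0) (u 1))"
  unfolding multilinear_def bilinear_def by (auto simp: less_2_cases_iff)

lemma metric_has_derivative:
  fixes G :: "'y::euclidean_space \<Rightarrow> 'e::euclidean_space \<Rightarrow> 'e \<Rightarrow> real"
  assumes S: "open S" "q \<in> S"
    and G: "\<And>y. y \<in> S \<Longrightarrow> bilinear (G y)"
    and dG: "\<And>u v. ((\<lambda>y. G y u v) has_derivative (\<lambda>w. G q (\<Gamma> w u) v + G q u (\<Gamma> w v))) (at q)"
    and \<Gamma>: "\<And>w. linear (\<Gamma> w)"
    and U: "(U has_derivative U') (at q)" "(V has_derivative V') (at q)"
  shows "((\<lambda>y. G y (U y) (V y)) has_derivative
      (\<lambda>w. G q (U' w + \<Gamma> w (U q)) (V q) + G q (U q) (V' w + \<Gamma> w (V q)))) (at q)"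
proof -
  have 2: "{..<2::nat} = {0, 1}" by auto
  let ?U = "\<lambda>i::nat. if i = 0 then U else V" and ?U' = "\<lambda>i::nat. if i = 0 then U' else V'"
  have "((\<lambda>y. (\<lambda>y u. G y (u 0) (u 1)) y (\<lambda>i. ?U i y)) has_derivative
      (\<lambda>w. \<Sum>i<2. (\<lambda>y u. G y (u 0) (u 1)) q ((\<lambda>j. ?U j q)(i := ?U' i w + \<Gamma> w (?U i q))))) (at q)"
    by (rule multilinear_family_has_derivative[OF S bilinear_multilinear[OF G] _ \<Gamma>])
      (use dG U in \<open>auto simp: 2\<close>)
  then show ?thesis by (simp add: 2)
qed

section \<open>Alternating forms and the cousin condition\<close>

lemma alternating_form_multilinear:
  assumes "alternating_form p UNIV \<omega>"
  shows "multilinear p \<omega>"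
  unfolding multilinear_def
proof (intro conjI allI impI linearI)
  show "\<omega> v = \<omega> u" if "\<forall>i<p. v i = u i" for u v
    using assms that unfolding alternating_form_def by simp
  have lin: "\<omega> (u(i := a *\<^sub>R x + b *\<^sub>R y)) = a * \<omega> (u(i := x)) + b * \<omega> (u(i := y))" if "i < p" for i u x y a b
    using assms that unfolding alternating_form_def by blast
  show "\<omega> (u(i := x + y)) = \<omega> (u(i := x)) + \<omega> (u(i := y))" if "i < p" for i u x y
    using lin[OF that, of u 1 x 1 y] by simp
  show "\<omega> (u(i := c *\<^sub>R x)) = c *\<^sub>R \<omega> (u(i := x))" if "i < p" for i u c x
    using lin[OF that, of u c x 0 x] by simp
qed

lemma alternating_form_slot_linear:
  "alternating_form p UNIV \<omega> \<Longrightarrow> i < p \<Longrightarrow> linear (\<lambda>x. \<omega> (u(i := x)))"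
  using alternating_form_multilinear unfolding multilinear_def by blast

lemma alternating_form_repeated:
  "alternating_form p UNIV \<omega> \<Longrightarrow> i < p \<Longrightarrow> j < p \<Longrightarrow> i \<noteq> j \<Longrightarrow> v i = v j \<Longrightarrow> \<omega> v = 0"
  unfolding alternating_form_def by blast

lemma alternating_form_swap:
  assumes \<omega>: "alternating_form p UNIV \<omega>" and ij: "i < p" "j < p" "i \<noteq> j"
  shows "\<omega> (v(i := x, j := y)) = - \<omega> (v(i := y, j := x))"
proof -
  have z: "\<omega> (v(i := a, j := a)) = 0" for a
    using alternating_form_repeated[OF \<omega> ij] ij by simp
  have l1: "\<omega> (v(i := a + b, j := c)) = \<omega> (v(i := a, j := c)) + \<omega> (v(i := b, j := c))" for a b c
    using linear_add[OF alternating_form_slot_linear[OF \<omega> ij(1), of "v(j := c)"], of a b] ij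
    by (simp add: fun_upd_twist)
  have l2: "\<omega> (v(i := c, j := a + b)) = \<omega> (v(i := c, j := a)) + \<omega> (v(i := c, j := b))" for a b c
    using linear_add[OF alternating_form_slot_linear[OF \<omega> ij(2), of "v(i := c)"], of a b] by simp
  have "0 = \<omega> (v(i := x + y, j := x + y))" using z by simp
  also have "\<dots> = \<omega> (v(i := x, j := y)) + \<omega> (v(i := y, j := x))"
    unfolding l1 l2 using z by simp
  finally show ?thesis by simp
qed


text \<open>Subtracting from \<open>x\<close> its projection to the frame leaves a normal vector,
  which the cousin hypothesis kills. Of the projection only the component along \<open>v i\<close>
  survives, since any other one repeats an entry.\<close>

lemma alternating_form_orthonormal_slot:
  assumes \<omega>: "alternating_form p UNIV \<omega>" and i: "i < p"
    and x: "\<And>x. (\<forall>j<p. G x (v j) = 0) \<Longrightarrow> \<omega> (v(i := x)) = 0"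
    and G: "bilinear G" and on: "\<And>i j. i < p \<Longrightarrow> j < p \<Longrightarrow> G (v i) (v j) = (if i = j then 1 else 0 :: real)"
  shows "\<omega> (v(i := x)) = G x (v i) * \<omega> v"
proof -
  note lin = alternating_form_slot_linear[OF \<omega> i, of v]
  define T where "T = (\<Sum>j<p. G x (v j) *\<^sub>R v j)"
  have linG: "linear (\<lambda>x. G x y)" for y using G unfolding bilinear_def by blast
  have "G (x - T) (v k) = 0" if "k < p" for k
  proof -
    have "G T (v k) = (\<Sum>j<p. G x (v j) * G (v j) (v k))"
      unfolding T_def by (simp add: linear_sum[OF linG] linear_cmul[OF linG])
    also have "\<dots> = (\<Sum>j<p. if j = k then G x (v j) else 0)"
      using that on by (intro sum.cong) auto
    finally show ?thesis using that by (simp add: linear_diff[OF linG])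
  qed
  then have "\<omega> (v(i := x - T)) = 0" using x by blast
  then have "\<omega> (v(i := x)) = \<omega> (v(i := T))" by (simp add: linear_diff[OF lin])
  also have "\<dots> = (\<Sum>j<p. G x (v j) * \<omega> (v(i := v j)))"
    unfolding T_def by (simp add: linear_sum[OF lin] linear_cmul[OF lin])
  also have "\<dots> = (\<Sum>j<p. if j = i then G x (v j) * \<omega> v else 0)"
  proof (intro sum.cong refl)
    fix j assume j: "j \<in> {..<p}"
    show "G x (v j) * \<omega> (v(i := v j)) = (if j = i then G x (v j) * \<omega> v else 0)"
      using j i alternating_form_repeated[OF \<omega>, of i j "v(i := v j)"] by (cases "j = i") auto
  qed
  finally show ?thesis using i by simp
qed

text \<open>For \<open>x = v m\<close> the value vanishes in each case: \<open>m = k\<close> leaves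
  the frame with \<open>n\<close> in slot \<open>i\<close>, \<open>m = i\<close> leaves it, after a
  swap, with \<open>n\<close> in slot \<open>k\<close>, and any other \<open>m\<close> repeats an
  entry. This is why tangential parts drop out.\<close>

lemma alternating_form_span_slot:
  assumes \<omega>: "alternating_form p UNIV \<omega>" and ik: "i < p" "k < p" "i \<noteq> k"
    and cousin: "\<And>i. i < p \<Longrightarrow> \<omega> (v(i := n)) = 0"
    and x: "x \<in> span (v ` {..<p})"
  shows "\<omega> (v(i := n, k := x)) = 0"
  using x
proof (induction rule: span_induct)
  case base
  have "linear (\<lambda>x. \<omega> (v(i := n, k := x)))" by (rule alternating_form_slot_linear[OF \<omega> ik(2)])
  from linear_subspace_kernel[OF this] show ?case .
next
  case (step x)
  then obtain m where m: "m < p" "x = v m" by auto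
  consider "m = k" | "m = i" | "m \<noteq> k" "m \<noteq> i" by blast
  then show ?case
  proof cases
    case 1
    then have "v(i := n, k := x) = v(i := n)" using m ik by auto
    then show ?thesis using cousin[OF ik(1)] by (simp only:)
  next
    case 2
    then have "v(i := x, k := n) = v(k := n)" using m ik by auto
    then show ?thesis
      using cousin[OF ik(2)] alternating_form_swap[OF \<omega> ik, of v n x] by (simp only: minus_zero)
  next
    case 3
    then have "(v(i := n, k := x)) m = (v(i := n, k := x)) k" using m by simp
    then show ?thesis using alternating_form_repeated[OF \<omega> m(1) ik(2) 3(1)] by blast
  qed
qed

text \<open>The differentiation argument in coordinates: all data are pulled back to a chart of \<open>N\<close>, \<open>A\<close> is
  the orthonormal frame, \<open>a\<close> its coordinates at \<open>q\<close>, and \<open>\<sigma> + \<theta>\<close> splits \<open>\<nabla>\<^bsub>A\<^sub>i\<^esub> A\<^sub>j\<close> at \<open>q\<close> into a symmetric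
  and a tangential part.\<close>

lemma local_minimality:
  fixes A :: "nat \<Rightarrow> 'f::euclidean_space \<Rightarrow> 'e::euclidean_space"
    and G :: "'f \<Rightarrow> 'e \<Rightarrow> 'e \<Rightarrow> real" and \<Phi> :: "'f \<Rightarrow> (nat \<Rightarrow> 'e) \<Rightarrow> real"
  assumes S: "open S" "q \<in> S"
    and G: "\<And>y. y \<in> S \<Longrightarrow> bilinear (G y)" "\<And>y u v. y \<in> S \<Longrightarrow> G y u v = G y v u"
    and dG: "\<And>u v. ((\<lambda>y. G y u v) has_derivative (\<lambda>w. G q (\<Gamma> w u) v + G q u (\<Gamma> w v))) (at q)"
    and \<Gamma>: "\<And>w. linear (\<Gamma> w)"
    and \<Phi>: "\<And>y. y \<in> S \<Longrightarrow> alternating_form p UNIV (\<Phi> y)"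
    and d\<Phi>: "\<And>u. ((\<lambda>y. \<Phi> y u) has_derivative (\<lambda>w. \<Sum>i<p. \<Phi> q (u(i := \<Gamma> w (u i))))) (at q)"
    and dA: "\<And>i. i < p \<Longrightarrow> (A i has_derivative A' i) (at q)"
    and on: "\<And>y i j. y \<in> S \<Longrightarrow> i < p \<Longrightarrow> j < p \<Longrightarrow> G y (A i y) (A j y) = (if i = j then 1 else 0)"
    and cousin: "\<And>y n i. y \<in> S \<Longrightarrow> \<forall>j<p. G y n (A j y) = 0 \<Longrightarrow> i < p \<Longrightarrow> \<Phi> y ((\<lambda>j. A j y)(i := n)) = 0"
    and split: "\<And>i j. i < p \<Longrightarrow> j < p \<Longrightarrow> A' j (a i) + \<Gamma> (a i) (A j q) = \<sigma> i j + \<theta> i j"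
    and \<sigma>: "\<And>i j. i < p \<Longrightarrow> j < p \<Longrightarrow> \<sigma> i j = \<sigma> j i"
    and \<theta>: "\<And>i j. i < p \<Longrightarrow> j < p \<Longrightarrow> \<theta> i j \<in> span ((\<lambda>j. A j q) ` {..<p})"
    and nz: "\<Phi> q (\<lambda>j. A j q) \<noteq> 0"
    and n: "\<forall>j<p. G q n (A j q) = 0"
  shows "(\<Sum>i<p. G q n (\<sigma> i i)) = 0"
proof -
  define e where "e = (\<lambda>j. A j q)"
  note lin\<Phi> = alternating_form_slot_linear[OF \<Phi>[OF S(2)]]
  have linG1: "linear (\<lambda>x. G y x v)" if "y \<in> S" for y v
    using G(1)[OF that] unfolding bilinear_def by blast
  have linG2: "linear (\<lambda>x. G y v x)" if "y \<in> S" for y v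
    using G(1)[OF that] unfolding bilinear_def by blast
  \<comment> \<open>The constant vector \<open>n\<close> is projected away from the frame at every
    point. The result is normal on all of \<open>S\<close> and equals \<open>n\<close> at
    \<open>q\<close>, so the cousin identity holds along it and can be differentiated.\<close>
  define \<nu> where "\<nu> y = n - (\<Sum>j<p. G y n (A j y) *\<^sub>R A j y)" for y
  have \<nu>q: "\<nu> q = n" unfolding \<nu>_def using n by simp
  have \<nu>_orth: "G y (\<nu> y) (A k y) = 0" if y: "y \<in> S" and k: "k < p" for y k
  proof -
    have "G y (\<nu> y) (A k y) = G y n (A k y) - (\<Sum>j<p. G y n (A j y) * G y (A j y) (A k y))"
      unfolding \<nu>_def using linG1[OF y, of "A k y"]
      by (simp add: linear_diff[OF linG1[OF y]] linear_sum[OF linG1[OF y]] linear_cmul[OF linG1[OF y]])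
    also have "(\<Sum>j<p. G y n (A j y) * G y (A j y) (A k y)) = (\<Sum>j<p. if j = k then G y n (A j y) else 0)"
      using on[OF y _ k] by (intro sum.cong) auto
    finally show ?thesis using k by simp
  qed
  obtain \<nu>' where \<nu>': "(\<nu> has_derivative \<nu>') (at q)"
  proof
    show "(\<nu> has_derivative (\<lambda>w. 0 - (\<Sum>j<p. G q n (A j q) *\<^sub>R A' j w +
        (G q (0 + \<Gamma> w n) (A j q) + G q n (A' j w + \<Gamma> w (A j q))) *\<^sub>R A j q))) (at q)"
      unfolding \<nu>_def
      by (intro has_derivative_diff has_derivative_const has_derivative_sum has_derivative_scaleR dA
          metric_has_derivative[OF S G(1) dG \<Gamma>]) auto
  qed
  \<comment> \<open>At \<open>q\<close>, \<open>N w\<close> is the covariant derivative of the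
    normal field along \<open>w\<close>, and \<open>K i j\<close> that of the frame field
    \<open>A j\<close> along \<open>a i\<close>.\<close>
  define N where "N w = \<nu>' w + \<Gamma> w n" for w
  define K where "K i j = A' j (a i) + \<Gamma> (a i) (e j)" for i j
  have K: "K i j = \<sigma> i j + \<theta> i j" if "i < p" "j < p" for i j
    using split[OF that] unfolding K_def e_def .
  have cousin_e: "\<Phi> q (e(i := x)) = 0" if "\<forall>j<p. G q x (e j) = 0" "i < p" for x i
    using cousin[OF S(2) _ that(2)] that(1) unfolding e_def by blast
  \<comment> \<open>The derivative along \<open>a i\<close> of a function that is identically zero
    on \<open>S\<close>; the term differentiating the normal field in slot \<open>i\<close> is split
    off.\<close>
  have eq: "\<Phi> q (e(i := N (a i))) + (\<Sum>k\<in>{..<p} - {i}. \<Phi> q (e(i := n, k := K i k))) = 0"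
    if i: "i < p" for i
  proof -
    define U where "U = A(i := \<nu>)"
    define U' where "U' = A'(i := \<nu>')"
    have Uy: "(\<lambda>j. U j y) = (\<lambda>j. A j y)(i := \<nu> y)" for y unfolding U_def by auto
    have "((\<lambda>y. \<Phi> y (\<lambda>i. U i y)) has_derivative
      (\<lambda>w. \<Sum>k<p. \<Phi> q ((\<lambda>j. U j q)(k := U' k w + \<Gamma> w (U k q))))) (at q)"
      by (rule multilinear_family_has_derivative[OF S alternating_form_multilinear[OF \<Phi>] d\<Phi> \<Gamma>])
        (use dA \<nu>' in \<open>auto simp: U_def U'_def\<close>)
    moreover have "((\<lambda>y. \<Phi> y (\<lambda>i. U i y)) has_derivative (\<lambda>w. 0)) (at q)"
      by (rule has_derivative_transform_within_open[OF has_derivative_const S])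
        (use cousin \<nu>_orth i in \<open>simp add: Uy\<close>)
    ultimately have "(\<lambda>w. \<Sum>k<p. \<Phi> q ((\<lambda>j. U j q)(k := U' k w + \<Gamma> w (U k q)))) = (\<lambda>w. 0)"
      by (rule has_derivative_unique)
    from fun_cong[OF this, of "a i"]
    have "(\<Sum>k<p. \<Phi> q ((e(i := n))(k := U' k (a i) + \<Gamma> (a i) (U k q)))) = 0"
      unfolding Uy \<nu>q e_def .
    then have "\<Phi> q ((e(i := n))(i := U' i (a i) + \<Gamma> (a i) (U i q)))
        + (\<Sum>k\<in>{..<p} - {i}. \<Phi> q ((e(i := n))(k := U' k (a i) + \<Gamma> (a i) (U k q)))) = 0"
      using i by (subst (asm) sum.remove[of _ i]) auto
    moreover have "(\<Sum>k\<in>{..<p} - {i}. \<Phi> q ((e(i := n))(k := U' k (a i) + \<Gamma> (a i) (U k q))))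
        = (\<Sum>k\<in>{..<p} - {i}. \<Phi> q (e(i := n, k := K i k)))"
      by (intro sum.cong) (auto simp: U_def U'_def K_def e_def)
    moreover have "U' i (a i) + \<Gamma> (a i) (U i q) = N (a i)"
      by (simp add: U_def U'_def N_def \<nu>q)
    ultimately show ?thesis by simp
  qed
  \<comment> \<open>The difference of the two sides has the tangent vector
    \<open>\<theta> i k\<close> in slot \<open>k\<close>.\<close>
  have K\<sigma>: "\<Phi> q (e(i := n, k := K i k)) = \<Phi> q (e(i := n, k := \<sigma> i k))"
    if ik: "i < p" "k < p" "i \<noteq> k" for i k
  proof -
    have "\<Phi> q (e(i := n, k := \<theta> i k)) = 0"
      by (rule alternating_form_span_slot[OF \<Phi>[OF S(2)] ik])
        (use cousin_e n \<theta>[OF ik(1,2)] in \<open>auto simp: e_def\<close>)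
    then show ?thesis unfolding K[OF ik(1,2)] by (simp add: linear_add[OF lin\<Phi>[OF ik(2)]])
  qed
  \<comment> \<open>The zero diagonal extends the sums over \<open>k \<noteq> i\<close> to the full
    square. There the symmetry of \<open>\<sigma>\<close> and the sign of a swap cancel the terms in
    pairs.\<close>
  define D where "D i k = (if i = k then 0 else \<Phi> q (e(i := n, k := \<sigma> i k)))" for i k
  have D_anti: "D k i = - D i k" if "i < p" "k < p" for i k
  proof (cases "i = k")
    case False
    have "e(k := n, i := \<sigma> i k) = e(i := \<sigma> i k, k := n)" using False by (rule fun_upd_twist[symmetric])
    then show ?thesis
      using alternating_form_swap[OF \<Phi>[OF S(2)] that False, of e n "\<sigma> i k"] \<sigma>[OF that] False
      unfolding D_def by simp
  qed (simp add: D_def)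
  have "(\<Sum>i<p. \<Sum>k<p. D i k) = (\<Sum>i<p. \<Sum>k<p. D k i)" by (rule sum.swap)
  also have "\<dots> = - (\<Sum>i<p. \<Sum>k<p. D i k)"
    unfolding sum_negf[symmetric] by (intro sum.cong refl D_anti) auto
  finally have D0: "(\<Sum>i<p. \<Sum>k<p. D i k) = 0" by simp
  have "\<Phi> q (e(i := N (a i))) = - (\<Sum>k<p. D i k)" if i: "i < p" for i
  proof -
    have "(\<Sum>k<p. D i k) = D i i + (\<Sum>k\<in>{..<p} - {i}. D i k)"
      using i by (subst sum.remove[of _ i]) auto
    also have "\<dots> = (\<Sum>k\<in>{..<p} - {i}. \<Phi> q (e(i := n, k := K i k)))"
      using K\<sigma>[OF i] by (simp add: D_def)
    finally show ?thesis using eq[OF i] by linarith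
  qed
  then have "(\<Sum>i<p. \<Phi> q (e(i := N (a i)))) = 0" using D0 by (simp add: sum_negf)
  moreover have "\<Phi> q (e(i := N (a i))) = - G q n (\<sigma> i i) * \<Phi> q e" if i: "i < p" for i
  proof -
    have "\<Phi> q (e(i := N (a i))) = G q (N (a i)) (e i) * \<Phi> q e"
      by (rule alternating_form_orthonormal_slot[OF \<Phi>[OF S(2)] i _ G(1)[OF S(2)]])
        (use cousin_e i on[OF S(2)] in \<open>auto simp: e_def\<close>)
    \<comment> \<open>The Weingarten relation: metric compatibility applied to the vanishing
      function \<open>G y (\<nu> y) (A i y)\<close> moves the derivative from the normal field to
      the frame.\<close>
    moreover have "G q (N (a i)) (e i) + G q n (K i i) = 0"
    proof -
      have "((\<lambda>y. G y (\<nu> y) (A i y)) has_derivative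
        (\<lambda>w. G q (\<nu>' w + \<Gamma> w (\<nu> q)) (A i q) + G q (\<nu> q) (A' i w + \<Gamma> w (A i q)))) (at q)"
        by (rule metric_has_derivative[OF S G(1) dG \<Gamma> \<nu>' dA[OF i]])
      moreover have "((\<lambda>y. G y (\<nu> y) (A i y)) has_derivative (\<lambda>w. 0)) (at q)"
        by (rule has_derivative_transform_within_open[OF has_derivative_const S])
          (use \<nu>_orth i in simp)
      ultimately have "(\<lambda>w. G q (\<nu>' w + \<Gamma> w (\<nu> q)) (A i q) + G q (\<nu> q) (A' i w + \<Gamma> w (A i q))) = (\<lambda>w. 0)"
        by (rule has_derivative_unique)
      from fun_cong[OF this, of "a i"] show ?thesis unfolding \<nu>q N_def K_def e_def .
    qed
    moreover have "G q n (\<theta> i i) = 0"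
      using \<theta>[OF i i]
    proof (induction rule: span_induct)
      case base
      show ?case using linear_subspace_kernel[OF linG2[OF S(2), of n]] by (simp add: vimage_def)
    next
      case (step x)
      then show ?case using n by auto
    qed
    then have "G q n (K i i) = G q n (\<sigma> i i)"
      unfolding K[OF i i] by (simp add: linear_add[OF linG2[OF S(2)]])
    ultimately show ?thesis by (metis add_eq_0_iff2)
  qed
  ultimately have "(\<Sum>i<p. - G q n (\<sigma> i i) * \<Phi> q e) = 0" by simp
  then have "(\<Sum>i<p. G q n (\<sigma> i i)) * \<Phi> q e = 0" by (simp add: sum_distrib_right sum_negf)
  then show ?thesis using nz unfolding e_def by simp
qed

section \<open>Changes of charts\<close>

lemma smooth_manifold_chart:
  assumes "smooth_manifold M" "c \<in> atlas M"
  shows chart_domain_open: "openin (mtop M) (fst c)"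
    and chart_inj_on: "inj_on (snd c) (fst c)"
    and chart_image_open: "openin (mtop M) W \<Longrightarrow> open (snd c ` (W \<inter> fst c))"
proof -
  have hom: "homeomorphic_map (subtopology (mtop M) (fst c)) (top_of_set (snd c ` fst c)) (snd c)"
    and op: "open (snd c ` fst c)" and dom: "openin (mtop M) (fst c)"
    using assms unfolding smooth_manifold_def by blast+
  show "openin (mtop M) (fst c)" by (rule dom)
  have top: "topspace (subtopology (mtop M) (fst c)) = fst c"
    using openin_subset[OF dom] by (auto simp: topspace_subtopology)
  show "inj_on (snd c) (fst c)"
    using hom top unfolding homeomorphic_eq_everything_map by simp
  assume "openin (mtop M) W"
  then have "openin (subtopology (mtop M) (fst c)) (W \<inter> fst c)"
    by (auto simp: openin_subtopology)
  then have "openin (top_of_set (snd c ` fst c)) (snd c ` (W \<inter> fst c))"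
    using homeomorphic_imp_open_map[OF hom] unfolding open_map_def by blast
  then show "open (snd c ` (W \<inter> fst c))" using op openin_open_eq by blast
qed

lemma chart_inv_left:
  "smooth_manifold M \<Longrightarrow> c \<in> atlas M \<Longrightarrow> x \<in> fst c \<Longrightarrow> chart_inv c (snd c x) = x"
  by (simp add: chart_inj_on)

lemma charts_at_point: "smooth_manifold M \<Longrightarrow> c \<in> charts_at M x \<Longrightarrow> x \<in> points M"
  unfolding charts_at_def using chart_domain_open openin_subset by blast

lemma charts_at_nonempty: "smooth_manifold M \<Longrightarrow> x \<in> points M \<Longrightarrow> \<exists>c. c \<in> charts_at M x"
  unfolding smooth_manifold_def charts_at_def by auto

text \<open>The hypotheses on \<open>N\<close> of a submanifold except for the immersion condition; in this form
  they also hold for \<open>N = M\<close>.\<close>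

definition smooth_inclusion ::
    "('a, 'e::euclidean_space) manifold \<Rightarrow> ('a, 'f::euclidean_space) manifold \<Rightarrow> bool" where
  "smooth_inclusion M N \<longleftrightarrow> smooth_manifold M \<and> smooth_manifold N \<and> points N \<subseteq> points M \<and>
     continuous_map (mtop N) (mtop M) (\<lambda>x. x) \<and>
     (\<forall>d\<in>atlas N. \<forall>c\<in>atlas M. smooth_on (snd d ` (fst d \<inter> fst c)) (snd c \<circ> chart_inv d))"

lemma smooth_inclusion_refl: "smooth_manifold M \<Longrightarrow> smooth_inclusion M M"
  unfolding smooth_inclusion_def by (auto simp: smooth_manifold_def)

lemma submanifold_smooth_inclusion:
  "smooth_manifold M \<Longrightarrow> submanifold M N \<Longrightarrow> smooth_inclusion M N"
  unfolding smooth_inclusion_def submanifold_def by blast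

text \<open>The differential of the inclusion of N in M, read from the chart \<open>d\<close> of N
  to the chart \<open>c\<close> of M. For N = M it is the Jacobian of a coordinate change, so one
  calculus serves both.\<close>

abbreviation dtrans :: "('a, 'f::euclidean_space) chart \<Rightarrow> ('a, 'e::euclidean_space) chart \<Rightarrow> 'a \<Rightarrow> 'f \<Rightarrow> 'e" where
  "dtrans d c x \<equiv> frechet_derivative (snd c \<circ> chart_inv d) (at (snd d x))"

text \<open>The Hessian of the inclusion in charts: \<open>u\<close> is the direction of the first
  derivative, \<open>w\<close> that of the second.\<close>

abbreviation d2trans :: "('a, 'f::euclidean_space) chart \<Rightarrow> ('a, 'e::euclidean_space) chart \<Rightarrow> 'a \<Rightarrow> 'f \<Rightarrow> 'f \<Rightarrow> 'e" where
  "d2trans d c x u w \<equiv>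
     frechet_derivative (\<lambda>y. frechet_derivative (snd c \<circ> chart_inv d) (at y) u) (at (snd d x)) w"

lemma inclusion_openin:
  assumes "smooth_inclusion M N" "openin (mtop M) U" "openin (mtop N) W"
  shows "openin (mtop N) (W \<inter> U)"
proof -
  have "openin (mtop N) {x \<in> topspace (mtop N). x \<in> U}"
    using assms(1,2) unfolding smooth_inclusion_def
    using openin_continuous_map_preimage[of "mtop N" "mtop M" "\<lambda>x. x" U] by blast
  from openin_Int[OF assms(3) this] have "openin (mtop N) (W \<inter> {x \<in> topspace (mtop N). x \<in> U})" .
  moreover have "W \<inter> {x \<in> topspace (mtop N). x \<in> U} = W \<inter> U"
    using openin_subset[OF assms(3)] by blast
  ultimately show ?thesis by simp
qed

lemma inclusion_overlap_open:
  assumes "smooth_inclusion M N" "d \<in> atlas N" "c \<in> atlas M"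
  shows "open (snd d ` (fst d \<inter> fst c))"
proof -
  have M: "smooth_manifold M" and N: "smooth_manifold N"
    using assms unfolding smooth_inclusion_def by auto
  have "openin (mtop N) (fst d \<inter> fst c)"
    using inclusion_openin[OF assms(1) chart_domain_open[OF M assms(3)] chart_domain_open[OF N assms(2)]] .
  from chart_image_open[OF N assms(2) this] show ?thesis by (simp add: Int_commute Int_left_commute)
qed

lemma inclusion_smooth:
  "smooth_inclusion M N \<Longrightarrow> d \<in> atlas N \<Longrightarrow> c \<in> atlas M \<Longrightarrow>
    smooth_on (snd d ` (fst d \<inter> fst c)) (snd c \<circ> chart_inv d)"
  unfolding smooth_inclusion_def by blast

lemma dtrans_has_derivative:
  assumes "smooth_inclusion M N" "d \<in> charts_at N x" "c \<in> charts_at M x"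
  shows "((snd c \<circ> chart_inv d) has_derivative dtrans d c x) (at (snd d x))"
proof (rule smooth_on_has_derivative[OF inclusion_smooth[OF assms(1)]])
  show "d \<in> atlas N" "c \<in> atlas M" "snd d x \<in> snd d ` (fst d \<inter> fst c)"
    using assms(2,3) unfolding charts_at_def by auto
qed

lemma dtrans_linear:
  assumes "smooth_inclusion M N" "d \<in> charts_at N x" "c \<in> charts_at M x"
  shows "linear (dtrans d c x)"
  using dtrans_has_derivative[OF assms] has_derivative_linear by blast

lemma d2trans_has_derivative:
  assumes "smooth_inclusion M N" "d \<in> charts_at N x" "c \<in> charts_at M x"
  shows "((\<lambda>y. frechet_derivative (snd c \<circ> chart_inv d) (at y) u) has_derivative d2trans d c x u) (at (snd d x))"
proof -
  have "d \<in> atlas N" "c \<in> atlas M" "snd d x \<in> snd d ` (fst d \<inter> fst c)"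
    using assms unfolding charts_at_def by auto
  note cd = this
  show ?thesis
    by (rule smooth_on_has_derivative[OF smooth_on_frechet_derivative cd(3)])
      (rule inclusion_overlap_open[OF assms(1) cd(1,2)] inclusion_smooth[OF assms(1) cd(1,2)])+
qed

lemma d2trans_symmetric:
  assumes "smooth_inclusion M N" "d \<in> charts_at N x" "c \<in> charts_at M x"
  shows "d2trans d c x u w = d2trans d c x w u"
proof -
  have "d \<in> atlas N" "c \<in> atlas M" "snd d x \<in> snd d ` (fst d \<inter> fst c)"
    using assms unfolding charts_at_def by auto
  note cd = this
  show ?thesis
    by (rule smooth_on_second_derivative_symmetric[OF _ _ cd(3)])
      (rule inclusion_overlap_open[OF assms(1) cd(1,2)] inclusion_smooth[OF assms(1) cd(1,2)])+
qed

lemma d2trans_bilinear: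
  assumes "smooth_inclusion M N" "d \<in> charts_at N x" "c \<in> charts_at M x"
  shows "bilinear (d2trans d c x)"
proof -
  have 1: "linear (\<lambda>w. d2trans d c x u w)" for u
    using d2trans_has_derivative[OF assms, of u] has_derivative_linear by blast
  have "linear (\<lambda>u. d2trans d c x u w)" for w
    using 1[of w] unfolding d2trans_symmetric[OF assms, of _ w] .
  then show ?thesis using 1 unfolding bilinear_def by blast
qed

text \<open>On the overlap \<open>h\<close> in the chart \<open>d\<close> is \<open>h\<close> in the
  chart \<open>c\<close> composed with the coordinate form of the inclusion, so this is the chain
  rule. Both uses matter: restriction from M to N, and change of chart within one manifold.\<close>

lemma derivative_change_chart:
  assumes "smooth_inclusion M N" "d \<in> charts_at N x" "c \<in> charts_at M x"
    and h: "((h \<circ> chart_inv c) has_derivative H) (at (snd c x))"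
  shows "((h \<circ> chart_inv d) has_derivative (\<lambda>w. H (dtrans d c x w))) (at (snd d x))"
proof -
  have M: "smooth_manifold M" and N: "smooth_manifold N"
    using assms unfolding smooth_inclusion_def by auto
  have cd: "c \<in> atlas M" "d \<in> atlas N" "x \<in> fst c" "x \<in> fst d"
    using assms unfolding charts_at_def by auto
  have "((h \<circ> chart_inv c) has_derivative H) (at ((snd c \<circ> chart_inv d) (snd d x)))"
    using h chart_inv_left[OF N cd(2,4)] by simp
  from has_derivative_compose[OF dtrans_has_derivative[OF assms(1-3)] this]
  have "((\<lambda>y. (h \<circ> chart_inv c) ((snd c \<circ> chart_inv d) y)) has_derivative (\<lambda>w. H (dtrans d c x w))) (at (snd d x))" .
  then show ?thesis
  proof (rule has_derivative_transform_within_open[OF _ inclusion_overlap_open[OF assms(1) cd(2,1)]])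
    show "snd d x \<in> snd d ` (fst d \<inter> fst c)" using cd by blast
    fix y assume "y \<in> snd d ` (fst d \<inter> fst c)"
    then obtain z where z: "z \<in> fst d" "z \<in> fst c" "y = snd d z" by blast
    then show "(h \<circ> chart_inv c) ((snd c \<circ> chart_inv d) y) = (h \<circ> chart_inv d) y"
      using chart_inv_left[OF M cd(1)] chart_inv_left[OF N cd(2)] by simp
  qed
qed

text \<open>Take \<open>h\<close> in the previous lemma to be the coordinate map of
  \<open>b\<close>.\<close>

lemma dtrans_trans:
  assumes "smooth_inclusion M N" "d \<in> charts_at N x" "c \<in> charts_at M x"
    and "smooth_inclusion L M" "b \<in> charts_at L x"
  shows "dtrans d b x w = dtrans c b x (dtrans d c x w)"
  using fun_cong[OF frechet_derivative_at[OF derivative_change_chart[OF assms(1-3)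
        dtrans_has_derivative[OF assms(4,3,5)]]], of w] by (rule sym)

lemma dtrans_refl:
  assumes "smooth_manifold M" "c \<in> charts_at M x"
  shows "dtrans c c x u = u"
proof -
  have c: "c \<in> atlas M" "x \<in> fst c" using assms unfolding charts_at_def by auto
  have "((snd c \<circ> chart_inv c) has_derivative (\<lambda>u. u)) (at (snd c x))"
  proof (rule has_derivative_transform_within_open[OF has_derivative_ident])
    show "open (snd c ` (fst c \<inter> fst c))"
      using inclusion_overlap_open[OF smooth_inclusion_refl[OF assms(1)] c(1) c(1)] .
  qed (use c chart_inv_left[OF assms(1) c(1)] in auto)
  from fun_cong[OF frechet_derivative_at[OF this], of u] show ?thesis by (rule sym)
qed

lemma dtrans_inverse:
  assumes "smooth_manifold M" "c \<in> charts_at M x" "c' \<in> charts_at M x"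
  shows "dtrans c' c x (dtrans c c' x u) = u"
  using dtrans_trans[OF smooth_inclusion_refl[OF assms(1)] assms(2,3) smooth_inclusion_refl[OF assms(1)] assms(2)]
  unfolding dtrans_refl[OF assms(1,2)] by (rule sym)

section \<open>Tangent vectors in coordinates\<close>

lemma tangent_vector_change_chart:
  "v \<in> tangent_space M x \<Longrightarrow> c \<in> charts_at M x \<Longrightarrow> c' \<in> charts_at M x \<Longrightarrow> v c' = dtrans c c' x (v c)"
  unfolding tangent_space_def by blast

lemma coord_vec_tangent:
  assumes "smooth_manifold M" "c \<in> charts_at M x"
  shows "coord_vec M c x u \<in> tangent_space M x"
proof -
  note incl = smooth_inclusion_refl[OF assms(1)]
  have "coord_vec M c x u d = dtrans b d x (coord_vec M c x u b)"
    if bd: "b \<in> charts_at M x" "d \<in> charts_at M x" for b d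
    unfolding coord_vec_def bd[THEN eqTrueI] if_True
    by (rule dtrans_trans[OF incl assms(2) bd(1) incl bd(2)])
  moreover have "coord_vec M c x u d = 0" if "d \<notin> charts_at M x" for d
    using that by (simp add: coord_vec_def)
  ultimately show ?thesis unfolding tangent_space_def by blast
qed

lemma coord_vec_apply:
  "c' \<in> charts_at M x \<Longrightarrow> coord_vec M c x u c' = dtrans c c' x u"
  unfolding coord_vec_def by simp

lemma coord_vec_same:
  "smooth_manifold M \<Longrightarrow> c \<in> charts_at M x \<Longrightarrow> coord_vec M c x u c = u"
  unfolding coord_vec_def by (simp add: dtrans_refl)

lemma coord_vec_tangent_vector:
  assumes "v \<in> tangent_space M x" "c \<in> charts_at M x"
  shows "coord_vec M c x (v c) = v"
proof
  fix d
  show "coord_vec M c x (v c) d = v d"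
  proof (cases "d \<in> charts_at M x")
    case True
    then show ?thesis using tangent_vector_change_chart[OF assms True] by (simp add: coord_vec_def)
  next
    case False
    moreover have "v d = 0" using assms(1) False unfolding tangent_space_def by blast
    ultimately show ?thesis by (simp add: coord_vec_def)
  qed
qed

lemma tangent_vector_eqI:
  "v \<in> tangent_space M x \<Longrightarrow> w \<in> tangent_space M x \<Longrightarrow> c \<in> charts_at M x \<Longrightarrow> v c = w c \<Longrightarrow> v = w"
  by (metis coord_vec_tangent_vector)

lemma coord_vec_change_chart:
  assumes "smooth_manifold M" "c \<in> charts_at M x" "c' \<in> charts_at M x"
  shows "coord_vec M c x u = coord_vec M c' x (dtrans c c' x u)"
  by (rule tangent_vector_eqI[OF coord_vec_tangent[OF assms(1,2)] coord_vec_tangent[OF assms(1,3)] assms(3)])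
    (simp add: coord_vec_apply assms dtrans_refl[OF assms(1,3)])

lemma coord_vec_linear:
  assumes "smooth_manifold M" "c \<in> charts_at M x"
  shows "linear (coord_vec M c x)"
proof (rule linearI)
  note lin = dtrans_linear[OF smooth_inclusion_refl[OF assms(1)] assms(2)]
  show "coord_vec M c x (u + v) = coord_vec M c x u + coord_vec M c x v" for u v
    by (rule ext) (simp add: coord_vec_def linear_add[OF lin])
  show "coord_vec M c x (r *\<^sub>R u) = r *\<^sub>R coord_vec M c x u" for r u
    by (rule ext) (simp add: coord_vec_def linear_cmul[OF lin] scaleR_fun_def)
qed

lemma tangent_space_subspace:
  assumes "smooth_manifold M" "x \<in> points M"
  shows "subspace (tangent_space M x)"
proof -
  obtain c where c: "c \<in> charts_at M x" using charts_at_nonempty[OF assms] by blast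
  have "tangent_space M x = range (coord_vec M c x)"
  proof
    show "tangent_space M x \<subseteq> range (coord_vec M c x)"
      using coord_vec_tangent_vector[OF _ c] by (metis rangeI subsetI)
    show "range (coord_vec M c x) \<subseteq> tangent_space M x"
      using coord_vec_tangent[OF assms(1) c] by blast
  qed
  then show ?thesis using linear_subspace_image[OF coord_vec_linear[OF assms(1) c] subspace_UNIV] by simp
qed

text \<open>Frees \<open>dir_deriv\<close> from the arbitrary chart in its definition: the Jacobian
  that changes the derivative of \<open>h\<close> is the one that relates the representations of
  \<open>v\<close>.\<close>

lemma dir_deriv_chart:
  assumes "smooth_manifold N" "d \<in> charts_at N x" "v \<in> tangent_space N x"
    and h: "((h \<circ> chart_inv d) has_derivative H) (at (snd d x))"
  shows "dir_deriv N x v h = H (v d)"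
proof -
  define b where "b = (SOME c. c \<in> charts_at N x)"
  have b: "b \<in> charts_at N x" unfolding b_def using assms(2) by (rule someI)
  have "((h \<circ> chart_inv b) has_derivative (\<lambda>w. H (dtrans b d x w))) (at (snd b x))"
    by (rule derivative_change_chart[OF smooth_inclusion_refl[OF assms(1)] b assms(2) h])
  from fun_cong[OF frechet_derivative_at[OF this], of "v b"]
  have "dir_deriv N x v h = H (dtrans b d x (v b))"
    unfolding dir_deriv_def Let_def b_def[symmetric] by simp
  then show ?thesis using tangent_vector_change_chart[OF assms(3) b assms(2)] by simp
qed

lemma incl_deriv_chart:
  assumes "smooth_inclusion M N" "d \<in> charts_at N x" "c \<in> charts_at M x" "v \<in> tangent_space N x"
  shows "incl_deriv M N x v c = dtrans d c x (v d)"
proof -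
  have "smooth_manifold N" using assms unfolding smooth_inclusion_def by blast
  from dir_deriv_chart[OF this assms(2,4) dtrans_has_derivative[OF assms(1-3)]]
  show ?thesis unfolding incl_deriv_def using assms(3) by simp
qed

lemma incl_deriv_tangent:
  assumes "smooth_inclusion M N" "x \<in> points N" "v \<in> tangent_space N x"
  shows "incl_deriv M N x v \<in> tangent_space M x"
proof -
  have M: "smooth_manifold M" and N: "smooth_manifold N"
    using assms unfolding smooth_inclusion_def by auto
  obtain d where d: "d \<in> charts_at N x" using charts_at_nonempty[OF N assms(2)] by blast
  have "incl_deriv M N x v c' = dtrans c c' x (incl_deriv M N x v c)"
    if "c \<in> charts_at M x" "c' \<in> charts_at M x" for c c'
    unfolding incl_deriv_chart[OF assms(1) d that(1) assms(3)] incl_deriv_chart[OF assms(1) d that(2) assms(3)]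
    by (rule dtrans_trans[OF assms(1) d that(1) smooth_inclusion_refl[OF M] that(2)])
  moreover have "incl_deriv M N x v c = 0" if "c \<notin> charts_at M x" for c
    using that by (simp add: incl_deriv_def)
  ultimately show ?thesis unfolding tangent_space_def by blast
qed

section \<open>The Levi-Civita connection\<close>

text \<open>Product rule for \<open>L y\<close> applied to a moving vector, from derivatives at
  constant vectors alone. It is needed for Jacobians applied to vector fields, where the values are
  vectors.\<close>

lemma linear_family_has_derivative:
  fixes L :: "'y::euclidean_space \<Rightarrow> 'e::euclidean_space \<Rightarrow> 'b::real_normed_vector"
  assumes S: "open S" "q \<in> S"
    and L: "\<And>y. y \<in> S \<Longrightarrow> linear (L y)"
    and dL: "\<And>u. ((\<lambda>y. L y u) has_derivative D u) (at q)"
    and U: "(U has_derivative U') (at q)"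
  shows "((\<lambda>y. L y (U y)) has_derivative (\<lambda>w. L q (U' w) + D (U q) w)) (at q)"
proof -
  have expand: "((\<lambda>y. L y (V y)) has_derivative
      (\<lambda>w. \<Sum>b\<in>Basis. (V q \<bullet> b) *\<^sub>R D b w + (V' w \<bullet> b) *\<^sub>R L q b)) (at q)"
    if V: "(V has_derivative V') (at q)" for V V'
  proof (rule has_derivative_transform_within_open[OF _ S])
    show "((\<lambda>y. \<Sum>b\<in>Basis. (V y \<bullet> b) *\<^sub>R L y b) has_derivative
      (\<lambda>w. \<Sum>b\<in>Basis. (V q \<bullet> b) *\<^sub>R D b w + (V' w \<bullet> b) *\<^sub>R L q b)) (at q)"
      by (intro has_derivative_sum has_derivative_scaleR has_derivative_inner_left V dL)
    show "(\<Sum>b\<in>Basis. (V y \<bullet> b) *\<^sub>R L y b) = L y (V y)" if "y \<in> S" for y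
      by (rule linear_basis_expansion[OF L[OF that]])
  qed
  \<comment> \<open>Linearity of \<open>D\<close> in \<open>u\<close> is not assumed; it follows by
    comparing \<open>dL\<close> with the expansion for a constant vector.\<close>
  have "(\<Sum>b\<in>Basis. (u \<bullet> b) *\<^sub>R D b w) = D u w" for u w
    using fun_cong[OF has_derivative_unique[OF dL[of u] expand[OF has_derivative_const[of u]]], of w] by simp
  then show ?thesis
    using expand[OF U] unfolding sum.distrib linear_basis_expansion[OF L[OF S(2)]]
    by (simp add: add.commute)
qed

text \<open>The map \<open>L\<close>, listing the values of \<open>G r\<close> on
  \<open>Basis\<close>, is injective by positivity and hence surjective by dimension.\<close>

lemma riesz_bilinear:
  fixes G :: "'e::euclidean_space \<Rightarrow> 'e \<Rightarrow> real"
  assumes G: "bilinear G" and pos: "\<And>u. u \<noteq> 0 \<Longrightarrow> G u u > 0" and f: "linear f"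
  shows "\<exists>r. \<forall>v. G r v = f v"
proof -
  have lin1: "linear (\<lambda>u. G u v)" and lin2: "linear (G u)" for u v
    using G unfolding bilinear_def by auto
  define L where "L r = (\<Sum>b\<in>Basis. G r b *\<^sub>R b)" for r
  have Lb: "L r \<bullet> b = G r b" if "b \<in> Basis" for r b
    using that unfolding L_def by (simp add: inner_sum_left inner_Basis if_distrib cong: if_cong)
  have "linear L"
    by (rule linearI; rule euclidean_eqI)
      (simp_all add: Lb inner_add_left linear_add[OF lin1] linear_cmul[OF lin1])
  moreover have "inj L"
    unfolding linear_injective_0[OF \<open>linear L\<close>]
  proof (intro allI impI)
    fix r assume "L r = 0"
    then have "G r b = 0" if "b \<in> Basis" for b using Lb[OF that, of r] by simp
    then have "G r r = 0" using linear_basis_expansion[OF lin2, of r r] by simp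
    then show "r = 0" using pos[of r] by fastforce
  qed
  ultimately obtain r where r: "L r = (\<Sum>b\<in>Basis. f b *\<^sub>R b)"
    using linear_injective_imp_surjective[of L] by (metis surjD)
  have "G r = f"
  proof (rule linear_eq_stdbasis[OF lin2 f])
    fix b :: 'e assume "b \<in> Basis"
    then show "G r b = f b"
      using Lb[of b r] unfolding r by (simp add: inner_sum_left inner_Basis if_distrib cong: if_cong)
  qed
  then show ?thesis by auto
qed

text \<open>\<open>G\<close> is the metric at one point and \<open>D w u v\<close> the derivative of \<open>G u v\<close> in direction \<open>w\<close>; the
  coefficients are given by Koszul's formula.\<close>

lemma levi_civita_exists_unique:
  fixes G :: "'e::euclidean_space \<Rightarrow> 'e \<Rightarrow> real"
  assumes G: "bilinear G" and sym: "\<And>u v. G u v = G v u" and pos: "\<And>u. u \<noteq> 0 \<Longrightarrow> G u u > 0"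
    and D1: "\<And>u v. linear (\<lambda>w. D w u v)" and D2: "\<And>w. bilinear (D w)"
    and Dsym: "\<And>w u v. D w u v = D w v u"
  shows "\<exists>!\<Gamma>. bilinear \<Gamma> \<and> (\<forall>u v. \<Gamma> u v = \<Gamma> v u) \<and>
    (\<forall>w u v. D w u v = G (\<Gamma> w u) v + G u (\<Gamma> w v))"
proof -
  have lin1: "linear (\<lambda>u. G u v)" and lin2: "linear (G u)" for u v
    using G unfolding bilinear_def by auto
  have eqI: "r = s" if "\<And>v. G r v = G s v" for r s
  proof -
    have "G (r - s) (r - s) = 0" using that[of "r - s"] by (simp add: linear_diff[OF lin1])
    then show ?thesis using pos[of "r - s"] by fastforce
  qed
  have D2a: "linear (\<lambda>u. D w u v)" and D2b: "linear (D w u)" for u v w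
    using D2[of w] unfolding bilinear_def by auto
  \<comment> \<open>Koszul's expression without bracket terms, since constant coordinate fields
    commute.\<close>
  define k where "k w u v = (D w u v + D u w v - D v w u) / 2" for w u v
  have k1: "linear (k w u)" for w u
    by (rule linearI) (simp_all add: k_def linear_add[OF D2b] linear_add[OF D1]
      linear_cmul[OF D2b] linear_cmul[OF D1] algebra_simps add_divide_distrib diff_divide_distrib)
  have k2: "linear (\<lambda>u. k w u v)" for w v
    by (rule linearI) (simp_all add: k_def linear_add[OF D2b] linear_add[OF D2a] linear_add[OF D1]
      linear_cmul[OF D2b] linear_cmul[OF D2a] linear_cmul[OF D1] algebra_simps add_divide_distrib diff_divide_distrib)
  have ksym: "k w u v = k u w v" for w u v unfolding k_def using Dsym by simp
  have "\<exists>r. \<forall>v. G r v = k w u v" for w u by (rule riesz_bilinear[OF G pos k1])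
  then obtain \<Gamma> where \<Gamma>: "\<And>w u v. G (\<Gamma> w u) v = k w u v" by metis
  show ?thesis
  proof (rule ex1I[of _ \<Gamma>], intro conjI allI)
    show \<Gamma>sym: "\<Gamma> u v = \<Gamma> v u" for u v by (rule eqI) (simp add: \<Gamma> ksym)
    have "linear (\<Gamma> w)" for w
      by (rule linearI; rule eqI)
        (simp_all add: \<Gamma> linear_add[OF lin1] linear_cmul[OF lin1] linear_add[OF k2] linear_cmul[OF k2])
    then show "bilinear \<Gamma>" unfolding bilinear_def using \<Gamma>sym by simp
    show "D w u v = G (\<Gamma> w u) v + G u (\<Gamma> w v)" for w u v
    proof -
      have "G (\<Gamma> w u) v + G u (\<Gamma> w v) = k w u v + k w v u" by (simp add: \<Gamma> sym[of u])
      also have "\<dots> = D w u v"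
        using Dsym[of w v u] Dsym[of u v w] Dsym[of v u w] unfolding k_def by (simp add: field_simps)
      finally show ?thesis by simp
    qed
  next
    \<comment> \<open>Combining three permutations of metric compatibility, symmetry of
      \<open>\<Delta>\<close> cancels everything except twice
      \<open>G (\<Delta> w u) v\<close>.\<close>
    fix \<Delta> assume \<Delta>: "bilinear \<Delta> \<and> (\<forall>u v. \<Delta> u v = \<Delta> v u) \<and>
      (\<forall>w u v. D w u v = G (\<Delta> w u) v + G u (\<Delta> w v))"
    have "G (\<Delta> w u) v = k w u v" for w u v
    proof -
      have s: "\<Delta> u w = \<Delta> w u" "\<Delta> v w = \<Delta> w v" "\<Delta> v u = \<Delta> u v" using \<Delta> by blast+
      have "D w u v = G (\<Delta> w u) v + G u (\<Delta> w v)" "D u w v = G (\<Delta> u w) v + G w (\<Delta> u v)"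
        "D v w u = G (\<Delta> v w) u + G w (\<Delta> v u)" using \<Delta> by blast+
      then show ?thesis unfolding k_def s by (simp add: sym[of u])
    qed
    then show "\<Delta> = \<Gamma>" by (intro ext eqI) (simp add: \<Gamma>)
  qed
qed

section \<open>The metric and the Christoffel symbols in charts\<close>

lemma riemannian_smooth_manifold: "riemannian_manifold M g \<Longrightarrow> smooth_manifold M"
  unfolding riemannian_manifold_def by blast

lemma
  assumes "riemannian_manifold M g" "x \<in> points M"
    and "u \<in> tangent_space M x" "v \<in> tangent_space M x" "w \<in> tangent_space M x"
  shows metric_symmetric: "g x u v = g x v u"
    and metric_linear: "g x (a *\<^sub>R u + b *\<^sub>R v) w = a * g x u w + b * g x v w"
  using assms unfolding riemannian_manifold_def by simp_all

lemma metric_pos: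
  "riemannian_manifold M g \<Longrightarrow> x \<in> points M \<Longrightarrow> u \<in> tangent_space M x \<Longrightarrow> u \<noteq> 0 \<Longrightarrow> g x u u > 0"
  unfolding riemannian_manifold_def by simp

lemma coord_metric_at:
  "smooth_manifold M \<Longrightarrow> c \<in> charts_at M x \<Longrightarrow>
    coord_metric M g c u v (snd c x) = g x (coord_vec M c x u) (coord_vec M c x v)"
  unfolding coord_metric_def charts_at_def by (simp add: chart_inv_left)

lemma metric_coord:
  assumes "smooth_manifold M" "c \<in> charts_at M x" "u \<in> tangent_space M x" "v \<in> tangent_space M x"
  shows "g x u v = coord_metric M g c (u c) (v c) (snd c x)"
  by (simp add: coord_metric_at[OF assms(1,2)] coord_vec_tangent_vector[OF assms(3,2)] coord_vec_tangent_vector[OF assms(4,2)])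

lemma coord_metric_symmetric:
  assumes "riemannian_manifold M g" "c \<in> charts_at M x"
  shows "coord_metric M g c u v (snd c x) = coord_metric M g c v u (snd c x)"
proof -
  note M = riemannian_smooth_manifold[OF assms(1)]
  show ?thesis unfolding coord_metric_at[OF M assms(2)]
    by (rule metric_symmetric[OF assms(1)])
      (rule charts_at_point[OF M assms(2)] coord_vec_tangent[OF M assms(2)])+
qed

lemma coord_metric_bilinear:
  assumes "riemannian_manifold M g" "c \<in> charts_at M x"
  shows "bilinear (\<lambda>u v. coord_metric M g c u v (snd c x))"
proof -
  note M = riemannian_smooth_manifold[OF assms(1)]
  note lin = coord_vec_linear[OF M assms(2)] and tan = coord_vec_tangent[OF M assms(2)]
  have 2: "g x (a *\<^sub>R u + b *\<^sub>R v) w = a * g x u w + b * g x v w"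
    if "u \<in> tangent_space M x" "v \<in> tangent_space M x" "w \<in> tangent_space M x" for a b u v w
    by (rule metric_linear[OF assms(1) charts_at_point[OF M assms(2)] that])
  have 1: "linear (\<lambda>u. coord_metric M g c u v (snd c x))" for v
    unfolding coord_metric_at[OF M assms(2)]
    by (rule linearI) (use 2[OF tan tan tan, of 1 _ 1] 2[OF tan tan tan, of _ _ 0] in
      \<open>simp_all add: linear_add[OF lin] linear_cmul[OF lin]\<close>)
  have "linear (\<lambda>v. coord_metric M g c u v (snd c x))" for u
    using 1[of u] unfolding coord_metric_symmetric[OF assms, of _ u] .
  then show ?thesis using 1 unfolding bilinear_def by blast
qed

lemma coord_metric_pos:
  assumes "riemannian_manifold M g" "c \<in> charts_at M x" "u \<noteq> 0"
  shows "coord_metric M g c u u (snd c x) > 0"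
proof -
  note M = riemannian_smooth_manifold[OF assms(1)]
  have "coord_vec M c x u \<noteq> 0"
    using coord_vec_same[OF M assms(2), of u] assms(3) by (metis zero_fun_apply)
  then show ?thesis unfolding coord_metric_at[OF M assms(2)]
    by (rule metric_pos[OF assms(1) charts_at_point[OF M assms(2)] coord_vec_tangent[OF M assms(2)]])
qed

lemma coord_metric_has_derivative:
  assumes "riemannian_manifold M g" "c \<in> charts_at M x"
  shows "(coord_metric M g c u v has_derivative frechet_derivative (coord_metric M g c u v) (at (snd c x))) (at (snd c x))"
proof (rule smooth_on_has_derivative)
  show "smooth_on (snd c ` fst c) (coord_metric M g c u v)" "snd c x \<in> snd c ` fst c"
    using assms unfolding riemannian_manifold_def charts_at_def by auto
qed

text \<open>Justifies the definite description in \<open>christoffel\<close>. The second claim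
  identifies coefficients by their defining properties, which is how the transformation law is
  obtained.\<close>

lemma levi_civita_coeffs_christoffel:
  assumes g: "riemannian_manifold M g" and c: "c \<in> charts_at M x"
  shows "levi_civita_coeffs M g c x (christoffel M g c x)"
    and "levi_civita_coeffs M g c x \<Gamma> \<Longrightarrow> \<Gamma> = christoffel M g c x"
proof -
  note M = riemannian_smooth_manifold[OF assms(1)]
  define D where "D w u v = frechet_derivative (coord_metric M g c u v) (at (snd c x)) w" for w u v
  have hd: "(coord_metric M g c u v has_derivative (\<lambda>w. D w u v)) (at (snd c x))" for u v
    unfolding D_def by (rule coord_metric_has_derivative[OF assms])
  have ca: "c \<in> atlas M" "x \<in> fst c" using c unfolding charts_at_def by auto
  have op: "open (snd c ` (fst c \<inter> fst c))" "snd c x \<in> snd c ` (fst c \<inter> fst c)"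
    using inclusion_overlap_open[OF smooth_inclusion_refl[OF M] ca(1) ca(1)] ca by auto
  have nbhd: "\<exists>z. c \<in> charts_at M z \<and> y = snd c z" if "y \<in> snd c ` (fst c \<inter> fst c)" for y
    using that ca unfolding charts_at_def by blast
  \<comment> \<open>Symmetry here and linearity below are inherited by derivatives, as the
    corresponding identities for the metric hold throughout the chart domain.\<close>
  have Dsym: "D w u v = D w v u" for w u v
  proof -
    have "(coord_metric M g c v u has_derivative (\<lambda>w. D w u v)) (at (snd c x))"
    proof (rule has_derivative_transform_within_open[OF hd op])
      show "coord_metric M g c u v y = coord_metric M g c v u y" if "y \<in> snd c ` (fst c \<inter> fst c)" for y
        using nbhd[OF that] coord_metric_symmetric[OF g] by blast
    qed
    from fun_cong[OF has_derivative_unique[OF this hd]] show ?thesis .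
  qed
  have D2: "linear (\<lambda>u. D w u v)" for w v
  proof (rule linearI)
    have lin: "linear (\<lambda>u. coord_metric M g c u v y)" if y: "y \<in> snd c ` (fst c \<inter> fst c)" for y
      using nbhd[OF y] coord_metric_bilinear[OF g] unfolding bilinear_def by blast
    fix u u'
    have "(coord_metric M g c (u + u') v has_derivative (\<lambda>w. D w u v + D w u' v)) (at (snd c x))"
      by (rule has_derivative_transform_within_open[OF has_derivative_add[OF hd hd] op])
        (simp only: linear_add[OF lin])
    from fun_cong[OF has_derivative_unique[OF hd this]] show "D w (u + u') v = D w u v + D w u' v" .
    fix r
    have "(coord_metric M g c (r *\<^sub>R u) v has_derivative (\<lambda>w. r *\<^sub>R D w u v)) (at (snd c x))"
      by (rule has_derivative_transform_within_open[OF has_derivative_scaleR_right[OF hd] op])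
        (simp only: linear_cmul[OF lin])
    from fun_cong[OF has_derivative_unique[OF hd this]] show "D w (r *\<^sub>R u) v = r *\<^sub>R D w u v" .
  qed
  have "linear (\<lambda>v. D w u v)" for w u using D2[of w u] unfolding Dsym[of w _ u] .
  then have D2': "bilinear (D w)" for w using D2 unfolding bilinear_def by blast
  have D1: "linear (\<lambda>w. D w u v)" for u v using hd has_derivative_linear by blast
  have ex1: "\<exists>!\<Gamma>. levi_civita_coeffs M g c x \<Gamma>"
    unfolding levi_civita_coeffs_def D_def[symmetric]
    by (rule levi_civita_exists_unique[OF coord_metric_bilinear[OF assms] coord_metric_symmetric[OF assms]
          coord_metric_pos[OF assms] D1 D2' Dsym])
  show "levi_civita_coeffs M g c x (christoffel M g c x)"
    unfolding christoffel_def by (rule theI'[OF ex1])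
  show "\<Gamma> = christoffel M g c x" if "levi_civita_coeffs M g c x \<Gamma>"
    unfolding christoffel_def by (rule the1_equality[OF ex1, OF that, symmetric])
qed

lemma
  assumes "riemannian_manifold M g" "c \<in> charts_at M x"
  shows christoffel_bilinear: "bilinear (christoffel M g c x)"
    and christoffel_symmetric: "christoffel M g c x u v = christoffel M g c x v u"
  using levi_civita_coeffs_christoffel(1)[OF assms, unfolded levi_civita_coeffs_def,
      THEN conjunct1]
    levi_civita_coeffs_christoffel(1)[OF assms, unfolded levi_civita_coeffs_def,
      THEN conjunct2, THEN conjunct1, rule_format] by blast+

lemma coord_metric_derivative:
  assumes "riemannian_manifold M g" "c \<in> charts_at M x"
  shows "(coord_metric M g c u v has_derivative
    (\<lambda>w. coord_metric M g c (christoffel M g c x w u) v (snd c x)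
       + coord_metric M g c u (christoffel M g c x w v) (snd c x))) (at (snd c x))"
proof -
  have "frechet_derivative (coord_metric M g c u v) (at (snd c x)) = 
    (\<lambda>w. coord_metric M g c (christoffel M g c x w u) v (snd c x)
       + coord_metric M g c u (christoffel M g c x w v) (snd c x))"
    by (rule ext) (rule levi_civita_coeffs_christoffel(1)[OF assms, unfolded levi_civita_coeffs_def,
      THEN conjunct2, THEN conjunct2, rule_format])
  then show ?thesis using coord_metric_has_derivative[OF assms, of u v] by simp
qed

text \<open>Metric compatibility along N, by the chain rule. It supplies the hypothesis
  \<open>dG\<close> of \<open>local_minimality\<close> and, for N = M, the derivative needed under a
  change of charts.\<close>

lemma coord_metric_pullback_derivative:
  assumes g: "riemannian_manifold M g" and incl: "smooth_inclusion M N"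
    and d: "d \<in> charts_at N x" and c: "c \<in> charts_at M x"
  shows "((\<lambda>y. coord_metric M g c u v ((snd c \<circ> chart_inv d) y)) has_derivative
    (\<lambda>w. coord_metric M g c (christoffel M g c x (dtrans d c x w) u) v ((snd c \<circ> chart_inv d) (snd d x))
       + coord_metric M g c u (christoffel M g c x (dtrans d c x w) v) ((snd c \<circ> chart_inv d) (snd d x)))) (at (snd d x))"
proof -
  have "smooth_manifold N" "d \<in> atlas N" "x \<in> fst d"
    using incl d unfolding smooth_inclusion_def charts_at_def by auto
  then have Fq: "(snd c \<circ> chart_inv d) (snd d x) = snd c x" by (simp add: chart_inv_left)
  show ?thesis
    using has_derivative_compose[OF dtrans_has_derivative[OF incl d c], of "coord_metric M g c u v"]
      coord_metric_derivative[OF g c] unfolding Fq by blast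
qed

lemma coord_metric_change_chart:
  assumes "smooth_manifold M" "c \<in> charts_at M x" "c' \<in> charts_at M x"
  shows "coord_metric M g c u v (snd c x) = coord_metric M g c' (dtrans c c' x u) (dtrans c c' x v) (snd c' x)"
  unfolding coord_metric_at[OF assms(1,2)] coord_metric_at[OF assms(1,3)]
    coord_vec_change_chart[OF assms] ..

lemma tangent_spaceI:
  assumes "smooth_manifold M" "c \<in> charts_at M x"
    and "\<And>c'. c' \<in> charts_at M x \<Longrightarrow> v c' = dtrans c c' x (v c)"
    and "\<And>c'. c' \<notin> charts_at M x \<Longrightarrow> v c' = 0"
  shows "v \<in> tangent_space M x"
proof -
  have "v = coord_vec M c x (v c)"
  proof
    fix d show "v d = coord_vec M c x (v c) d"
    proof (cases "d \<in> charts_at M x")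
      case True
      then show ?thesis using assms(3)[OF True] by (simp add: coord_vec_def)
    next
      case False
      then show ?thesis using assms(4)[OF False] by (simp add: coord_vec_def)
    qed
  qed
  then show ?thesis using coord_vec_tangent[OF assms(1,2), of "v c"] by simp
qed

text \<open>The transformed coefficients satisfy the defining conditions of the Christoffel symbols in the
  chart \<open>c\<close>, so uniqueness applies.\<close>

lemma christoffel_change_chart:
  assumes g: "riemannian_manifold M g" and c: "c \<in> charts_at M x" and c': "c' \<in> charts_at M x"
  shows "dtrans c c' x (christoffel M g c x u v) =
    christoffel M g c' x (dtrans c c' x u) (dtrans c c' x v) + d2trans c c' x u v"
proof -
  note M = riemannian_smooth_manifold[OF g]
  note incl = smooth_inclusion_refl[OF M]
  define L where "L = dtrans c c' x"
  define L' where "L' = dtrans c' c x"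
  \<comment> \<open>The classical transformation law solved for the coefficients in
    \<open>c\<close>; the Hessian is its inhomogeneous term.\<close>
  define \<Delta> where "\<Delta> u v = L' (christoffel M g c' x (L u) (L v) + d2trans c c' x u v)" for u v
  have linL: "linear L" and linL': "linear L'"
    unfolding L_def L'_def using dtrans_linear[OF incl] c c' by blast+
  have LL': "L (L' z) = z" for z unfolding L_def L'_def by (rule dtrans_inverse[OF M c' c])
  have lin1: "linear (\<lambda>u. christoffel M g c' x u v)" and lin2: "linear (christoffel M g c' x u)" for u v
    using christoffel_bilinear[OF g c'] unfolding bilinear_def by auto
  have d1: "linear (\<lambda>u. d2trans c c' x u v)" and d2: "linear (d2trans c c' x u)" for u v
    using d2trans_bilinear[OF incl c c'] unfolding bilinear_def by auto
  have \<Delta>_sym: "\<Delta> u v = \<Delta> v u" for u v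
    unfolding \<Delta>_def using christoffel_symmetric[OF g c'] d2trans_symmetric[OF incl c c'] by metis
  have "linear (\<lambda>u. \<Delta> u v)" for v
    unfolding \<Delta>_def
    by (rule linearI)
      (simp_all add: linear_add[OF linL] linear_add[OF linL'] linear_add[OF lin1] linear_add[OF d1]
        linear_cmul[OF linL] linear_cmul[OF linL'] linear_cmul[OF lin1] linear_cmul[OF d1] scaleR_add_right)
  moreover from this have "linear (\<Delta> u)" for u unfolding \<Delta>_sym[of u] .
  ultimately have "bilinear \<Delta>" unfolding bilinear_def by blast
  have ca: "c \<in> atlas M" "x \<in> fst c" "c' \<in> atlas M" "x \<in> fst c'"
    using c c' unfolding charts_at_def by auto
  define S where "S = snd c ` (fst c \<inter> fst c')"
  have S: "open S" "snd c x \<in> S"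
    using inclusion_overlap_open[OF incl ca(1,3)] ca unfolding S_def by auto
  have SE: "\<exists>z. c \<in> charts_at M z \<and> c' \<in> charts_at M z \<and> y = snd c z \<and> (snd c' \<circ> chart_inv c) y = snd c' z"
    if "y \<in> S" for y
    using that ca chart_inv_left[OF M ca(1)] unfolding S_def charts_at_def by fastforce
  define G where "G y u v = coord_metric M g c' u v ((snd c' \<circ> chart_inv c) y)" for y u v
  have Gbil: "bilinear (G y)" if y: "y \<in> S" for y
  proof -
    obtain z where "c' \<in> charts_at M z" "(snd c' \<circ> chart_inv c) y = snd c' z"
      using SE[OF y] by blast
    then show ?thesis using coord_metric_bilinear[OF g, of c' z] unfolding G_def by simp
  qed
  have hd: "(coord_metric M g c u v has_derivative
      (\<lambda>w. coord_metric M g c (\<Delta> w u) v (snd c x) + coord_metric M g c u (\<Delta> w v) (snd c x))) (at (snd c x))" for u v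
  proof -
    \<comment> \<open>The metric in \<open>c\<close> is the metric in \<open>c'\<close> evaluated on
      Jacobian images of constant vectors; differentiating these images produces the
      Hessians.\<close>
    have "((\<lambda>y. G y (frechet_derivative (snd c' \<circ> chart_inv c) (at y) u) (frechet_derivative (snd c' \<circ> chart_inv c) (at y) v))
      has_derivative (\<lambda>w. G (snd c x) (d2trans c c' x u w + christoffel M g c' x (L w) (L u)) (L v)
        + G (snd c x) (L u) (d2trans c c' x v w + christoffel M g c' x (L w) (L v)))) (at (snd c x))"
      unfolding L_def
    proof (rule metric_has_derivative[OF S Gbil _ lin2])
      show "((\<lambda>y. G y u v) has_derivative (\<lambda>w. G (snd c x) (christoffel M g c' x (dtrans c c' x w) u) v
          + G (snd c x) u (christoffel M g c' x (dtrans c c' x w) v))) (at (snd c x))" for u v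
        unfolding G_def by (rule coord_metric_pullback_derivative[OF g incl c c'])
    qed (assumption | rule d2trans_has_derivative[OF incl c c'])+
    moreover have "G y (frechet_derivative (snd c' \<circ> chart_inv c) (at y) u) (frechet_derivative (snd c' \<circ> chart_inv c) (at y) v)
      = coord_metric M g c u v y" if y: "y \<in> S" for y
    proof -
      obtain z where "c \<in> charts_at M z" "c' \<in> charts_at M z" "y = snd c z" "(snd c' \<circ> chart_inv c) y = snd c' z"
        using SE[OF y] by blast
      then show ?thesis unfolding G_def using coord_metric_change_chart[OF M, of c z c'] by simp
    qed
    ultimately have hd: "(coord_metric M g c u v has_derivative
      (\<lambda>w. G (snd c x) (d2trans c c' x u w + christoffel M g c' x (L w) (L u)) (L v)
        + G (snd c x) (L u) (d2trans c c' x v w + christoffel M g c' x (L w) (L v)))) (at (snd c x))"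
      by (rule has_derivative_transform_within_open[OF _ S])
    have Gq: "G (snd c x) a b = coord_metric M g c' a b (snd c' x)" for a b
      unfolding G_def using chart_inv_left[OF M ca(1,2)] by simp
    have L\<Delta>: "d2trans c c' x u w + christoffel M g c' x (L w) (L u) = L (\<Delta> w u)" for u w
      unfolding \<Delta>_def LL' d2trans_symmetric[OF incl c c', of u w] by (rule add.commute)
    have Gc: "G (snd c x) (L a) (L b) = coord_metric M g c a b (snd c x)" for a b
      unfolding Gq L_def by (rule coord_metric_change_chart[OF M c c', symmetric])
    show ?thesis using hd unfolding L\<Delta> Gc .
  qed
  have "levi_civita_coeffs M g c x \<Delta>"
    unfolding levi_civita_coeffs_def
  proof (intro conjI allI)
    show "bilinear \<Delta>" by fact
    show "\<Delta> u v = \<Delta> v u" for u v by (rule \<Delta>_sym)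
    show "frechet_derivative (coord_metric M g c u v) (at (snd c x)) w =
      coord_metric M g c (\<Delta> w u) v (snd c x) + coord_metric M g c u (\<Delta> w v) (snd c x)" for w u v
      using fun_cong[OF frechet_derivative_at[OF hd], of w] by (rule sym)
  qed
  then have "\<Delta> = christoffel M g c x" by (rule levi_civita_coeffs_christoffel(2)[OF g c])
  then have "L (christoffel M g c x u v) = L (\<Delta> u v)" by simp
  then show ?thesis unfolding \<Delta>_def LL' unfolding L_def .
qed

section \<open>Covariant derivatives of fields and forms\<close>

lemma nabla_chart:
  assumes incl: "smooth_inclusion M N" and d: "d \<in> charts_at N x" and c: "c \<in> charts_at M x"
    and v: "v \<in> tangent_space N x"
    and Y: "((\<lambda>y. Y (chart_inv d y) c) has_derivative DY) (at (snd d x))"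
  shows "nabla M g N x v Y c = DY (v d) + christoffel M g c x (dtrans d c x (v d)) (Y x c)"
proof -
  have N: "smooth_manifold N" using incl unfolding smooth_inclusion_def by blast
  have "dir_deriv N x v (\<lambda>y. Y y c) = DY (v d)"
    by (rule dir_deriv_chart[OF N d v]) (use Y in \<open>simp add: o_def\<close>)
  then show ?thesis unfolding nabla_def using c incl_deriv_chart[OF incl d c v] by simp
qed

text \<open>Differentiating the components of \<open>Y\<close> after a coordinate change produces a
  Hessian term, which cancels against the inhomogeneous term in
  \<open>christoffel_change_chart\<close>. The field need only be defined along N.\<close>

lemma nabla_tangent:
  assumes g: "riemannian_manifold M g" and incl: "smooth_inclusion M N"
    and d: "d \<in> charts_at N x" and c: "c \<in> charts_at M x"
    and v: "v \<in> tangent_space N x"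
    and W: "openin (mtop N) W" "x \<in> W" and YT: "\<And>y. y \<in> W \<Longrightarrow> Y y \<in> tangent_space M y"
    and Y: "((\<lambda>y. Y (chart_inv d y) c) has_derivative DY) (at (snd d x))"
  shows "nabla M g N x v Y \<in> tangent_space M x"
proof (rule tangent_spaceI[OF riemannian_smooth_manifold[OF g] c])
  note M = riemannian_smooth_manifold[OF g]
  note inclM = smooth_inclusion_refl[OF M]
  have N: "smooth_manifold N" using incl unfolding smooth_inclusion_def by blast
  show "nabla M g N x v Y c' = 0" if "c' \<notin> charts_at M x" for c'
    unfolding nabla_def using that by simp
  fix c' assume c': "c' \<in> charts_at M x"
  have ca: "c \<in> atlas M" "x \<in> fst c" "c' \<in> atlas M" "x \<in> fst c'" "d \<in> atlas N" "x \<in> fst d"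
    using c c' d unfolding charts_at_def by auto
  note linL = dtrans_linear[OF inclM c c']
  define V where "V = W \<inter> fst c \<inter> fst c'"
  define S where "S = snd d ` (V \<inter> fst d)"
  have "openin (mtop N) V"
    unfolding V_def
    by (intro inclusion_openin[OF incl] W chart_domain_open[OF M] ca)
  then have S: "open S" "snd d x \<in> S"
    unfolding S_def using chart_image_open[OF N ca(5)] ca W V_def by auto
  have SE: "\<exists>z. z \<in> W \<and> c \<in> charts_at M z \<and> c' \<in> charts_at M z \<and> chart_inv d y = z" if "y \<in> S" for y
    using that ca chart_inv_left[OF N ca(5)] unfolding S_def V_def charts_at_def by auto
  \<comment> \<open>The Jacobian of the change from \<open>c\<close> to \<open>c'\<close> at points
    of N, as a function of the coordinates \<open>d\<close> on N.\<close>
  define Lf where "Lf y = frechet_derivative (snd c' \<circ> chart_inv c) (at ((snd c \<circ> chart_inv d) y))" for y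
  have dx: "chart_inv d (snd d x) = x" by (rule chart_inv_left[OF N ca(5,6)])
  have Lfq: "Lf (snd d x) = dtrans c c' x" unfolding Lf_def by (simp add: dx)
  have "((\<lambda>y. Lf y (Y (chart_inv d y) c)) has_derivative
      (\<lambda>w. Lf (snd d x) (DY w) + d2trans c c' x (Y (chart_inv d (snd d x)) c) (dtrans d c x w))) (at (snd d x))"
  proof (rule linear_family_has_derivative[OF S _ _ Y])
    show "linear (Lf y)" if y: "y \<in> S" for y
    proof -
      obtain z where z: "z \<in> W" "c \<in> charts_at M z" "c' \<in> charts_at M z" "chart_inv d y = z"
        using SE[OF y] by blast
      then show ?thesis unfolding Lf_def using dtrans_linear[OF inclM z(2,3)] by simp
    qed
    fix u
    have "((\<lambda>y. frechet_derivative (snd c' \<circ> chart_inv c) (at y) u) has_derivative d2trans c c' x u)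
      (at ((snd c \<circ> chart_inv d) (snd d x)))"
      using d2trans_has_derivative[OF inclM c c', of u] by (simp add: dx)
    from has_derivative_compose[OF dtrans_has_derivative[OF incl d c] this]
    show "((\<lambda>y. Lf y u) has_derivative (\<lambda>w. d2trans c c' x u (dtrans d c x w))) (at (snd d x))"
      unfolding Lf_def .
  qed
  moreover have "Lf y (Y (chart_inv d y) c) = Y (chart_inv d y) c'" if y: "y \<in> S" for y
  proof -
    obtain z where z: "z \<in> W" "c \<in> charts_at M z" "c' \<in> charts_at M z" "chart_inv d y = z"
      using SE[OF y] by blast
    then show ?thesis
      unfolding Lf_def using tangent_vector_change_chart[OF YT[OF z(1)] z(2,3)] by simp
  qed
  ultimately have Y': "((\<lambda>y. Y (chart_inv d y) c') has_derivative
      (\<lambda>w. dtrans c c' x (DY w) + d2trans c c' x (Y x c) (dtrans d c x w))) (at (snd d x))"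
    unfolding Lfq dx by (rule has_derivative_transform_within_open[OF _ S])
  define a where "a = dtrans d c x (v d)"
  have "nabla M g N x v Y c' = dtrans c c' x (DY (v d)) + d2trans c c' x (Y x c) a
      + christoffel M g c' x (dtrans c c' x a) (dtrans c c' x (Y x c))"
    unfolding nabla_chart[where Y = Y, OF incl d c' v Y'] a_def
      dtrans_trans[OF incl d c inclM c'] tangent_vector_change_chart[OF YT[OF W(2)] c c'] ..
  also have "\<dots> = dtrans c c' x (DY (v d)) + dtrans c c' x (christoffel M g c x a (Y x c))"
    unfolding christoffel_change_chart[OF g c c'] d2trans_symmetric[OF inclM c c', of "Y x c" a]
    by (simp add: add_ac)
  also have "\<dots> = dtrans c c' x (nabla M g N x v Y c)"
    unfolding nabla_chart[where Y = Y, OF incl d c v Y] a_def linear_add[OF linL] ..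
  finally show "nabla M g N x v Y c' = dtrans c c' x (nabla M g N x v Y c)" .
qed

text \<open>\<open>parallel_form\<close> can be tested only on smooth fields over open sets;
  constant coordinate fields on a chart domain are admissible.\<close>

lemma coord_vec_smooth_field:
  assumes M: "smooth_manifold M" and c: "c \<in> atlas M"
  shows "smooth_field M (fst c) (\<lambda>y. coord_vec M c y u)"
  unfolding smooth_field_def
proof (intro conjI ballI)
  show "coord_vec M c y u \<in> tangent_space M y" if "y \<in> fst c" for y
    using coord_vec_tangent[OF M] c that unfolding charts_at_def by blast
  fix c' assume c': "c' \<in> atlas M"
  note incl = smooth_inclusion_refl[OF M]
  have op: "open (snd c' ` (fst c' \<inter> fst c))" "open (snd c ` (fst c \<inter> fst c'))"
    by (rule inclusion_overlap_open[OF incl] c c')+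
  have "smooth_on (snd c' ` (fst c' \<inter> fst c))
    (\<lambda>y. frechet_derivative (snd c' \<circ> chart_inv c) (at ((snd c \<circ> chart_inv c') y)) u)"
  proof (rule smooth_on_compose[where g = "snd c \<circ> chart_inv c'" and
        f = "\<lambda>y. frechet_derivative (snd c' \<circ> chart_inv c) (at y) u"])
    show "smooth_on (snd c ` (fst c \<inter> fst c')) (\<lambda>y. frechet_derivative (snd c' \<circ> chart_inv c) (at y) u)"
      by (rule smooth_on_frechet_derivative[OF op(2) inclusion_smooth[OF incl c c']])
    show "smooth_on (snd c' ` (fst c' \<inter> fst c)) (snd c \<circ> chart_inv c')"
      by (rule inclusion_smooth[OF incl c' c])
    show "(snd c \<circ> chart_inv c') ` snd c' ` (fst c' \<inter> fst c) \<subseteq> snd c ` (fst c \<inter> fst c')"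
      using chart_inv_left[OF M c'] by auto
  qed
  then have "smooth_on (snd c' ` (fst c' \<inter> fst c)) (\<lambda>y. coord_vec M c (chart_inv c' y) u c')"
  proof (rule smooth_on_cong[OF op(1), rotated])
    fix y assume "y \<in> snd c' ` (fst c' \<inter> fst c)"
    then obtain z where z: "z \<in> fst c'" "z \<in> fst c" "y = snd c' z" by blast
    then have "c' \<in> charts_at M z" using c' unfolding charts_at_def by blast
    then show "frechet_derivative (snd c' \<circ> chart_inv c) (at ((snd c \<circ> chart_inv c') y)) u
      = coord_vec M c (chart_inv c' y) u c'"
      using chart_inv_left[OF M c' z(1)] z(3) by (simp add: coord_vec_apply)
  qed
  then show "smooth_on (snd c' ` (fst c \<inter> fst c')) (\<lambda>y. coord_vec M c (chart_inv c' y) u c')"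
    by (simp add: Int_commute)
qed

text \<open>Evaluating the covariant derivative on constant coordinate fields turns parallelism into
  the derivative formula that the multilinear product rule takes as input.\<close>

lemma parallel_form_coord:
  assumes g: "riemannian_manifold M g" and \<phi>: "smooth_form p M \<phi>" "parallel_form p M g \<phi>"
    and c: "c \<in> charts_at M x"
  shows "(coord_form M \<phi> c u has_derivative
    (\<lambda>w. \<Sum>i<p. coord_form M \<phi> c (u(i := christoffel M g c x w (u i))) (snd c x))) (at (snd c x))"
proof -
  note M = riemannian_smooth_manifold[OF g]
  note incl = smooth_inclusion_refl[OF M]
  have ca: "c \<in> atlas M" "x \<in> fst c" using c unfolding charts_at_def by auto
  have cx: "chart_inv c (snd c x) = x" by (rule chart_inv_left[OF M ca])
  define Y where "Y i y = coord_vec M c y (u i)" for i y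
  have sm: "smooth_on (snd c ` fst c) (coord_form M \<phi> c u)"
    using \<phi>(1) ca(1) unfolding smooth_form_def by simp
  from smooth_on_has_derivative[OF this]
  have hd: "(coord_form M \<phi> c u has_derivative frechet_derivative (coord_form M \<phi> c u) (at (snd c x))) (at (snd c x))"
    using ca by blast
  have "frechet_derivative (coord_form M \<phi> c u) (at (snd c x)) w =
    (\<Sum>i<p. coord_form M \<phi> c (u(i := christoffel M g c x w (u i))) (snd c x))" for w
  proof -
    define v where "v = coord_vec M c x w"
    have v: "v \<in> tangent_space M x" "v c = w"
      unfolding v_def using coord_vec_tangent[OF M c] coord_vec_same[OF M c] by auto
    have "nabla_form p M g \<phi> x v Y = 0"
    proof -
      have "openin (mtop M) (fst c)" "\<forall>i<p. smooth_field M (fst c) (Y i)"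
        using chart_domain_open[OF M ca(1)] coord_vec_smooth_field[OF M ca(1)] unfolding Y_def by auto
      then show ?thesis using \<phi>(2) ca(2) v(1) unfolding parallel_form_def by blast
    qed
    moreover have "dir_deriv M x v (\<lambda>y. \<phi> y (\<lambda>i. Y i y)) = frechet_derivative (coord_form M \<phi> c u) (at (snd c x)) w"
    proof -
      have "(\<lambda>y. \<phi> y (\<lambda>i. Y i y)) \<circ> chart_inv c = coord_form M \<phi> c u"
        by (rule ext) (simp add: coord_form_def Y_def)
      then show ?thesis using dir_deriv_chart[OF M c v(1), of "\<lambda>y. \<phi> y (\<lambda>i. Y i y)"] hd v(2) by simp
    qed
    moreover have "nabla M g M x v (Y i) = coord_vec M c x (christoffel M g c x w (u i))" for i
    proof (rule tangent_vector_eqI[OF _ coord_vec_tangent[OF M c] c])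
      \<comment> \<open>The components are constant on the chart, so the covariant derivative
        reduces to its Christoffel term.\<close>
      have DY: "((\<lambda>y. Y i (chart_inv c y) c) has_derivative (\<lambda>w. 0)) (at (snd c x))"
      proof (rule has_derivative_transform_within_open[OF has_derivative_const])
        show "open (snd c ` (fst c \<inter> fst c))"
          by (rule inclusion_overlap_open[OF incl ca(1) ca(1)])
        show "snd c x \<in> snd c ` (fst c \<inter> fst c)" using ca by blast
        show "u i = Y i (chart_inv c y) c" if y: "y \<in> snd c ` (fst c \<inter> fst c)" for y
        proof -
          obtain z where z: "z \<in> fst c" "y = snd c z" using y by blast
          then have "c \<in> charts_at M z" "chart_inv c y = z"
            using chart_inv_left[OF M ca(1) z(1)] ca(1) unfolding charts_at_def by auto
          then show ?thesis unfolding Y_def using coord_vec_same[OF M, of c z "u i"] by simp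
        qed
      qed
      show "nabla M g M x v (Y i) \<in> tangent_space M x"
        by (rule nabla_tangent[where Y = "Y i", OF g incl c c v(1) chart_domain_open[OF M ca(1)] ca(2) _ DY])
          (use coord_vec_tangent[OF M] ca(1) in \<open>auto simp: Y_def charts_at_def\<close>)
      show "nabla M g M x v (Y i) c = coord_vec M c x (christoffel M g c x w (u i)) c"
        unfolding nabla_chart[where Y = "Y i", OF incl c c v(1) DY] Y_def coord_vec_same[OF M c] v(2) dtrans_refl[OF M c] by simp
    qed
    moreover have "(\<lambda>j. Y j x)(i := coord_vec M c x z) = (\<lambda>j. coord_vec M c x ((u(i := z)) j))" for i z
      unfolding Y_def by auto
    ultimately show ?thesis unfolding nabla_form_def coord_form_def cx by simp
  qed
  then have "frechet_derivative (coord_form M \<phi> c u) (at (snd c x)) =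
    (\<lambda>w. \<Sum>i<p. coord_form M \<phi> c (u(i := christoffel M g c x w (u i))) (snd c x))" by (rule ext)
  then show ?thesis using hd by simp
qed

section \<open>Frames and critical planes\<close>

text \<open>Each \<open>l k\<close> vanishes on the span of the other vectors but not at
  \<open>a k\<close>. The family is therefore independent, and its size is the dimension.\<close>

lemma dual_family_span:
  fixes a :: "nat \<Rightarrow> 'f::euclidean_space" and l :: "nat \<Rightarrow> 'f \<Rightarrow> real"
  assumes lin: "\<And>k. k < DIM('f) \<Longrightarrow> linear (l k)"
    and dual: "\<And>j k. j < DIM('f) \<Longrightarrow> k < DIM('f) \<Longrightarrow> l k (a j) = (if j = k then 1 else 0)"
  shows "span (a ` {..<DIM('f)}) = UNIV"
proof -
  let ?A = "a ` {..<DIM('f)}"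
  have "inj_on a {..<DIM('f)}"
  proof (rule inj_onI)
    fix j k assume "j \<in> {..<DIM('f)}" "k \<in> {..<DIM('f)}" "a j = a k"
    then show "j = k" using dual[of j k] dual[of k k] by (auto split: if_splits)
  qed
  then have card: "card ?A = DIM('f)" by (simp add: card_image)
  have "independent ?A"
    unfolding dependent_def
  proof safe
    fix k assume k: "k < DIM('f)" and sp: "a k \<in> span (?A - {a k})"
    have "l k (a k) = 0"
    proof (rule linear_eq_0_on_span[OF lin[OF k] _ sp])
      fix x assume "x \<in> ?A - {a k}"
      then show "l k x = 0" using dual k by auto
    qed
    then show False using dual[OF k k] by simp
  qed
  then have "UNIV \<subseteq> span ?A"
    by (intro card_ge_dim_independent) (simp_all add: card dim_UNIV)
  then show ?thesis by blast
qed

text \<open>Expanding the first argument in one basis, or the second in the other, gives the same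
  mixed double sum over \<open>h (a i) (b j) * \<beta> (b j) (a i)\<close>.\<close>

lemma trace_orthonormal_basis_independent:
  fixes h \<beta> :: "'f::euclidean_space \<Rightarrow> 'f \<Rightarrow> real"
  assumes h: "bilinear h" "\<And>u v. h u v = h v u" and \<beta>: "bilinear \<beta>"
    and a: "\<And>i j. i < DIM('f) \<Longrightarrow> j < DIM('f) \<Longrightarrow> h (a i) (a j) = (if i = j then 1 else 0)"
    and b: "\<And>i j. i < DIM('f) \<Longrightarrow> j < DIM('f) \<Longrightarrow> h (b i) (b j) = (if i = j then 1 else 0)"
  shows "(\<Sum>i<DIM('f). \<beta> (a i) (a i)) = (\<Sum>i<DIM('f). \<beta> (b i) (b i))"
proof -
  have hlin: "linear (\<lambda>u. h u v)" for v using h unfolding bilinear_def by blast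
  have \<beta>1: "linear (\<lambda>u. \<beta> u v)" and \<beta>2: "linear (\<beta> u)" for u v
    using \<beta> unfolding bilinear_def by auto
  have expand: "(\<Sum>j<DIM('f). h u (c j) *\<^sub>R c j) = u"
    if c: "\<And>i j. i < DIM('f) \<Longrightarrow> j < DIM('f) \<Longrightarrow> h (c i) (c j) = (if i = j then 1 else 0)" for c u
  proof -
    have "u \<in> span (c ` {..<DIM('f)})"
      using dual_family_span[of "\<lambda>k u. h u (c k)" c] hlin c by simp
    then show ?thesis
    proof (rule linear_eq_on_span[rotated -1])
      show "linear (\<lambda>u. \<Sum>j<DIM('f). h u (c j) *\<^sub>R c j)"
        by (rule linearI)
          (simp_all add: linear_add[OF hlin] linear_cmul[OF hlin] scaleR_add_left sum.distrib scaleR_sum_right)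
      show "linear (\<lambda>u::'f. u)" by (rule linear_ident)
      fix x assume "x \<in> c ` {..<DIM('f)}"
      then obtain i where i: "i < DIM('f)" "x = c i" by auto
      have "(\<Sum>j<DIM('f). h x (c j) *\<^sub>R c j) = (\<Sum>j<DIM('f). if j = i then c j else 0)"
        using i c by (intro sum.cong) auto
      then show "(\<Sum>j<DIM('f). h x (c j) *\<^sub>R c j) = x" using i by simp
    qed
  qed
  have "\<beta> (a i) (a i) = (\<Sum>j<DIM('f). h (a i) (b j) * \<beta> (b j) (a i))" for i
  proof -
    have "\<beta> (\<Sum>j<DIM('f). h (a i) (b j) *\<^sub>R b j) (a i) = (\<Sum>j<DIM('f). h (a i) (b j) * \<beta> (b j) (a i))"
      by (simp add: linear_sum[OF \<beta>1] linear_cmul[OF \<beta>1])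
    moreover have "(\<Sum>j<DIM('f). h (a i) (b j) *\<^sub>R b j) = a i" by (rule expand) (rule b)
    ultimately show ?thesis by simp
  qed
  then have "(\<Sum>i<DIM('f). \<beta> (a i) (a i)) = (\<Sum>i<DIM('f). \<Sum>j<DIM('f). h (a i) (b j) * \<beta> (b j) (a i))"
    by simp
  also have "\<dots> = (\<Sum>j<DIM('f). \<Sum>i<DIM('f). h (b j) (a i) * \<beta> (b j) (a i))"
    unfolding h(2)[of "b _"] by (rule sum.swap)
  also have "\<dots> = (\<Sum>j<DIM('f). \<beta> (b j) (b j))"
  proof (rule sum.cong[OF refl])
    fix j
    have "\<beta> (b j) (\<Sum>i<DIM('f). h (b j) (a i) *\<^sub>R a i) = (\<Sum>i<DIM('f). h (b j) (a i) * \<beta> (b j) (a i))"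
      by (simp add: linear_sum[OF \<beta>2] linear_cmul[OF \<beta>2])
    moreover have "(\<Sum>i<DIM('f). h (b j) (a i) *\<^sub>R a i) = b j" by (rule expand) (rule a)
    ultimately show "(\<Sum>i<DIM('f). h (b j) (a i) * \<beta> (b j) (a i)) = \<beta> (b j) (b j)" by simp
  qed
  finally show ?thesis .
qed

text \<open>The family is closed under differentiation, so the induction runs over all coefficients
  at once.\<close>

lemma Ck_on_cos_sin: "Ck_on k S (\<lambda>t::real. a * cos t + b * sin t)"
proof (induction k arbitrary: a b)
  case 0
  show ?case by (auto intro!: continuous_intros)
next
  case (Suc k)
  show ?case unfolding Ck_on.simps
  proof (intro exI[of _ "\<lambda>t u. (u * b) * cos t + (- u * a) * sin t"] conjI ballI allI)
    show "Ck_on k S (\<lambda>t. (u * b) * cos t + (- u * a) * sin t)" for u by (rule Suc)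
    show "((\<lambda>t. a * cos t + b * sin t) has_derivative (\<lambda>u. (u * b) * cos t + (- u * a) * sin t)) (at t)" for t
      by (auto intro!: derivative_eq_intros simp: algebra_simps)
  qed
qed

section \<open>Critical planes and unit p-vectors\<close>

lemma alternating_form_combination:
  assumes "alternating_form p V \<omega>" "\<And>i. i < p \<Longrightarrow> v i \<in> V" "i < p" "x \<in> V" "y \<in> V"
  shows "\<omega> (v(i := a *\<^sub>R x + b *\<^sub>R y)) = a * \<omega> (v(i := x)) + b * \<omega> (v(i := y))"
  using assms unfolding alternating_form_def by blast

text \<open>The first cousin principle: rotating one vector \<open>e\<^sub>i\<close> of the frame towards a normal direction
  is a curve in the Grassmannian.\<close>

lemma critical_plane_first_cousin:
  assumes V: "subspace V"
    and hlin: "\<And>u v w a b. u \<in> V \<Longrightarrow> v \<in> V \<Longrightarrow> w \<in> V \<Longrightarrow> h (a *\<^sub>R u + b *\<^sub>R v) w = a * h u w + b * h v w"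
    and hsym: "\<And>u v. u \<in> V \<Longrightarrow> v \<in> V \<Longrightarrow> h u v = h v u"
    and hpos: "\<And>u. u \<in> V \<Longrightarrow> u \<noteq> 0 \<Longrightarrow> h u u > 0"
    and \<omega>: "alternating_form p V \<omega>" and e: "orthonormal p V h e"
    and crit: "wedge p V e \<in> critical_planes p V h \<omega>"
    and n: "n \<in> V" "\<And>j. j < p \<Longrightarrow> h n (e j) = 0" and i: "i < p"
  shows "\<omega> (e(i := n)) = 0"
proof (cases "n = 0")
  case True
  have eV: "\<And>j. j < p \<Longrightarrow> e j \<in> V" using e unfolding orthonormal_def by blast
  show ?thesis using alternating_form_combination[where v = e and a = 0 and b = 0, OF \<omega> eV i n(1) n(1)] True by simp
next
  case False
  have eV: "\<And>j. j < p \<Longrightarrow> e j \<in> V" and eon: "\<And>j k. j < p \<Longrightarrow> k < p \<Longrightarrow> h (e j) (e k) = (if j = k then 1 else 0)"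
    using e unfolding orthonormal_def by auto
  \<comment> \<open>The rotation stays among orthonormal frames only if the normal direction has
    unit length.\<close>
  define s where "s = 1 / sqrt (h n n)"
  have hn: "h n n > 0" using hpos n(1) False by blast
  define m where "m = s *\<^sub>R n"
  have mV: "m \<in> V" unfolding m_def using V n(1) by (rule subspace_scale)
  have hm: "h m w = s * h n w" if "w \<in> V" for w
    using hlin[OF n(1) n(1) that, of s 0] unfolding m_def by simp
  have hme: "h m (e j) = 0" if "j < p" for j using hm[OF eV[OF that]] n(2)[OF that] by simp
  have hem: "h (e j) m = 0" if "j < p" for j using hme[OF that] hsym[OF mV eV[OF that]] by simp
  have hmm: "h m m = 1"
  proof -
    have "h m m = s * (s * h n n)" using hm[OF mV] hm[OF n(1)] hsym[OF n(1) mV] by simp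
    also have "\<dots> = 1" unfolding s_def using hn by (simp add: field_simps)
    finally show ?thesis .
  qed
  define r where "r t = cos t *\<^sub>R e i + sin t *\<^sub>R m" for t
  have rV: "r t \<in> V" for t unfolding r_def using V eV[OF i] mV by (intro subspace_add subspace_scale)
  have hr: "h (r t) w = cos t * h (e i) w + sin t * h m w" if "w \<in> V" for t w
    unfolding r_def by (rule hlin[OF eV[OF i] mV that])
  have hrr: "h (r t) (r t) = 1" for t
  proof -
    have 1: "h (e i) (r t) = cos t" using hr[OF eV[OF i]] hsym[OF eV[OF i] rV] eon[OF i i] hme[OF i] by simp
    have 2: "h m (r t) = sin t" using hr[OF mV] hsym[OF mV rV] hem[OF i] hmm by simp
    show ?thesis unfolding hr[OF rV] 1 2 using sin_cos_squared_add[of t] by (simp add: power2_eq_square)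
  qed
  have hre: "h (r t) (e j) = 0" if "j < p" "j \<noteq> i" for t j
    using hr[OF eV[OF that(1)]] eon[OF i that(1)] hme[OF that(1)] that by simp
  have on: "orthonormal p V h (e(i := r t))" for t
    unfolding orthonormal_def
  proof (intro conjI allI impI)
    show "(e(i := r t)) j \<in> V" if "j < p" for j using that eV rV by simp
    show "h ((e(i := r t)) j) ((e(i := r t)) k) = (if j = k then 1 else 0)" if "j < p" "k < p" for j k
      using that hrr hre eon hsym[OF eV[OF that(1)] rV] by auto
  qed
  define \<gamma> where "\<gamma> t = wedge p V (e(i := r t))" for t
  \<comment> \<open>Linearity in slot \<open>i\<close> makes every coordinate of the curve a
    combination of cosine and sine; this gives both smoothness and the derivative
    \<open>\<omega> (e(i := m))\<close> at 0.\<close>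
  have val: "\<gamma> t \<eta> = \<eta> e * cos t + \<eta> (e(i := m)) * sin t" if "alternating_form p V \<eta>" for t \<eta>
    unfolding \<gamma>_def wedge_def r_def
    using alternating_form_combination[where v = e and a = "cos t" and b = "sin t", OF that eV i eV[OF i] mV] that by simp
  have "\<gamma> t \<in> Gr_o p V h" for t unfolding Gr_o_def \<gamma>_def using on by blast
  moreover have "smooth_on UNIV (\<lambda>t. \<gamma> t \<eta>)" if "alternating_form p V \<eta>" for \<eta>
    unfolding val[OF that] smooth_on_def using Ck_on_cos_sin by blast
  moreover have "\<gamma> 0 = wedge p V e" unfolding \<gamma>_def r_def by simp
  ultimately have "((\<lambda>t. \<gamma> t \<omega>) has_real_derivative 0) (at 0)"
    using crit unfolding critical_planes_def by blast
  moreover have "((\<lambda>t. \<gamma> t \<omega>) has_real_derivative \<omega> (e(i := m))) (at 0)"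
    unfolding val[OF \<omega>] by (auto intro!: derivative_eq_intros)
  ultimately have "\<omega> (e(i := m)) = 0" by (metis DERIV_unique)
  moreover have "\<omega> (e(i := m)) = s * \<omega> (e(i := n))"
    using alternating_form_combination[where v = e and a = s and b = 0, OF \<omega> eV i n(1) n(1)] unfolding m_def by simp
  ultimately show ?thesis using hn unfolding s_def by simp
qed

text \<open>The determinant of the Gram matrix with respect to the frame, as Leibniz sum.\<close>

lemma alternating_form_nonzero_on_orthonormal:
  assumes hlin: "\<And>u v w a b. u \<in> V \<Longrightarrow> v \<in> V \<Longrightarrow> w \<in> V \<Longrightarrow> h (a *\<^sub>R u + b *\<^sub>R v) w = a * h u w + b * h v w"
    and e: "orthonormal p V h e"
  shows "\<exists>\<omega>. alternating_form p V \<omega> \<and> \<omega> e = 1"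
proof -
  have eV: "\<And>j. j < p \<Longrightarrow> e j \<in> V" and eon: "\<And>j k. j < p \<Longrightarrow> k < p \<Longrightarrow> h (e j) (e k) = (if j = k then 1 else 0)"
    using e unfolding orthonormal_def by auto
  define P where "P = {\<sigma>. \<sigma> permutes {..<p}}"
  have finP: "finite P" unfolding P_def by (simp add: finite_permutations)
  have \<sigma>p: "\<sigma> k < p" if "\<sigma> \<in> P" "k < p" for \<sigma> k
    using that permutes_in_image[of \<sigma> "{..<p}" k] unfolding P_def by simp
  define leib where "leib v \<sigma> = of_int (sign \<sigma>) * (\<Prod>k<p. h (v k) (e (\<sigma> k)))" for v \<sigma>
  define \<omega> where "\<omega> v = (\<Sum>\<sigma>\<in>P. leib v \<sigma> :: real)" for v
  have "alternating_form p V \<omega>"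
    unfolding alternating_form_def
  proof (intro conjI allI impI ballI)
    fix v w :: "nat \<Rightarrow> 'a"
    assume "\<forall>i<p. v i \<in> V \<and> w i = v i"
    then show "\<omega> w = \<omega> v" unfolding \<omega>_def leib_def by simp
  next
    fix v :: "nat \<Rightarrow> 'a" and i z w a b
    assume v: "\<forall>i<p. v i \<in> V" and i: "i < p" and zw: "z \<in> V" "w \<in> V"
    have split: "leib (v(i := x)) \<sigma> = of_int (sign \<sigma>) * (h x (e (\<sigma> i)) * (\<Prod>k\<in>{..<p} - {i}. h (v k) (e (\<sigma> k))))" for x \<sigma>
    proof -
      have "(\<Prod>k<p. h ((v(i := x)) k) (e (\<sigma> k)))
        = h ((v(i := x)) i) (e (\<sigma> i)) * (\<Prod>k\<in>{..<p} - {i}. h ((v(i := x)) k) (e (\<sigma> k)))"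
        using i by (subst prod.remove[of _ i]) auto
      also have "(\<Prod>k\<in>{..<p} - {i}. h ((v(i := x)) k) (e (\<sigma> k))) = (\<Prod>k\<in>{..<p} - {i}. h (v k) (e (\<sigma> k)))"
        by (rule prod.cong) auto
      finally show ?thesis unfolding leib_def by simp
    qed
    have "leib (v(i := a *\<^sub>R z + b *\<^sub>R w)) \<sigma> = a * leib (v(i := z)) \<sigma> + b * leib (v(i := w)) \<sigma>" if "\<sigma> \<in> P" for \<sigma>
      unfolding split hlin[OF zw eV[OF \<sigma>p[OF that i]]] by (simp add: algebra_simps)
    then show "\<omega> (v(i := a *\<^sub>R z + b *\<^sub>R w)) = a * \<omega> (v(i := z)) + b * \<omega> (v(i := w))"
      unfolding \<omega>_def by (simp add: sum.distrib sum_distrib_left)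
  next
    fix v :: "nat \<Rightarrow> 'a" and i j
    assume v: "\<forall>i<p. v i \<in> V" and i: "i < p" and j: "j < p" and ij: "i \<noteq> j \<and> v i = v j"
    let ?t = "Transposition.transpose i j"
    \<comment> \<open>Composition with this transposition permutes \<open>P\<close>, keeps each
      product because \<open>v i = v j\<close>, and flips the sign, so the sum equals its own
      negative.\<close>
    have t: "?t permutes {..<p}" using i j by (intro permutes_swap_id) auto
    have vt: "v (?t k) = v k" for k using ij by (simp add: Transposition.transpose_def)
    have flip: "leib v (\<sigma> \<circ> ?t) = - leib v \<sigma>" if \<sigma>: "\<sigma> \<in> P" for \<sigma>
    proof -
      have "(\<Prod>k<p. h (v k) (e (\<sigma> k))) = (\<Prod>k<p. h (v (?t k)) (e (\<sigma> (?t k))))"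
        using prod.permute[OF t, of "\<lambda>k. h (v k) (e (\<sigma> k))"] by (simp add: o_def)
      moreover have "sign (\<sigma> \<circ> ?t) = - sign \<sigma>"
        using sign_compose[of \<sigma> ?t] \<sigma> t ij permutation_permutes[of \<sigma>] permutation_permutes[of ?t]
        unfolding P_def by (auto simp: sign_swap_id)
      ultimately show ?thesis unfolding leib_def vt by simp
    qed
    have "\<omega> v = (\<Sum>\<sigma>\<in>P. leib v (\<sigma> \<circ> ?t))"
      unfolding \<omega>_def P_def by (rule sum_permutations_compose_right[OF t])
    also have "\<dots> = - \<omega> v" unfolding \<omega>_def by (simp add: flip sum_negf)
    finally show "\<omega> v = 0" by simp
  qed
  moreover have "\<omega> e = 1"
  proof -
    have "leib e \<sigma> = (if \<sigma> = id then 1 else 0)" if \<sigma>: "\<sigma> \<in> P" for \<sigma>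
    proof (cases "\<sigma> = id")
      case True
      then show ?thesis unfolding leib_def using eon by simp
    next
      case False
      then obtain k where k: "\<sigma> k \<noteq> k" by (auto simp: fun_eq_iff)
      then have "k < p" using \<sigma> unfolding P_def permutes_def by blast
      then have "(\<Prod>k<p. h (e k) (e (\<sigma> k))) = 0"
        using k eon \<sigma>p[OF \<sigma>] by (intro prod_zero bexI[of _ k]) auto
      then show ?thesis using False unfolding leib_def by simp
    qed
    then have "\<omega> e = (\<Sum>\<sigma>\<in>P. if \<sigma> = id then 1 else 0)" unfolding \<omega>_def by simp
    also have "\<dots> = 1" using finP permutes_id[of "{..<p}"] unfolding P_def by simp
    finally show ?thesis .
  qed
  ultimately show ?thesis by blast
qed

section \<open>Minimality of critical submanifolds\<close>

lemma sum_fun_apply: "(\<Sum>i\<in>A. f i) x = (\<Sum>i\<in>A. f i x)"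
  by (induction A rule: infinite_finite_induct) auto

section \<open>Tangent planes, normal parts and the volume form\<close>

lemma incl_deriv_image:
  assumes incl: "smooth_inclusion M N" and d: "d \<in> charts_at N x" and c: "c \<in> charts_at M x"
  shows "incl_deriv M N x ` tangent_space N x = range (\<lambda>u. coord_vec M c x (dtrans d c x u))"
proof -
  have N: "smooth_manifold N" using incl unfolding smooth_inclusion_def by blast
  have 1: "incl_deriv M N x v = coord_vec M c x (dtrans d c x (v d))" if v: "v \<in> tangent_space N x" for v
    using coord_vec_tangent_vector[OF incl_deriv_tangent[OF incl charts_at_point[OF N d] v] c]
    unfolding incl_deriv_chart[OF incl d c v] by (rule sym)
  have "coord_vec M c x (dtrans d c x u) = incl_deriv M N x (coord_vec N d x u)" for u
    unfolding 1[OF coord_vec_tangent[OF N d]] coord_vec_same[OF N d] ..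
  then show ?thesis using 1 coord_vec_tangent[OF N d] by (auto simp: image_iff)
qed

lemma subspace_incl_deriv_image:
  assumes incl: "smooth_inclusion M N" and x: "x \<in> points N"
  shows "subspace (incl_deriv M N x ` tangent_space N x)"
proof -
  have M: "smooth_manifold M" and N: "smooth_manifold N" and xM: "x \<in> points M"
    using incl x unfolding smooth_inclusion_def by auto
  obtain d where d: "d \<in> charts_at N x" using charts_at_nonempty[OF N x] by blast
  obtain c where c: "c \<in> charts_at M x" using charts_at_nonempty[OF M xM] by blast
  have "linear (\<lambda>u. coord_vec M c x (dtrans d c x u))"
    using linear_compose[OF dtrans_linear[OF incl d c] coord_vec_linear[OF M c]] by (simp add: o_def)
  from linear_subspace_image[OF this subspace_UNIV] show ?thesis
    unfolding incl_deriv_image[OF incl d c] .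
qed

text \<open>Justifies the definite description in \<open>normal_part\<close>: orthogonal projection
  along the images of the basis gives existence, positivity of the metric gives uniqueness.\<close>

lemma normal_part_decomposition:
  fixes N :: "('a, 'f::euclidean_space) manifold"
  assumes g: "riemannian_manifold M g" and incl: "smooth_inclusion M N" and x: "x \<in> points N"
    and e: "orthonormal DIM('f) (tangent_space N x) (induced_metric M g N x) e"
    and z: "z \<in> tangent_space M x"
  shows "normal_part M g N x z \<in> tangent_space M x \<and>
     (\<forall>s\<in>incl_deriv M N x ` tangent_space N x. g x (normal_part M g N x z) s = 0) \<and>
     z - normal_part M g N x z \<in> incl_deriv M N x ` tangent_space N x"
proof -
  have M: "smooth_manifold M" and N: "smooth_manifold N" and xM: "x \<in> points M"
    using incl x unfolding smooth_inclusion_def by auto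
  obtain d where d: "d \<in> charts_at N x" using charts_at_nonempty[OF N x] by blast
  obtain c where c: "c \<in> charts_at M x" using charts_at_nonempty[OF M xM] by blast
  define T where "T = tangent_space M x"
  define P where "P = incl_deriv M N x ` tangent_space N x"
  define I where "I j = incl_deriv M N x (e j)" for j
  have eT: "e j \<in> tangent_space N x" if "j < DIM('f)" for j using e that unfolding orthonormal_def by blast
  have IP: "I j \<in> P" if "j < DIM('f)" for j unfolding I_def P_def using eT[OF that] by blast
  have PT: "P \<subseteq> T" unfolding P_def T_def using incl_deriv_tangent[OF incl x] by blast
  have subT: "subspace T" unfolding T_def by (rule tangent_space_subspace[OF M xM])
  have subP: "subspace P" unfolding P_def by (rule subspace_incl_deriv_image[OF incl x])
  \<comment> \<open>\<open>g x\<close> is known to be bilinear only on the tangent space; its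
    coordinate form is bilinear on the whole model space.\<close>
  define G where "G u v = coord_metric M g c u v (snd c x)" for u v
  have gG: "g x u v = G (u c) (v c)" if "u \<in> T" "v \<in> T" for u v
    unfolding G_def by (rule metric_coord[OF M c]) (use that T_def in auto)
  have lin1: "linear (\<lambda>u. G u v)" and lin2: "linear (G u)" for u v
    using coord_metric_bilinear[OF g c] unfolding bilinear_def G_def by auto
  have gdiff: "g x (u - v) w = g x u w - g x v w" if "u \<in> T" "v \<in> T" "w \<in> T" for u v w
    using that subT by (simp add: gG subspace_diff linear_diff[OF lin1])
  have Ion: "g x (I j) (I k) = (if j = k then 1 else 0)" if "j < DIM('f)" "k < DIM('f)" for j k
    using e that unfolding orthonormal_def induced_metric_def I_def by blast
  define t where "t = (\<Sum>j<DIM('f). g x z (I j) *\<^sub>R I j)"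
  have tP: "t \<in> P" unfolding t_def using IP subP by (intro subspace_sum subspace_scale) auto
  then have tT: "t \<in> T" and zT: "z \<in> T" using PT z T_def by auto
  have tc: "t c = (\<Sum>j<DIM('f). g x z (I j) *\<^sub>R I j c)"
    unfolding t_def by (simp add: sum_fun_apply scaleR_fun_def)
  have wI: "g x (z - t) (I k) = 0" if k: "k < DIM('f)" for k
  proof -
    have IT: "I j \<in> T" if "j < DIM('f)" for j using IP[OF that] PT by blast
    have "g x t (I k) = (\<Sum>j<DIM('f). g x z (I j) * G (I j c) (I k c))"
      unfolding gG[OF tT IT[OF k]] tc by (simp add: linear_sum[OF lin1] linear_cmul[OF lin1])
    also have "\<dots> = (\<Sum>j<DIM('f). if j = k then g x z (I j) else 0)"
      using Ion k by (intro sum.cong) (auto simp: gG[OF IT IT, symmetric])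
    finally show ?thesis using k by (simp add: gdiff zT tT IT)
  qed
  \<comment> \<open>Orthogonality to the images \<open>I k\<close> extends to the whole tangent
    plane, since the basis spans the coordinate space of N by duality.\<close>
  have wP: "g x (z - t) s = 0" if s: "s \<in> P" for s
  proof -
    obtain v where v: "v \<in> tangent_space N x" "s = incl_deriv M N x v" using s unfolding P_def by blast
    have wT: "z - t \<in> T" by (intro subspace_diff subT zT tT)
    define l where "l u = G ((z - t) c) (dtrans d c x u)" for u
    have linl: "linear l"
      unfolding l_def using linear_compose[OF dtrans_linear[OF incl d c] lin2] by (simp add: o_def)
    have l: "l (v d) = g x (z - t) (incl_deriv M N x v)" if "v \<in> tangent_space N x" for v
      unfolding l_def using gG[OF wT] incl_deriv_tangent[OF incl x that] incl_deriv_chart[OF incl d c that]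
      by (simp add: T_def)
    have "span ((\<lambda>j. e j d) ` {..<DIM('f)}) = UNIV"
    proof (rule dual_family_span[of "\<lambda>k u. G (dtrans d c x u) (I k c)"])
      show "linear (\<lambda>u. G (dtrans d c x u) (I k c))" for k
        using linear_compose[OF dtrans_linear[OF incl d c] lin1[of "I k c"]] by (simp add: o_def)
      fix j k assume jk: "j < DIM('f)" "k < DIM('f)"
      have "dtrans d c x (e j d) = I j c" unfolding I_def by (rule incl_deriv_chart[OF incl d c eT[OF jk(1)], symmetric])
      then show "G (dtrans d c x (e j d)) (I k c) = (if j = k then 1 else 0)"
        using gG[OF subsetD[OF PT IP[OF jk(1)]] subsetD[OF PT IP[OF jk(2)]]] Ion[OF jk] by simp
    qed
    moreover have "l y = 0" if "y \<in> (\<lambda>j. e j d) ` {..<DIM('f)}" for y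
      using that l[OF eT] wI unfolding I_def by auto
    ultimately have "l (v d) = 0" using linear_eq_0_on_span[OF linl, of "(\<lambda>j. e j d) ` {..<DIM('f)}" "v d"] by simp
    then show ?thesis using l[OF v(1)] v(2) by simp
  qed
  have "\<exists>!w. w \<in> T \<and> (\<forall>s\<in>P. g x w s = 0) \<and> z - w \<in> P"
  proof (rule ex1I[of _ "z - t"])
    show "z - t \<in> T \<and> (\<forall>s\<in>P. g x (z - t) s = 0) \<and> z - (z - t) \<in> P"
      using wP tP subspace_diff[OF subT zT tT] by simp
    fix w assume w: "w \<in> T \<and> (\<forall>s\<in>P. g x w s = 0) \<and> z - w \<in> P"
    have wtT: "w - (z - t) \<in> T" using w subspace_diff[OF subT] zT tT by blast
    have "t - (z - w) \<in> P" using subspace_diff[OF subP tP] w by blast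
    moreover have "t - (z - w) = w - (z - t)" by (simp add: algebra_simps)
    ultimately have wtP: "w - (z - t) \<in> P" by simp
    then have "g x w (w - (z - t)) = 0" "g x (z - t) (w - (z - t)) = 0" using w wP by blast+
    then have "g x (w - (z - t)) (w - (z - t)) = 0"
      using gdiff[of w "z - t" "w - (z - t)"] w wtT subspace_diff[OF subT zT tT] by simp
    then have "w - (z - t) = 0"
      using metric_pos[OF g xM wtT[unfolded T_def]] by fastforce
    then show "w = z - t" by simp
  qed
  from theI'[OF this] show ?thesis unfolding normal_part_def P_def T_def .
qed

text \<open>The coefficient in \<open>volume_form\<close> is determined because the unit p-vector is
  nonzero, as witnessed by a form with value 1 on the frame.\<close>

lemma volume_form_frame:
  fixes N :: "('a, 'f::euclidean_space) manifold"
  assumes g: "riemannian_manifold M g" and incl: "smooth_inclusion M N" and x: "x \<in> points N"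
    and e: "orthonormal DIM('f) (tangent_space N x) (induced_metric M g N x) e"
    and \<tau>: "\<tau> x = plane_vec M N x e"
  shows "volume_form M N \<tau> x e = 1"
proof -
  have xM: "x \<in> points M" using incl x unfolding smooth_inclusion_def by auto
  have "orthonormal DIM('f) (tangent_space M x) (g x) (\<lambda>i. incl_deriv M N x (e i))"
    using e incl_deriv_tangent[OF incl x] unfolding orthonormal_def induced_metric_def by blast
  then obtain \<omega> where "alternating_form DIM('f) (tangent_space M x) \<omega>" "\<omega> (\<lambda>i. incl_deriv M N x (e i)) = 1"
    using alternating_form_nonzero_on_orthonormal[of "tangent_space M x" "g x", OF metric_linear[OF g xM]] by metis
  then have \<tau>\<omega>: "\<tau> x \<omega> = 1" unfolding \<tau> plane_vec_def wedge_def by simp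
  have "a = 1" if "\<tau> x = a *\<^sub>R \<tau> x" for a
    using fun_cong[OF that, of \<omega>] \<tau>\<omega> by (simp add: scaleR_fun_def)
  then have "(THE a. \<tau> x = a *\<^sub>R \<tau> x) = 1" by (intro the_equality) auto
  then show ?thesis unfolding volume_form_def \<tau>[symmetric] .
qed

lemma alternating_form_cong:
  "alternating_form p V \<omega> \<Longrightarrow> (\<And>j. j < p \<Longrightarrow> v j \<in> V) \<Longrightarrow> (\<And>j. j < p \<Longrightarrow> w j = v j) \<Longrightarrow> \<omega> w = \<omega> v"
  unfolding alternating_form_def by simp

lemma alternating_form_pullback:
  assumes "alternating_form p V \<omega>" "linear L" "range L \<subseteq> V"
  shows "alternating_form p UNIV (\<lambda>u. \<omega> (\<lambda>i. L (u i)))"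
proof -
  have upd: "(\<lambda>j. L ((v(i := z)) j)) = (\<lambda>j. L (v j))(i := L z)" for v i z by auto
  have LV: "L z \<in> V" for z using assms(3) by blast
  show ?thesis
    unfolding alternating_form_def upd
  proof (intro conjI allI impI ballI)
    show "\<omega> (\<lambda>i. L (w i)) = \<omega> (\<lambda>i. L (v i))" if "\<forall>i<p. v i \<in> UNIV \<and> w i = v i" for v w
      using assms(1) that LV unfolding alternating_form_def by simp
    show "\<omega> ((\<lambda>j. L (v j))(i := L (a *\<^sub>R z + b *\<^sub>R w)))
      = a * \<omega> ((\<lambda>j. L (v j))(i := L z)) + b * \<omega> ((\<lambda>j. L (v j))(i := L w))" if "i < p" for v i z w a b
      unfolding linear_add[OF assms(2)] linear_cmul[OF assms(2)]
      by (rule alternating_form_combination[OF assms(1) LV that LV LV])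
    show "\<omega> (\<lambda>j. L (v j)) = 0" if "i < p" "j < p" "i \<noteq> j \<and> v i = v j" for v i j
      using assms(1) that LV unfolding alternating_form_def by metis
  qed
qed


text \<open>Transfers \<open>local_minimality\<close> to the manifold. The summand is the coordinate
  form of the covariant derivative of an extension with constant coordinates, before projection to
  the normal space.\<close>

lemma critical_submanifold_trace:
  fixes N :: "('a, 'f::euclidean_space) manifold" and M :: "('a, 'e::euclidean_space) manifold"
  assumes g: "riemannian_manifold M g" and \<phi>: "smooth_form DIM('f) M \<phi>" "parallel_form DIM('f) M g \<phi>"
    and crit: "critical_submanifold M g \<phi> N \<tau>"
    and val: "critical_value M \<phi> N \<tau> \<phi>\<^sub>o" "\<phi>\<^sub>o \<noteq> 0"
    and d: "d \<in> charts_at N x" and c: "c \<in> charts_at M x"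
    and e: "orthonormal DIM('f) (tangent_space N x) (induced_metric M g N x) e"
    and n: "n \<in> tangent_space M x" "\<And>s. s \<in> incl_deriv M N x ` tangent_space N x \<Longrightarrow> g x n s = 0"
  shows "(\<Sum>i<DIM('f). coord_metric M g c (n c)
      (d2trans d c x (e i d) (e i d) + christoffel M g c x (dtrans d c x (e i d)) (dtrans d c x (e i d))) (snd c x)) = 0"
proof -
  note M = riemannian_smooth_manifold[OF g]
  have incl: "smooth_inclusion M N"
    using crit submanifold_smooth_inclusion[OF M] unfolding critical_submanifold_def by blast
  then have N: "smooth_manifold N" unfolding smooth_inclusion_def by blast
  have x: "x \<in> points N" by (rule charts_at_point[OF N d])
  have "orientation M g N \<tau>" using crit unfolding critical_submanifold_def by blast
  then obtain W E where W: "openin (mtop N) W" "x \<in> W"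
    and Esm: "\<And>i. i < DIM('f) \<Longrightarrow> smooth_field N W (E i)"
    and Eon: "\<And>y. y \<in> W \<Longrightarrow> orthonormal DIM('f) (tangent_space N y) (induced_metric M g N y) (\<lambda>i. E i y)"
    and \<tau>: "\<And>y. y \<in> W \<Longrightarrow> \<tau> y = plane_vec M N y (\<lambda>i. E i y)"
    using x unfolding orientation_def by metis
  have ca: "d \<in> atlas N" "x \<in> fst d" "c \<in> atlas M" "x \<in> fst c"
    using c d unfolding charts_at_def by auto
  have dx: "chart_inv d (snd d x) = x" by (rule chart_inv_left[OF N ca(1,2)])
  define q where "q = snd d x"
  define F where "F = snd c \<circ> chart_inv d"
  define S where "S = snd d ` (W \<inter> fst c \<inter> fst d)"
  have Fq: "F q = snd c x" unfolding F_def q_def by (simp add: dx)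
  have S: "open S" "q \<in> S"
    unfolding S_def q_def
    using chart_image_open[OF N ca(1) inclusion_openin[OF incl chart_domain_open[OF M ca(3)] W(1)]] ca W(2) by auto
  have SE: "\<exists>z. z \<in> W \<and> d \<in> charts_at N z \<and> c \<in> charts_at M z \<and> y = snd d z \<and> chart_inv d y = z \<and> F y = snd c z"
    if "y \<in> S" for y
    using that ca chart_inv_left[OF N ca(1)] unfolding S_def F_def charts_at_def by auto
  \<comment> \<open>The frame of the orientation pushed forward to M, in the coordinates
    \<open>c\<close>; \<open>a\<close> holds its coordinates in \<open>d\<close> at the point
    itself.\<close>
  define A where "A j y = frechet_derivative F (at y) (E j (chart_inv d y) d)" for j y
  define a where "a j = E j x d" for j
  define G where "G y u v = coord_metric M g c u v (F y)" for y u v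
  define \<Gamma> where "\<Gamma> w = christoffel M g c x (dtrans d c x w)" for w
  define \<Phi> where "\<Phi> y u = coord_form M \<phi> c u (F y)" for y u
  have ET: "E j z \<in> tangent_space N z" if "z \<in> W" "j < DIM('f)" for j z
    using Eon[OF that(1)] that(2) unfolding orthonormal_def by blast
  have A_incl: "A j y = incl_deriv M N z (E j z) c"
    if "z \<in> W" "d \<in> charts_at N z" "c \<in> charts_at M z" "y = snd d z" "chart_inv d y = z" "j < DIM('f)" for j y z
    using incl_deriv_chart[OF incl that(2,3) ET[OF that(1,6)]] that(4,5) unfolding A_def F_def by simp
  have Aq: "A j q = dtrans d c x (a j)" for j unfolding A_def q_def a_def dx F_def ..
  obtain DE where DE: "\<And>j. j < DIM('f) \<Longrightarrow> ((\<lambda>y. E j (chart_inv d y) d) has_derivative DE j) (at q)"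
  proof
    fix j assume j: "j < DIM('f)"
    have "smooth_on (snd d ` (W \<inter> fst d)) (\<lambda>y. E j (chart_inv d y) d)"
      using Esm[OF j] ca(1) unfolding smooth_field_def by blast
    from smooth_on_has_derivative[OF this]
    show "((\<lambda>y. E j (chart_inv d y) d) has_derivative frechet_derivative (\<lambda>y. E j (chart_inv d y) d) (at q)) (at q)"
      unfolding q_def using W(2) ca by blast
  qed
  have lin_dt: "linear (dtrans d c x)" by (rule dtrans_linear[OF incl d c])
  \<comment> \<open>The derivative of the coefficients yields the tangential part
    \<open>\<theta>\<close>; the Hessian, once joined by the Christoffel term, yields the symmetric
    part \<open>\<sigma>\<close>.\<close>
  have dA: "(A j has_derivative (\<lambda>w. dtrans d c x (DE j w) + d2trans d c x (a j) w)) (at q)" if j: "j < DIM('f)" for j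
  proof -
    have "((\<lambda>y. frechet_derivative F (at y) (E j (chart_inv d y) d)) has_derivative
      (\<lambda>w. frechet_derivative F (at q) (DE j w) + d2trans d c x (E j (chart_inv d q) d) w)) (at q)"
    proof (rule linear_family_has_derivative[OF S _ _ DE[OF j]])
      show "linear (frechet_derivative F (at y))" if y: "y \<in> S" for y
      proof -
        obtain z where "d \<in> charts_at N z" "c \<in> charts_at M z" "y = snd d z" using SE[OF y] by blast
        then show ?thesis using dtrans_linear[OF incl] unfolding F_def by blast
      qed
      show "((\<lambda>y. frechet_derivative F (at y) u) has_derivative d2trans d c x u) (at q)" for u
        unfolding F_def q_def by (rule d2trans_has_derivative[OF incl d c])
    qed
    then show ?thesis unfolding A_def[abs_def] a_def q_def F_def dx .
  qed
  have lin\<Gamma>: "linear (\<Gamma> w)" for w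
    using christoffel_bilinear[OF g c] unfolding \<Gamma>_def bilinear_def by blast
  have Gbil: "bilinear (G y)" and Gsym: "G y u v = G y v u" if y: "y \<in> S" for y u v
  proof -
    obtain z where z: "c \<in> charts_at M z" "F y = snd c z" using SE[OF y] by blast
    show "bilinear (G y)" "G y u v = G y v u"
      using coord_metric_bilinear[OF g z(1)] coord_metric_symmetric[OF g z(1)] z(2) unfolding G_def by auto
  qed
  have G_at: "G y (u c) (v c) = g z u v"
    if "c \<in> charts_at M z" "F y = snd c z" "u \<in> tangent_space M z" "v \<in> tangent_space M z" for y z u v
    using metric_coord[OF M that(1,3,4), of g] that(2) unfolding G_def by simp
  have on: "G y (A i y) (A j y) = (if i = j then 1 else 0)"
    if y: "y \<in> S" and ij: "i < DIM('f)" "j < DIM('f)" for y i j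
  proof -
    obtain z where z: "z \<in> W" "d \<in> charts_at N z" "c \<in> charts_at M z" "y = snd d z" "chart_inv d y = z" "F y = snd c z"
      using SE[OF y] by blast
    have zN: "z \<in> points N" by (rule charts_at_point[OF N z(2)])
    show ?thesis
      unfolding A_incl[OF z(1-5) ij(1)] A_incl[OF z(1-5) ij(2)]
        G_at[OF z(3,6) incl_deriv_tangent[OF incl zN ET[OF z(1) ij(1)]] incl_deriv_tangent[OF incl zN ET[OF z(1) ij(2)]]]
      using Eon[OF z(1)] ij unfolding orthonormal_def induced_metric_def by blast
  qed
  have \<Phi>_alt: "alternating_form DIM('f) UNIV (\<Phi> y)" if y: "y \<in> S" for y
  proof -
    obtain z where z: "c \<in> charts_at M z" "F y = snd c z" using SE[OF y] by blast
    have "alternating_form DIM('f) (tangent_space M z) (\<phi> z)"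
      using \<phi>(1) charts_at_point[OF M z(1)] unfolding smooth_form_def by blast
    from alternating_form_pullback[OF this coord_vec_linear[OF M z(1)]]
    have "alternating_form DIM('f) UNIV (\<lambda>u. \<phi> z (\<lambda>i. coord_vec M c z (u i)))"
      using coord_vec_tangent[OF M z(1)] by blast
    moreover have "\<Phi> y u = \<phi> z (\<lambda>i. coord_vec M c z (u i))" for u
      unfolding \<Phi>_def coord_form_def z(2) using z(1) chart_inv_left[OF M ca(3), of z] unfolding charts_at_def by simp
    ultimately show ?thesis by presburger
  qed
  have \<Phi>_cousin: "\<Phi> y ((\<lambda>j. A j y)(i := m)) = 0"
    if y: "y \<in> S" and m: "\<forall>j<DIM('f). G y m (A j y) = 0" and i: "i < DIM('f)" for y m i
  proof -
    obtain z where z: "z \<in> W" "d \<in> charts_at N z" "c \<in> charts_at M z" "y = snd d z" "chart_inv d y = z" "F y = snd c z"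
      using SE[OF y] by blast
    have zN: "z \<in> points N" by (rule charts_at_point[OF N z(2)])
    have zM: "z \<in> points M" by (rule charts_at_point[OF M z(3)])
    define I where "I j = incl_deriv M N z (E j z)" for j
    have IT: "I j \<in> tangent_space M z" if "j < DIM('f)" for j
      unfolding I_def by (rule incl_deriv_tangent[OF incl zN ET[OF z(1) that]])
    have A: "A j y = I j c" if "j < DIM('f)" for j unfolding I_def by (rule A_incl[OF z(1-5) that])
    define \<nu> where "\<nu> = coord_vec M c z m"
    have \<nu>: "\<nu> \<in> tangent_space M z" "\<nu> c = m"
      unfolding \<nu>_def using coord_vec_tangent[OF M z(3)] coord_vec_same[OF M z(3)] by auto
    have "\<phi> z (I(i := \<nu>)) = 0"
    proof (rule critical_plane_first_cousin[where h = "g z", OF tangent_space_subspace[OF M zM] _ _ _ _ _ _ \<nu>(1) _ i])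
      show "alternating_form DIM('f) (tangent_space M z) (\<phi> z)"
        using \<phi>(1) zM unfolding smooth_form_def by blast
      show "orthonormal DIM('f) (tangent_space M z) (g z) I"
        using Eon[OF z(1)] IT unfolding orthonormal_def induced_metric_def I_def by blast
      have "\<tau> z = wedge DIM('f) (tangent_space M z) I"
        unfolding \<tau>[OF z(1)] plane_vec_def I_def ..
      then show "wedge DIM('f) (tangent_space M z) I \<in> critical_planes DIM('f) (tangent_space M z) (g z) (\<phi> z)"
        using crit zN unfolding critical_submanifold_def by metis
      show "g z \<nu> (I j) = 0" if "j < DIM('f)" for j
      proof -
        have "G y m (A j y) = 0" using m that by blast
        then show ?thesis using G_at[OF z(3,6) \<nu>(1) IT[OF that]] \<nu>(2) A[OF that] by simp
      qed
    qed (rule metric_linear[OF g zM] metric_symmetric[OF g zM] metric_pos[OF g zM]; assumption)+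
    moreover have "\<Phi> y ((\<lambda>j. A j y)(i := m)) = \<phi> z (I(i := \<nu>))"
    proof -
      have cz: "chart_inv c (snd c z) = z" using chart_inv_left[OF M ca(3)] z(3) unfolding charts_at_def by blast
      have 1: "coord_vec M c z (((\<lambda>j. A j y)(i := m)) j) = (I(i := \<nu>)) j" if "j < DIM('f)" for j
        using coord_vec_tangent_vector[OF IT[OF that] z(3)] A[OF that] unfolding \<nu>_def by simp
      have 2: "(I(i := \<nu>)) j \<in> tangent_space M z" if "j < DIM('f)" for j using IT[OF that] \<nu>(1) by simp
      have "alternating_form DIM('f) (tangent_space M z) (\<phi> z)"
        using \<phi>(1) zM unfolding smooth_form_def by blast
      then show ?thesis
        unfolding \<Phi>_def coord_form_def z(6) cz by (rule alternating_form_cong[OF _ 2 1])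
    qed
    ultimately show ?thesis by simp
  qed
  \<comment> \<open>The frame has volume 1, so the value here is \<open>\<phi>\<^sub>o\<close>; this
    is where its being nonzero enters.\<close>
  have \<Phi>_nz: "\<Phi> q (\<lambda>j. A j q) \<noteq> 0"
  proof -
    have "\<phi> x (\<lambda>i. incl_deriv M N x (E i x)) = \<phi>\<^sub>o * volume_form M N \<tau> x (\<lambda>i. E i x)"
      by (rule val(1)[unfolded critical_value_def, rule_format, OF x ET[OF W(2)]])
    also have "\<dots> = \<phi>\<^sub>o" using volume_form_frame[where \<tau> = \<tau>, OF g incl x Eon[OF W(2)] \<tau>[OF W(2)]] by simp
    finally have 1: "\<phi> x (\<lambda>i. incl_deriv M N x (E i x)) \<noteq> 0" using val(2) by simp
    have cx: "chart_inv c (snd c x) = x" by (rule chart_inv_left[OF M ca(3,4)])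
    have 2: "coord_vec M c x (A j q) = incl_deriv M N x (E j x)" if j: "j < DIM('f)" for j
    proof -
      have T: "incl_deriv M N x (E j x) \<in> tangent_space M x"
        by (rule incl_deriv_tangent[OF incl x ET[OF W(2) j]])
      have "A j q = incl_deriv M N x (E j x) c"
        unfolding Aq a_def by (rule incl_deriv_chart[OF incl d c ET[OF W(2) j], symmetric])
      then show ?thesis using coord_vec_tangent_vector[OF T c] by simp
    qed
    have 3: "incl_deriv M N x (E j x) \<in> tangent_space M x" if "j < DIM('f)" for j
      by (rule incl_deriv_tangent[OF incl x ET[OF W(2) that]])
    have "alternating_form DIM('f) (tangent_space M x) (\<phi> x)"
      using \<phi>(1) charts_at_point[OF M c] unfolding smooth_form_def by blast
    then have "\<Phi> q (\<lambda>j. A j q) = \<phi> x (\<lambda>i. incl_deriv M N x (E i x))"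
      unfolding \<Phi>_def coord_form_def Fq cx by (rule alternating_form_cong[OF _ 3 2])
    then show ?thesis using 1 by simp
  qed
  have a_on: "G q (dtrans d c x (a i)) (dtrans d c x (a j)) = (if i = j then 1 else 0)"
    if "i < DIM('f)" "j < DIM('f)" for i j
    using on[OF S(2) that] unfolding Aq .
  \<comment> \<open>The induced metric of N at \<open>x\<close> in the coordinates \<open>d\<close>;
    both \<open>a\<close> and the coordinates of \<open>e\<close> are orthonormal for it.\<close>
  define h where "h u v = G q (dtrans d c x u) (dtrans d c x v)" for u v
  have linG1: "linear (\<lambda>u. G q u v)" and linG2: "linear (G q u)" for u v
    using Gbil[OF S(2)] unfolding bilinear_def by auto
  have h_bil: "bilinear h"
    unfolding h_def bilinear_def
    using linear_compose[OF lin_dt linG1] linear_compose[OF lin_dt linG2] by (simp add: o_def)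
  have span_a: "span (a ` {..<DIM('f)}) = UNIV"
    by (rule dual_family_span[of "\<lambda>k u. h u (a k)"])
      (use h_bil a_on in \<open>auto simp: bilinear_def h_def\<close>)
  \<comment> \<open>The covariant Hessian of the inclusion in coordinates; its normal part is the
    second fundamental form.\<close>
  define \<sigma> where "\<sigma> u v = d2trans d c x u v + christoffel M g c x (dtrans d c x u) (dtrans d c x v)" for u v
  have \<sigma>_sym: "\<sigma> u v = \<sigma> v u" for u v
    unfolding \<sigma>_def using d2trans_symmetric[OF incl d c] christoffel_symmetric[OF g c] by metis
  have \<sigma>_bil: "bilinear \<sigma>"
  proof -
    have "linear (\<sigma> u)" for u
    proof -
      have "linear (christoffel M g c x (dtrans d c x u))" "linear (d2trans d c x u)"
        using christoffel_bilinear[OF g c] d2trans_bilinear[OF incl d c] unfolding bilinear_def by blast+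
      from linear_compose_add[OF this(2) linear_compose[OF lin_dt this(1)]]
      show ?thesis unfolding \<sigma>_def o_def .
    qed
    moreover from this have "linear (\<lambda>u. \<sigma> u v)" for v unfolding \<sigma>_sym[of _ v] .
    ultimately show ?thesis unfolding bilinear_def by blast
  qed
  have n_orth: "\<forall>j<DIM('f). G q (n c) (A j q) = 0"
  proof (intro allI impI)
    fix j assume j: "j < DIM('f)"
    have "A j q = incl_deriv M N x (E j x) c"
      unfolding Aq a_def by (rule incl_deriv_chart[OF incl d c ET[OF W(2) j], symmetric])
    then show "G q (n c) (A j q) = 0"
      using G_at[OF c Fq n(1) incl_deriv_tangent[OF incl x ET[OF W(2) j]]] n(2) ET[OF W(2) j] by simp
  qed
  have "(\<Sum>i<DIM('f). G q (n c) (\<sigma> (a i) (a i))) = 0"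
  proof (rule local_minimality[where A = A and \<Gamma> = \<Gamma> and \<Phi> = \<Phi> and S = S and a = a
        and \<sigma> = "\<lambda>i j. \<sigma> (a i) (a j)" and \<theta> = "\<lambda>i j. dtrans d c x (DE j (a i))",
        OF S Gbil Gsym _ lin\<Gamma> \<Phi>_alt _ dA on \<Phi>_cousin _ \<sigma>_sym _ \<Phi>_nz n_orth])
    show "((\<lambda>y. G y u v) has_derivative (\<lambda>w. G q (\<Gamma> w u) v + G q u (\<Gamma> w v))) (at q)" for u v
      unfolding G_def \<Gamma>_def F_def q_def by (rule coord_metric_pullback_derivative[OF g incl d c])
    have "(coord_form M \<phi> c u has_derivative
      (\<lambda>w. \<Sum>i<DIM('f). coord_form M \<phi> c (u(i := christoffel M g c x w (u i))) (F q))) (at (F q))" for u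
      unfolding Fq by (rule parallel_form_coord[OF g \<phi> c])
    from has_derivative_compose[OF dtrans_has_derivative[OF incl d c] this[unfolded F_def q_def]]
    show "((\<lambda>y. \<Phi> y u) has_derivative (\<lambda>w. \<Sum>i<DIM('f). \<Phi> q (u(i := \<Gamma> w (u i))))) (at q)" for u
      unfolding \<Phi>_def \<Gamma>_def F_def q_def .
    show "dtrans d c x (DE j (a i)) + d2trans d c x (a j) (a i) + \<Gamma> (a i) (A j q)
      = \<sigma> (a i) (a j) + dtrans d c x (DE j (a i))" for i j
      unfolding \<Gamma>_def \<sigma>_def Aq d2trans_symmetric[OF incl d c, of "a j" "a i"] by simp
    have "(\<lambda>j. A j q) ` {..<DIM('f)} = dtrans d c x ` a ` {..<DIM('f)}" unfolding Aq by (simp add: image_image)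
    then have "span ((\<lambda>j. A j q) ` {..<DIM('f)}) = range (dtrans d c x)"
      using linear_span_image[OF lin_dt] span_a by simp
    then show "dtrans d c x (DE j (a i)) \<in> span ((\<lambda>j. A j q) ` {..<DIM('f)})" for i j by simp
  qed
  moreover have "(\<Sum>i<DIM('f). G q (n c) (\<sigma> (a i) (a i))) = (\<Sum>i<DIM('f). G q (n c) (\<sigma> (e i d) (e i d)))"
  proof (rule trace_orthonormal_basis_independent[OF h_bil, of "\<lambda>u v. G q (n c) (\<sigma> u v)" a "\<lambda>i. e i d"])
    show "h u v = h v u" for u v unfolding h_def by (rule Gsym[OF S(2)])
    show "bilinear (\<lambda>u v. G q (n c) (\<sigma> u v))"
    proof -
      have "linear (\<sigma> u)" "linear (\<lambda>u. \<sigma> u v)" for u v using \<sigma>_bil unfolding bilinear_def by auto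
      from linear_compose[OF this(1) linG2] linear_compose[OF this(2) linG2]
      show ?thesis unfolding bilinear_def o_def by blast
    qed
    show "h (a i) (a j) = (if i = j then 1 else 0)" if "i < DIM('f)" "j < DIM('f)" for i j
      unfolding h_def by (rule a_on[OF that])
    show "h (e i d) (e j d) = (if i = j then 1 else 0)" if ij: "i < DIM('f)" "j < DIM('f)" for i j
    proof -
      have eT: "e i \<in> tangent_space N x" "e j \<in> tangent_space N x" using e ij unfolding orthonormal_def by blast+
      have "h (e i d) (e j d) = g x (incl_deriv M N x (e i)) (incl_deriv M N x (e j))"
        unfolding h_def incl_deriv_chart[OF incl d c eT(1), symmetric] incl_deriv_chart[OF incl d c eT(2), symmetric]
        by (rule G_at[OF c Fq incl_deriv_tangent[OF incl x eT(1)] incl_deriv_tangent[OF incl x eT(2)]])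
      then show ?thesis using e ij unfolding orthonormal_def induced_metric_def by simp
    qed
  qed
  ultimately show ?thesis unfolding G_def \<sigma>_def Fq by simp
qed

theorem theorem1p2:
  fixes M :: "('a, 'e::euclidean_space) manifold" and g :: "('a, 'e) metric"
    and N :: "('a, 'f::euclidean_space) manifold"
    and \<tau> :: "'a \<Rightarrow> ('a, 'e) tvec multivector"
    and \<phi> :: "('a, 'e) dform" and p :: nat and \<phi>\<^sub>o :: real
  assumes "riemannian_manifold M g"
    and "calibration p M g \<phi>" and "parallel_form p M g \<phi>"
    and "DIM('f) = p"
    and "critical_submanifold M g \<phi> N \<tau>"
    and "critical_value M \<phi> N \<tau> \<phi>\<^sub>o"
    and "\<phi>\<^sub>o \<noteq> 0"
  shows "minimal_submanifold M g N"
  unfolding minimal_submanifold_def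
proof (intro conjI ballI)
  show sub: "submanifold M N" using assms(5) unfolding critical_submanifold_def by blast
  fix x assume x: "x \<in> points N"
  note g = assms(1)
  note M = riemannian_smooth_manifold[OF g]
  note incl = submanifold_smooth_inclusion[OF M sub]
  have N: "smooth_manifold N" and xM: "x \<in> points M" using incl x unfolding smooth_inclusion_def by auto
  \<comment> \<open>The same choice as in \<open>second_fund\<close>, and \<open>e\<close> below the
    same as in \<open>mean_curvature\<close>, so that \<open>H\<close> unfolds to the definition of
    the mean curvature vector.\<close>
  define d where "d = (SOME d. d \<in> charts_at N x)"
  have d: "d \<in> charts_at N x" unfolding d_def using charts_at_nonempty[OF N x] by (rule someI_ex)
  obtain c where c: "c \<in> charts_at M x" using charts_at_nonempty[OF M xM] by blast
  define e where "e = (SOME e. orthonormal DIM('f) (tangent_space N x) (induced_metric M g N x) e)"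
  have e: "orthonormal DIM('f) (tangent_space N x) (induced_metric M g N x) e"
  proof -
    have "orientation M g N \<tau>" using assms(5) unfolding critical_submanifold_def by blast
    then have "\<exists>e. orthonormal DIM('f) (tangent_space N x) (induced_metric M g N x) e"
      using x unfolding orientation_def by blast
    then show ?thesis unfolding e_def by (rule someI_ex)
  qed
  have eT: "e i \<in> tangent_space N x" if "i < DIM('f)" for i using e that unfolding orthonormal_def by blast
  define Y where "Y i y = incl_deriv M N y (coord_vec N d y (e i d))" for i y
  define Z where "Z i = nabla M g N x (e i) (Y i)" for i
  define H where "H = (\<Sum>i<DIM('f). normal_part M g N x (Z i))"
  define P where "P = incl_deriv M N x ` tangent_space N x"
  define G where "G u v = coord_metric M g c u v (snd c x)" for u v
  have ca: "d \<in> atlas N" "x \<in> fst d" "c \<in> atlas M" "x \<in> fst c" using d c unfolding charts_at_def by auto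
  have Z: "Z i \<in> tangent_space M x"
    "Z i c = d2trans d c x (e i d) (e i d) + christoffel M g c x (dtrans d c x (e i d)) (dtrans d c x (e i d))"
    if i: "i < DIM('f)" for i
  proof -
    have Yc: "Y i z c = dtrans d c z (e i d)" if "d \<in> charts_at N z" "c \<in> charts_at M z" for z
      unfolding Y_def incl_deriv_chart[OF incl that coord_vec_tangent[OF N that(1)]] coord_vec_same[OF N that(1)] ..
    \<comment> \<open>The coordinates of the extension in \<open>d\<close> are constant, so only the
      Hessian of the inclusion appears.\<close>
    have DY: "((\<lambda>y. Y i (chart_inv d y) c) has_derivative d2trans d c x (e i d)) (at (snd d x))"
    proof (rule has_derivative_transform_within_open[OF d2trans_has_derivative[OF incl d c]])
      show "open (snd d ` (fst d \<inter> fst c))" by (rule inclusion_overlap_open[OF incl ca(1,3)])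
      show "snd d x \<in> snd d ` (fst d \<inter> fst c)" using ca by blast
      fix y assume "y \<in> snd d ` (fst d \<inter> fst c)"
      then obtain z where z: "z \<in> fst d" "z \<in> fst c" "y = snd d z" by blast
      then show "frechet_derivative (snd c \<circ> chart_inv d) (at y) (e i d) = Y i (chart_inv d y) c"
        using Yc[of z] ca chart_inv_left[OF N ca(1) z(1)] unfolding charts_at_def by simp
    qed
    show "Z i \<in> tangent_space M x"
      unfolding Z_def
    proof (rule nabla_tangent[where Y = "Y i", OF g incl d c eT[OF i] chart_domain_open[OF N ca(1)] ca(2) _ DY])
      fix y assume "y \<in> fst d"
      then have y: "d \<in> charts_at N y" using ca(1) unfolding charts_at_def by blast
      show "Y i y \<in> tangent_space M y"
        unfolding Y_def by (rule incl_deriv_tangent[OF incl charts_at_point[OF N y] coord_vec_tangent[OF N y]])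
    qed
    show "Z i c = d2trans d c x (e i d) (e i d) + christoffel M g c x (dtrans d c x (e i d)) (dtrans d c x (e i d))"
      unfolding Z_def nabla_chart[where Y = "Y i", OF incl d c eT[OF i] DY] Yc[OF d c] ..
  qed
  have np: "normal_part M g N x (Z i) \<in> tangent_space M x"
    "s \<in> P \<Longrightarrow> g x (normal_part M g N x (Z i)) s = 0" "Z i - normal_part M g N x (Z i) \<in> P"
    if i: "i < DIM('f)" for i s
    using normal_part_decomposition[OF g incl x e Z(1)[OF i]] unfolding P_def by blast+
  have subT: "subspace (tangent_space M x)" by (rule tangent_space_subspace[OF M xM])
  have PT: "P \<subseteq> tangent_space M x" unfolding P_def using incl_deriv_tangent[OF incl x] by blast
  have HT: "H \<in> tangent_space M x" unfolding H_def using np(1) by (intro subspace_sum subT) auto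
  have gG: "g x u v = G (u c) (v c)" if "u \<in> tangent_space M x" "v \<in> tangent_space M x" for u v
    unfolding G_def by (rule metric_coord[OF M c that])
  have lin1: "linear (\<lambda>u. G u v)" and lin2: "linear (G u)" for u v
    using coord_metric_bilinear[OF g c] unfolding bilinear_def G_def by auto
  have Hc: "H c = (\<Sum>i<DIM('f). normal_part M g N x (Z i) c)" unfolding H_def by (rule sum_fun_apply)
  have g_H1: "g x H v = (\<Sum>i<DIM('f). g x (normal_part M g N x (Z i)) v)" if v: "v \<in> tangent_space M x" for v
    unfolding gG[OF HT v] Hc linear_sum[OF lin1] using gG[OF np(1) v] by simp
  have HP: "g x H s = 0" if "s \<in> P" for s
    using g_H1[of s] np(2) that PT by auto
  \<comment> \<open>\<open>H\<close> is normal, so pairing with it ignores the tangential part and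
    the projections can be removed.\<close>
  have "G (H c) (normal_part M g N x (Z i) c) = G (H c) (Z i c)" if i: "i < DIM('f)" for i
  proof -
    have "g x H (Z i - normal_part M g N x (Z i)) = 0" by (rule HP[OF np(3)[OF i]])
    then have "G (H c) (Z i c - normal_part M g N x (Z i) c) = 0"
      using gG[OF HT] np(3)[OF i] PT by (metis fun_diff_def subsetD)
    then show ?thesis by (simp add: linear_diff[OF lin2])
  qed
  then have "g x H H = (\<Sum>i<DIM('f). G (H c) (Z i c))"
    unfolding gG[OF HT HT] by (subst (2) Hc) (simp add: linear_sum[OF lin2])
  also have "\<dots> = (\<Sum>i<DIM('f). G (H c)
      (d2trans d c x (e i d) (e i d) + christoffel M g c x (dtrans d c x (e i d)) (dtrans d c x (e i d))))"
    using Z(2) by simp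
  also have "\<dots> = 0"
    unfolding G_def
  proof (rule critical_submanifold_trace[OF g _ _ assms(5,6,7) d c e HT])
    show "smooth_form DIM('f) M \<phi>" "parallel_form DIM('f) M g \<phi>"
      using assms(2,3,4) unfolding calibration_def by auto
    show "g x H s = 0" if "s \<in> incl_deriv M N x ` tangent_space N x" for s
      using HP that unfolding P_def by blast
  qed
  finally have "H = 0" using metric_pos[OF g xM HT] by fastforce
  then show "mean_curvature M g N x = 0"
    unfolding mean_curvature_def Let_def second_fund_def e_def[symmetric] d_def[symmetric]
    unfolding H_def Z_def Y_def .
qed

end
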